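(* Let $a<b$ be real numbers and let $(X(t),\,a\le t\le b)$ be a centered Gaussian process with continuous sample paths and covariance function $R_{\mathbf X}(s,t)=E[X(s)X(t)]$. Let $$\sigma_*^2(a,b)=\min_{\nu\in M_1[a,b]}\int_{[a,b]}\int_{[a,b]}R_{\mathbf X}(s,t)\,\nu(ds)\,\nu(dt),$$ with $\sigma_*^2(a,b)>0$, and suppose that an optimal measure $\nu_*$ in this optimization problem has full support in $[a,b]$. Suppose that there exists a function $\sigma:[0,\infty)\to[0,\infty)$ satisfying $$\lim_{h\downarrow 0}h^{-\beta}\sigma(h)=c\in(0,\infty)$$ for some $\beta>0$, such that $$E\left[(X(t)-X(s))^2\right]\le\sigma(|t-s|)^2,\qquad s,t\in[a,b].$$ Then $$\liminf_{u\to\infty}u^{-1/(\beta+1)}\left(\log P\Bigl(\min_{t\in[a,b]}X(t)>u\Bigr)+\frac{1}{2\sigma_*^2(a,b)}u^2\right)>-\infty.$$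
   Context: $M_1[a,b]$ denotes the set of all Borel probability measures on $[a,b]$. An optimal measure is a measure in $M_1[a,b]$ attaining the minimum. A measure has full support in $[a,b]$ if its (topological) support is all of $[a,b]$. The number $\sigma_*^2(a,b)$ is unrelated to the function $\sigma$. *)

theory Defs
  imports "HOL-Probability.Probability"
begin

text \<open>Univariate normal law with mean \<open>m\<close> and standard deviation \<open>s\<close>. The library's
  \<^const>\<open>normal_density\<close> only describes the case \<open>s > 0\<close>; as usual for Gaussian processes,
  the degenerate law (a point mass) counts as Gaussian.\<close>

definition normal_law :: "real \<Rightarrow> real \<Rightarrow> real measure" where
  "normal_law m s = (if s = 0 then return borel m else density lborel (normal_density m s))"

definition gaussian_rv :: "'w measure \<Rightarrow> ('w \<Rightarrow> real) \<Rightarrow> bool" where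
  "gaussian_rv M Y \<longleftrightarrow> Y \<in> borel_measurable M \<and> (\<exists>m s. 0 \<le> s \<and> distr M borel Y = normal_law m s)"

text \<open>Joint normality of all finite-dimensional distributions, in the standard form that every
  finite linear combination is normal.\<close>

definition gaussian_process :: "'w measure \<Rightarrow> 'i set \<Rightarrow> ('i \<Rightarrow> 'w \<Rightarrow> real) \<Rightarrow> bool" where
  "gaussian_process M T X \<longleftrightarrow>
     (\<forall>J c. finite J \<and> J \<subseteq> T \<longrightarrow> gaussian_rv M (\<lambda>\<omega>. \<Sum>t\<in>J. c t * X t \<omega>))"

definition centered_gaussian_process :: "'w measure \<Rightarrow> 'i set \<Rightarrow> ('i \<Rightarrow> 'w \<Rightarrow> real) \<Rightarrow> bool" where
  "centered_gaussian_process M T X \<longleftrightarrow>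
     gaussian_process M T X \<and> (\<forall>t\<in>T. integral\<^sup>L M (X t) = 0)"

text \<open>Since the process is centered, no means are subtracted.\<close>

definition cov_fun :: "'w measure \<Rightarrow> ('i \<Rightarrow> 'w \<Rightarrow> real) \<Rightarrow> 'i \<Rightarrow> 'i \<Rightarrow> real" where
  "cov_fun M X s t = (\<integral>\<omega>. X s \<omega> * X t \<omega> \<partial>M)"

definition M1 :: "real \<Rightarrow> real \<Rightarrow> real measure set" where
  "M1 a b = {\<nu>. prob_space \<nu> \<and> sets \<nu> = sets (restrict_space borel {a..b})}"

definition energy :: "(real \<Rightarrow> real \<Rightarrow> real) \<Rightarrow> real measure \<Rightarrow> real" where
  "energy R \<nu> = (\<integral>t. (\<integral>s. R s t \<partial>\<nu>) \<partial>\<nu>)"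

definition optimal_measure :: "(real \<Rightarrow> real \<Rightarrow> real) \<Rightarrow> real \<Rightarrow> real \<Rightarrow> real measure \<Rightarrow> bool" where
  "optimal_measure R a b \<nu> \<longleftrightarrow> is_arg_min (energy R) (\<lambda>\<mu>. \<mu> \<in> M1 a b) \<nu>"

text \<open>The value of the minimization problem. The infimum is a minimum exactly when an optimal
  measure exists.\<close>

definition sigma_star_sq :: "(real \<Rightarrow> real \<Rightarrow> real) \<Rightarrow> real \<Rightarrow> real \<Rightarrow> real" where
  "sigma_star_sq R a b = (INF \<nu>\<in>M1 a b. energy R \<nu>)"

definition measure_support :: "'a::topological_space measure \<Rightarrow> 'a set" where
  "measure_support \<nu> = {x \<in> space \<nu>. \<forall>U. open U \<and> x \<in> U \<longrightarrow> emeasure \<nu> (U \<inter> space \<nu>) > 0}"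

text \<open>Logarithm with \<open>log 0 = -\<infinity>\<close>; the library's real \<^const>\<open>ln\<close> has \<open>ln 0 = 0\<close>, which would
  turn a lower bound on the log-probability of a null event into a true statement.\<close>

definition ext_ln :: "real \<Rightarrow> ereal" where
  "ext_ln p = (if p \<le> 0 then -\<infinity> else ereal (ln p))"

end

theory Submission
  imports Defs
begin

text \<open>
  Let \<open>\<nu>\<close> be the minimising measure, \<open>v\<close> the minimal energy, and \<open>Y = \<integral> X t \<nu>(dt)\<close>, a
  centered Gaussian variable of variance \<open>v\<close>. Because \<open>\<nu>\<close> is a minimiser, the potential
  \<open>t \<mapsto> E[X t * Y]\<close> equals \<open>v\<close> almost everywhere with respect to \<open>\<nu>\<close>; it is continuous and
  \<open>\<nu>\<close> has full support, so it equals \<open>v\<close> on the whole interval (lemma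
  \<open>potential_constant\<close>). Hence every \<open>Z t = X t - Y\<close> is uncorrelated with \<open>Y\<close>, and by joint
  normality the process \<open>Z\<close> is independent of \<open>Y\<close>. If \<open>Y > u + 2 \<epsilon>\<close> and \<open>\<bar>Z\<bar> \<le> \<epsilon>\<close> throughout,
  then \<open>X > u\<close> throughout, so the probability in question is at least
  \<open>P(Y > u + 2 \<epsilon>) * P(sup \<bar>Z\<bar> \<le> \<epsilon>)\<close>.

  The first factor is a one-dimensional Gaussian tail; its logarithm is
  \<open>- u\<^sup>2 / (2 v)\<close> up to a loss of order \<open>u \<epsilon>\<close>. The second factor is at least
  \<open>exp (- C \<epsilon> powr (- 1 / \<beta>))\<close> by Talagrand's small ball estimate, lemma \<open>small_ball\<close>, as the
  increments of \<open>Z\<close> are those of \<open>X\<close>. The choice \<open>\<epsilon> = u powr (- \<beta> / (\<beta> + 1))\<close> makes both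
  losses of order \<open>u powr (1 / (\<beta> + 1))\<close>, which is the claim.

  The small ball estimate comes from dyadic chaining: \<open>\<bar>Z\<bar>\<close> is small if all dyadic increments
  of level \<open>j\<close> stay below a threshold \<open>\<alpha> j\<close>, with \<open>\<Sum>j. \<alpha> j \<le> \<epsilon>\<close>. The increments are
  dependent, but Sidak's inequality (lemma \<open>sidak\<close>) bounds the joint probability from below by
  the product of the individual ones. A union bound would lose a logarithmic factor and
  with it the exact order of the remainder.

  Sidak's inequality rests on Anderson's: shifting a symmetric intersection of slabs along a
  line away from the origin decreases its Gaussian measure. This follows from the midpoint
  Prekopa-Leindler inequality, proved here first on the line, from the Brunn-Minkowski
  inequality for compact sets of reals, and then for finite products by induction.

  Joint normality is handled through the locale \<open>gaussian_space\<close>: a linear space of square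
  integrable variables with the Gaussian characteristic function. Independence enters as the
  statement that conditioning on an event determined by one member leaves the orthogonal
  complement Gaussian with the same covariances (lemma \<open>conditional_gaussian_space\<close>), which
  needs only the uniqueness theorem for characteristic functions on the line.
\<close>

section \<open>The midpoint Prekopa-Leindler inequality\<close>

lemma emeasure_lborel_affine_half:
  fixes S :: "real set"
  assumes "S \<in> sets borel"
  shows "emeasure lborel {y. (t + y) / 2 \<in> S} = 2 * emeasure lborel S"
proof -
  have m: "{y. (t + y) / 2 \<in> S} \<in> sets borel"
  proof -
    have "(\<lambda>y. (t + y) / 2) \<in> borel_measurable borel" by measurable
    from measurable_sets[OF this assms] show ?thesis by (simp add: vimage_def)
  qed
  have "emeasure lborel S = emeasure (density (distr lborel borel (\<lambda>x. t/2 + (1/2) * x)) (\<lambda>_. ennreal \<bar>1/2\<bar>)) S"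
    using lborel_real_affine[of "1/2" "t/2"] by simp
  also have "\<dots> = ennreal (1/2) * emeasure (distr lborel borel (\<lambda>x. t/2 + (1/2) * x)) S"
    using assms by (subst emeasure_density_const) auto
  also have "emeasure (distr lborel borel (\<lambda>x. t/2 + (1/2) * x)) S = emeasure lborel {y. (t + y) / 2 \<in> S}"
    using assms by (subst emeasure_distr) (auto simp: vimage_def add_divide_distrib)
  finally have "2 * emeasure lborel S = 2 * ennreal (1/2) * emeasure lborel {y. (t + y) / 2 \<in> S}"
    by (simp add: mult.assoc)
  moreover have "2 * ennreal (1/2) = 1"
    by (metis ennreal_1 ennreal_mult' ennreal_numeral nonzero_mult_div_cancel_left
        times_divide_eq_right zero_le_numeral zero_neq_numeral mult.right_neutral)
  ultimately show ?thesis by simp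
qed

text \<open>Pairing every point of \<^term>\<open>A\<close> with the least point of \<^term>\<open>B\<close>, and every point
  of \<^term>\<open>B\<close> with the greatest point of \<^term>\<open>A\<close>, produces two half-size copies of the
  sets that meet in a single point.\<close>

lemma emeasure_midpoints_compact:
  fixes A B C :: "real set"
  assumes A: "compact A" "A \<noteq> {}" and B: "compact B" "B \<noteq> {}" and C: "C \<in> sets borel"
    and mid: "\<And>x y. x \<in> A \<Longrightarrow> y \<in> B \<Longrightarrow> (x + y) / 2 \<in> C"
  shows "emeasure lborel A + emeasure lborel B \<le> 2 * emeasure lborel C"
proof -
  obtain \<alpha> where \<alpha>: "\<alpha> \<in> A" "\<And>x. x \<in> A \<Longrightarrow> x \<le> \<alpha>"
    using compact_attains_sup[OF A] by blast
  obtain \<gamma> where \<gamma>: "\<gamma> \<in> B" "\<And>x. x \<in> B \<Longrightarrow> \<gamma> \<le> x"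
    using compact_attains_inf[OF B] by blast
  define p where "p = (\<alpha> + \<gamma>) / 2"
  have Ab: "A \<in> sets borel" and Bb: "B \<in> sets borel"
    using A B by (auto intro: borel_compact)
  have "emeasure lborel A = emeasure lborel (A - {\<alpha>})"
    using Ab by (subst emeasure_Diff_null_set) auto
  also have "\<dots> \<le> emeasure lborel {y. (\<gamma> + y) / 2 \<in> C \<inter> {..<p}}"
  proof (rule emeasure_mono)
    show "A - {\<alpha>} \<subseteq> {y. (\<gamma> + y) / 2 \<in> C \<inter> {..<p}}"
    proof
      fix x assume x: "x \<in> A - {\<alpha>}"
      then have "x < \<alpha>" using \<alpha>(2)[of x] by auto
      then show "x \<in> {y. (\<gamma> + y) / 2 \<in> C \<inter> {..<p}}"
        using mid[of x \<gamma>] x \<gamma>(1) by (auto simp: p_def add.commute)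
    qed
    have "(\<lambda>y. (\<gamma> + y) / 2) \<in> borel_measurable borel" by measurable
    from measurable_sets[OF this, of "C \<inter> {..<p}"] C
    show "{y. (\<gamma> + y) / 2 \<in> C \<inter> {..<p}} \<in> sets lborel" by (simp add: vimage_def)
  qed
  also have "\<dots> = 2 * emeasure lborel (C \<inter> {..<p})"
    using C by (intro emeasure_lborel_affine_half) auto
  finally have 1: "emeasure lborel A \<le> 2 * emeasure lborel (C \<inter> {..<p})" .
  have "emeasure lborel B \<le> emeasure lborel {y. (\<alpha> + y) / 2 \<in> C \<inter> {p..}}"
  proof (rule emeasure_mono)
    show "B \<subseteq> {y. (\<alpha> + y) / 2 \<in> C \<inter> {p..}}"
      using mid[OF \<alpha>(1)] \<gamma>(2) by (auto simp: p_def)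
    have "(\<lambda>y. (\<alpha> + y) / 2) \<in> borel_measurable borel" by measurable
    from measurable_sets[OF this, of "C \<inter> {p..}"] C
    show "{y. (\<alpha> + y) / 2 \<in> C \<inter> {p..}} \<in> sets lborel" by (simp add: vimage_def)
  qed
  also have "\<dots> = 2 * emeasure lborel (C \<inter> {p..})"
    using C by (intro emeasure_lborel_affine_half) auto
  finally have 2: "emeasure lborel B \<le> 2 * emeasure lborel (C \<inter> {p..})" .
  have "emeasure lborel (C \<inter> {..<p}) + emeasure lborel (C \<inter> {p..})
      = emeasure lborel ((C \<inter> {..<p}) \<union> (C \<inter> {p..}))"
    using C by (intro plus_emeasure) auto
  also have "(C \<inter> {..<p}) \<union> (C \<inter> {p..}) = C" by auto
  finally have "2 * emeasure lborel (C \<inter> {..<p}) + 2 * emeasure lborel (C \<inter> {p..}) = 2 * emeasure lborel C"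
    by (simp flip: distrib_left)
  with 1 2 show ?thesis by (metis add_mono)
qed

lemma compact_inner_approx:
  fixes A :: "real set"
  assumes A: "A \<in> sets borel" "A \<noteq> {}" and r: "r < emeasure lborel A"
  obtains K where "compact K" "K \<noteq> {}" "K \<subseteq> A" "r < emeasure lborel K"
proof -
  have inc: "incseq (\<lambda>n. A \<inter> {-real n..real n})"
    by (auto simp: incseq_def)
  have "(\<Union>n. A \<inter> {-real n..real n}) = A"
  proof -
    have "\<exists>n. x \<in> {-real n..real n}" for x
      by (metis abs_le_iff atLeastAtMost_iff minus_le_iff real_arch_simple)
    then show ?thesis by auto
  qed
  then have "(SUP n. emeasure lborel (A \<inter> {-real n..real n})) = emeasure lborel A"
    using SUP_emeasure_incseq[OF _ inc, of lborel] A by (simp add: image_subset_iff)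
  then obtain n where n: "r < emeasure lborel (A \<inter> {-real n..real n})"
    using r less_SUP_iff[of r "\<lambda>n. emeasure lborel (A \<inter> {-real n..real n})" UNIV] by auto
  define A' where "A' = A \<inter> {-real n..real n}"
  have A': "A' \<in> sets borel" using A by (auto simp: A'_def)
  have fin: "emeasure lborel A' < \<infinity>"
    by (rule le_less_trans[OF emeasure_mono[of _ "{-real n..real n}"]]) (auto simp: A'_def)
  have rfin: "r < top" using n by (auto simp: top.not_eq_extremum[symmetric])
  define d where "d = enn2real (emeasure lborel A') - enn2real r"
  have rr: "r = ennreal (enn2real r)" using rfin by simp
  have AA: "emeasure lborel A' = ennreal (enn2real (emeasure lborel A'))" using fin by simp
  have d: "d > 0"
    using n fin unfolding d_def A'_def[symmetric]
    by (subst (asm) rr, subst (asm) AA) (simp add: ennreal_less_iff)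
  have "A' \<in> sets lebesgue" using A' by auto
  from sets_lebesgue_inner_closed[OF this d] obtain T where T: "closed T" "T \<subseteq> A'"
    "A' - T \<in> lmeasurable" "emeasure lebesgue (A' - T) < ennreal d" by auto
  have Tb: "T \<in> sets borel" using T by auto
  have "emeasure lborel A' = emeasure lborel (T \<union> (A' - T))"
    using T(2) by (simp add: Un_absorb1)
  also have "\<dots> \<le> emeasure lborel T + emeasure lborel (A' - T)"
    using A' Tb by (intro emeasure_subadditive) auto
  finally have split: "emeasure lborel A' \<le> emeasure lborel T + emeasure lborel (A' - T)" .
  have e: "emeasure lborel (A' - T) < ennreal d"
    using T A' Tb by (simp add: emeasure_completion)
  have "r < emeasure lborel T"
  proof (rule ccontr)
    assume "\<not> r < emeasure lborel T"
    then have le: "emeasure lborel T \<le> r" by simp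
    have "emeasure lborel A' \<le> r + emeasure lborel (A' - T)"
      using split le by (meson add_right_mono order_trans)
    also have "\<dots> < r + ennreal d"
      using e rfin by (simp add: ennreal_add_left_cancel_less)
    also have "r + ennreal d = ennreal (enn2real r + d)"
      using d by (subst rr) (simp add: ennreal_plus)
    also have "\<dots> = emeasure lborel A'" using AA by (simp add: d_def)
    finally show False by simp
  qed
  moreover have "compact T"
  proof -
    have "bounded T" by (rule bounded_subset[of "{-real n..real n}"]) (use T(2) in \<open>auto simp: A'_def\<close>)
    then show ?thesis using T(1) compact_eq_bounded_closed by blast
  qed
  moreover have "T \<noteq> {}" using calculation(1) by auto
  ultimately show ?thesis using that[of T] T(2) by (auto simp: A'_def)
qed

lemma ennreal_lessThan_ne: "c \<noteq> 0 \<Longrightarrow> {..<c::ennreal} \<noteq> {}"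
  by (metis empty_iff lessThan_iff zero_less_iff_neq_zero)

text \<open>Inner regularity passes from compact to Borel sets. A set of measure zero has no compact subsets
of positive measure to approximate it with; in that case the midpoints of the other set with a
single point suffice.\<close>

lemma emeasure_midpoints:
  fixes A B C :: "real set"
  assumes A: "A \<in> sets borel" "A \<noteq> {}" and B: "B \<in> sets borel" "B \<noteq> {}" and C: "C \<in> sets borel"
    and mid: "\<And>x y. x \<in> A \<Longrightarrow> y \<in> B \<Longrightarrow> (x + y) / 2 \<in> C"
  shows "emeasure lborel A + emeasure lborel B \<le> 2 * emeasure lborel C"
proof -
  have *: "r + s \<le> 2 * emeasure lborel C" if r: "r < emeasure lborel A" and s: "s < emeasure lborel B" for r s
  proof -
    obtain K where K: "compact K" "K \<noteq> {}" "K \<subseteq> A" "r < emeasure lborel K"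
      using compact_inner_approx[OF A r] .
    obtain L where L: "compact L" "L \<noteq> {}" "L \<subseteq> B" "s < emeasure lborel L"
      using compact_inner_approx[OF B s] .
    have "r + s \<le> emeasure lborel K + emeasure lborel L"
      using K(4) L(4) by (intro add_mono) auto
    also have "\<dots> \<le> 2 * emeasure lborel C"
      using K L mid by (intro emeasure_midpoints_compact[OF K(1,2) L(1,2) C]) auto
    finally show ?thesis .
  qed
  have single: "emeasure lborel D \<le> 2 * emeasure lborel C"
    if D: "D \<in> sets borel" "D \<noteq> {}" "\<exists>z. \<forall>x\<in>D. (x + z) / 2 \<in> C" for D
  proof -
    obtain z where z: "\<forall>x\<in>D. (x + z) / 2 \<in> C" using D(3) by auto
    have "emeasure lborel D \<le> emeasure lborel {y. (z + y) / 2 \<in> C}"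
    proof (rule emeasure_mono)
      show "D \<subseteq> {y. (z + y) / 2 \<in> C}" using z by (auto simp: add.commute)
      have "(\<lambda>y. (z + y) / 2) \<in> borel_measurable borel" by measurable
      from measurable_sets[OF this C] show "{y. (z + y) / 2 \<in> C} \<in> sets lborel" by (simp add: vimage_def)
    qed
    then show ?thesis using emeasure_lborel_affine_half[OF C] by simp
  qed
  obtain x0 y0 where xy0: "x0 \<in> A" "y0 \<in> B" using A(2) B(2) by auto
  have sA: "emeasure lborel A \<le> 2 * emeasure lborel C"
    using single[OF A] mid xy0 by blast
  have sB: "emeasure lborel B \<le> 2 * emeasure lborel C"
    using single[OF B] mid xy0 by (metis add.commute)
  consider "emeasure lborel A = 0" | "emeasure lborel B = 0"
    | "emeasure lborel A \<noteq> 0" "emeasure lborel B \<noteq> 0" by auto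
  then show ?thesis
  proof cases
    case 3
    have "emeasure lborel A + s \<le> 2 * emeasure lborel C" if s: "s < emeasure lborel B" for s
    proof -
      have "emeasure lborel A + s = (SUP r\<in>{..<emeasure lborel A}. r) + s"
        by (metis Sup_lessThan image_ident)
      also have "\<dots> = (SUP r\<in>{..<emeasure lborel A}. r + s)"
        using 3 by (intro ennreal_SUP_add_left[symmetric]) (simp_all add: ennreal_lessThan_ne)
      also have "\<dots> \<le> 2 * emeasure lborel C"
        using *[OF _ s] by (intro SUP_least) auto
      finally show ?thesis .
    qed
    then have "(SUP s\<in>{..<emeasure lborel B}. emeasure lborel A + s) \<le> 2 * emeasure lborel C"
      by (intro SUP_least) auto
    moreover have "(SUP s\<in>{..<emeasure lborel B}. emeasure lborel A + s)
        = emeasure lborel A + (SUP s\<in>{..<emeasure lborel B}. s)"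
      using 3 by (intro ennreal_SUP_add_right[symmetric]) (simp_all add: ennreal_lessThan_ne)
    ultimately show ?thesis by (metis Sup_lessThan image_ident)
  qed (use sA sB in auto)
qed

lemma nn_integral_superlevel:
  fixes f :: "real \<Rightarrow> real"
  assumes f[measurable]: "f \<in> borel_measurable borel" and nn: "\<And>x. f x \<ge> 0"
  shows "(\<integral>\<^sup>+x. ennreal (f x) \<partial>lborel)
    = (\<integral>\<^sup>+t. emeasure lborel {x. t < f x} * indicator {0<..} t \<partial>lborel)"
proof -
  have "(\<integral>\<^sup>+x. ennreal (f x) \<partial>lborel) = (\<integral>\<^sup>+x. (\<integral>\<^sup>+t. indicator {0<..<f x} t \<partial>lborel) \<partial>lborel)"
    using nn by (intro nn_integral_cong) auto
  also have "\<dots> = (\<integral>\<^sup>+x. (\<integral>\<^sup>+t. indicator {0<..} t * indicator {x. t < f x} x \<partial>lborel) \<partial>lborel)"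
    by (intro nn_integral_cong) (auto split: split_indicator)
  also have "\<dots> = (\<integral>\<^sup>+t. (\<integral>\<^sup>+x. indicator {0<..} t * indicator {x. t < f x} x \<partial>lborel) \<partial>lborel)"
    by (rule lborel_pair.Fubini'[symmetric]) measurable
  also have "\<dots> = (\<integral>\<^sup>+t. emeasure lborel {x. t < f x} * indicator {0<..} t \<partial>lborel)"
    by (intro nn_integral_cong, subst nn_integral_cmult) (auto simp: mult.commute)
  finally show ?thesis .
qed

lemma ennreal_am_gm: "x + y \<le> 2 * z \<Longrightarrow> x * y \<le> z * (z::ennreal)"
proof -
  assume a: "x + y \<le> 2 * z"
  show ?thesis
  proof (cases "z = top")
    case True then show ?thesis by simp
  next
    case False
    then have "2 * z < top" by (simp add: ennreal_mult_less_top less_top)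
    then have "x + y < top" using a by (rule le_less_trans[rotated])
    then have xt: "x < top" and yt: "y < top" by (auto)
    obtain x' y' z' where e: "x = ennreal x'" "y = ennreal y'" "z = ennreal z'"
      and nn: "x' \<ge> 0" "y' \<ge> 0" "z' \<ge> 0"
      using xt yt False by (metis ennreal_cases less_irrefl)
    have "x + y = ennreal (x' + y')" using nn e by simp
    moreover have "2 * z = ennreal (2 * z')" using nn e by (simp add: ennreal_mult)
    ultimately have "ennreal (x' + y') \<le> ennreal (2 * z')" using a by simp
    then have "x' + y' \<le> 2 * z'" using nn by (simp add: ennreal_le_iff del: ennreal_plus)
    then have s: "(x' + y')^2 \<le> (2 * z')^2" using nn by (intro power_mono) auto
    have "x' * y' \<le> z' * z'" using s sum_power2_ge_zero[of "x' - y'" 0]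
      by (simp add: power2_eq_square algebra_simps)
    then show ?thesis using nn e by (simp flip: ennreal_mult)
  qed
qed

text \<open>With both suprema equal to \<open>1\<close>, the superlevel sets of \<^term>\<open>f\<close> and \<^term>\<open>g\<close> are
nonempty at exactly the same levels, so the inequality for midpoint sets applies level by level. It
bounds the sum of the integrals, and the inequality of arithmetic and geometric means turns
the sum into a product.\<close>

lemma prekopa_leindler_normalised:
  fixes f g h :: "real \<Rightarrow> real"
  assumes [measurable]: "f \<in> borel_measurable borel" "g \<in> borel_measurable borel" "h \<in> borel_measurable borel"
    and nn: "\<And>x. f x \<ge> 0" "\<And>x. g x \<ge> 0" "\<And>x. h x \<ge> 0"
    and sup: "(SUP x. f x) = 1" "(SUP x. g x) = 1" "\<And>x. f x \<le> 1" "\<And>x. g x \<le> 1"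
    and mid: "\<And>x y. f x * g y \<le> (h ((x + y) / 2))\<^sup>2"
  shows "(\<integral>\<^sup>+x. f x \<partial>lborel) * (\<integral>\<^sup>+x. g x \<partial>lborel) \<le> (\<integral>\<^sup>+x. h x \<partial>lborel) * (\<integral>\<^sup>+x. h x \<partial>lborel)"
proof (rule ennreal_am_gm)
  have m1: "(\<lambda>t. emeasure lborel {x. t < k x}) \<in> borel_measurable lborel"
    if [measurable]: "k \<in> borel_measurable borel" for k :: "real \<Rightarrow> real"
  proof -
    have "{p \<in> space (borel \<Otimes>\<^sub>M borel). fst p < k (snd p)} \<in> sets (borel \<Otimes>\<^sub>M borel)" by measurable
    then have "{p. fst p < k (snd p)} \<in> sets (lborel \<Otimes>\<^sub>M lborel)"
      by (simp add: space_pair_measure cong: sets_pair_measure_cong)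
    from lborel.measurable_emeasure_Pair[OF this] show ?thesis by (simp add: vimage_def)
  qed
  note [measurable] = m1
  have lev: "emeasure lborel {x. t < f x} + emeasure lborel {x. t < g x} \<le> 2 * emeasure lborel {x. t < h x}"
    if t: "t > 0" for t
  proof (cases "t < 1")
    case True
    have "bdd_above (range f)" "bdd_above (range g)"
      using sup(3,4) by (auto intro!: bdd_aboveI[of _ 1])
    then have "\<exists>x. t < f x" "\<exists>x. t < g x"
      using True sup less_cSUP_iff[of UNIV f t] less_cSUP_iff[of UNIV g t]
      by auto
    moreover have "t < h ((x + y) / 2)" if "t < f x" "t < g y" for x y
    proof -
      have "t^2 < f x * g y" using that t unfolding power2_eq_square
        by (intro mult_strict_mono) auto
      also have "\<dots> \<le> (h ((x + y) / 2))\<^sup>2" by (rule mid)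
      finally show ?thesis using nn(3) by (rule power_less_imp_less_base)
    qed
    ultimately show ?thesis
      by (intro emeasure_midpoints) auto
  next
    case False
    then have "{x. t < f x} = {}" "{x. t < g x} = {}"
      using sup(3,4) by (auto simp: not_less intro: order_trans)
    then show ?thesis by simp
  qed
  have "(\<integral>\<^sup>+x. f x \<partial>lborel) + (\<integral>\<^sup>+x. g x \<partial>lborel)
    = (\<integral>\<^sup>+t. emeasure lborel {x. t < f x} * indicator {0<..} t \<partial>lborel)
      + (\<integral>\<^sup>+t. emeasure lborel {x. t < g x} * indicator {0<..} t \<partial>lborel)"
    using nn by (simp add: nn_integral_superlevel)
  also have "\<dots> = (\<integral>\<^sup>+t. (emeasure lborel {x. t < f x} + emeasure lborel {x. t < g x}) * indicator {0<..} t \<partial>lborel)"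
    by (subst nn_integral_add[symmetric]) (auto simp: distrib_right)
  also have "\<dots> \<le> (\<integral>\<^sup>+t. 2 * (emeasure lborel {x. t < h x} * indicator {0<..} t) \<partial>lborel)"
    using lev by (intro nn_integral_mono) (auto split: split_indicator)
  also have "\<dots> = 2 * (\<integral>\<^sup>+t. emeasure lborel {x. t < h x} * indicator {0<..} t \<partial>lborel)"
    by (rule nn_integral_cmult) measurable
  also have "\<dots> = 2 * (\<integral>\<^sup>+x. h x \<partial>lborel)"
    using nn by (simp add: nn_integral_superlevel)
  finally show "(\<integral>\<^sup>+x. f x \<partial>lborel) + (\<integral>\<^sup>+x. g x \<partial>lborel) \<le> 2 * (\<integral>\<^sup>+x. h x \<partial>lborel)" .
qed

lemma prekopa_leindler:
  fixes f g h :: "real \<Rightarrow> real"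
  assumes [measurable]: "f \<in> borel_measurable borel" "g \<in> borel_measurable borel" "h \<in> borel_measurable borel"
    and nn: "\<And>x. f x \<ge> 0" "\<And>x. g x \<ge> 0" "\<And>x. h x \<ge> 0"
    and bd: "\<And>x. f x \<le> B" "\<And>x. g x \<le> B"
    and mid: "\<And>x y. f x * g y \<le> (h ((x + y) / 2))\<^sup>2"
  shows "(\<integral>\<^sup>+x. f x \<partial>lborel) * (\<integral>\<^sup>+x. g x \<partial>lborel) \<le> (\<integral>\<^sup>+x. h x \<partial>lborel) * (\<integral>\<^sup>+x. h x \<partial>lborel)"
proof -
  define F where "F = (SUP x. f x)"
  define G where "G = (SUP x. g x)"
  have bF: "bdd_above (range f)" and bG: "bdd_above (range g)"
    using bd by (auto intro!: bdd_aboveI[of _ B])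
  have fF: "f x \<le> F" and gG: "g x \<le> G" for x
    using bF bG by (auto simp: F_def G_def intro!: cSUP_upper)
  have F0: "F \<ge> 0" "G \<ge> 0" using fF[of 0] gG[of 0] nn(1)[of 0] nn(2)[of 0] by linarith+
  show ?thesis
  proof (cases "F = 0 \<or> G = 0")
    case True
    then have "(\<forall>x. f x = 0) \<or> (\<forall>x. g x = 0)"
      using fF gG nn by (metis antisym)
    then show ?thesis by auto
  next
    case False
    then have FG: "F > 0" "G > 0" using F0 by auto
    define f' g' h' where "f' = (\<lambda>x. f x / F)" and "g' = (\<lambda>x. g x / G)" and "h' = (\<lambda>x. h x / sqrt (F * G))"
    have sc: "(SUP x. k x / K) = 1" if "K = (SUP x. k x)" "K > 0" "bdd_above (range k)" for k :: "real \<Rightarrow> real" and K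
    proof (rule antisym)
      show "(SUP x. k x / K) \<le> 1"
        using that cSUP_upper[OF _ that(3)] by (intro cSUP_least) (auto simp: divide_le_eq_1)
      have bdd: "bdd_above (range (\<lambda>x. k x / K))"
        using cSUP_upper[OF _ that(3)] that by (intro bdd_aboveI[of _ 1]) (auto simp: divide_le_eq_1)
      have "K \<le> K * (SUP x. k x / K)"
        unfolding that(1)
      proof (rule cSUP_least, simp)
        fix x
        have "k x / K \<le> (SUP x. k x / K)" using bdd by (intro cSUP_upper) auto
        then show "k x \<le> (SUP x. k x) * (SUP x. k x / (SUP x. k x))"
          using that(2) unfolding that(1) by (simp add: divide_le_eq mult.commute)
      qed
      then show "1 \<le> (SUP x. k x / K)" using that(2) by simp
    qed
    have "(\<integral>\<^sup>+x. f' x \<partial>lborel) * (\<integral>\<^sup>+x. g' x \<partial>lborel) \<le> (\<integral>\<^sup>+x. h' x \<partial>lborel) * (\<integral>\<^sup>+x. h' x \<partial>lborel)"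
    proof (rule prekopa_leindler_normalised)
      show "(SUP x. f' x) = 1" "(SUP x. g' x) = 1"
        unfolding f'_def g'_def using FG bF bG by (auto intro!: sc simp: F_def G_def)
      show "f' x * g' y \<le> (h' ((x + y) / 2))\<^sup>2" for x y
        using mid[of x y] FG by (simp add: f'_def g'_def h'_def power_divide divide_right_mono)
    qed (use FG fF gG nn in \<open>auto simp: f'_def g'_def h'_def divide_le_eq_1\<close>)
    note main = this
    have f: "(\<integral>\<^sup>+x. f x \<partial>lborel) = F * (\<integral>\<^sup>+x. f' x \<partial>lborel)"
      using FG nn by (subst nn_integral_cmult[symmetric]) (auto simp: f'_def simp flip: ennreal_mult)
    have g: "(\<integral>\<^sup>+x. g x \<partial>lborel) = G * (\<integral>\<^sup>+x. g' x \<partial>lborel)"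
      using FG nn by (subst nn_integral_cmult[symmetric]) (auto simp: g'_def simp flip: ennreal_mult)
    have h: "(\<integral>\<^sup>+x. h x \<partial>lborel) = sqrt (F * G) * (\<integral>\<^sup>+x. h' x \<partial>lborel)"
      using FG nn by (subst nn_integral_cmult[symmetric]) (auto simp: h'_def simp flip: ennreal_mult)
    have FG': "ennreal F * ennreal G = ennreal (sqrt (F * G)) * ennreal (sqrt (F * G))"
      using FG by (simp flip: ennreal_mult)
    have "(\<integral>\<^sup>+x. f x \<partial>lborel) * (\<integral>\<^sup>+x. g x \<partial>lborel)
      = (ennreal F * ennreal G) * ((\<integral>\<^sup>+x. f' x \<partial>lborel) * (\<integral>\<^sup>+x. g' x \<partial>lborel))"
      unfolding f g by (rule mult.assoc[THEN trans]) (simp only: mult_ac)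
    also have "\<dots> \<le> (ennreal F * ennreal G) * ((\<integral>\<^sup>+x. h' x \<partial>lborel) * (\<integral>\<^sup>+x. h' x \<partial>lborel))"
      by (rule mult_left_mono[OF main]) simp
    also have "\<dots> = (\<integral>\<^sup>+x. h x \<partial>lborel) * (\<integral>\<^sup>+x. h x \<partial>lborel)"
      unfolding h FG' by (simp only: mult_ac)
    finally show ?thesis .
  qed
qed

abbreviation std_normal :: "real measure" where
  "std_normal \<equiv> density lborel (\<lambda>x. ennreal (std_normal_density x))"

lemma prob_space_std_normal: "prob_space std_normal"
  by (rule prob_space_normal_density) simp

text \<open>The normal density is log-concave, so multiplying by it preserves the hypothesis.\<close>

lemma prekopa_leindler_std_normal:
  fixes f g h :: "real \<Rightarrow> real"
  assumes [measurable]: "f \<in> borel_measurable borel" "g \<in> borel_measurable borel" "h \<in> borel_measurable borel"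
    and nn: "\<And>x. f x \<in> {0..1}" "\<And>x. g x \<in> {0..1}" "\<And>x. h x \<in> {0..1}"
    and mid: "\<And>x y. f x * g y \<le> (h ((x + y) / 2))\<^sup>2"
  shows "(\<integral>x. f x \<partial>std_normal) * (\<integral>x. g x \<partial>std_normal) \<le> (\<integral>x. h x \<partial>std_normal)\<^sup>2"
proof -
  interpret prob_space std_normal by (rule prob_space_std_normal)
  let ?\<rho> = std_normal_density
  have int: "integrable std_normal k"
    if "k \<in> borel_measurable borel" "\<And>x. k x \<in> {0..1}" for k :: "real \<Rightarrow> real"
    using that by (intro integrable_const_bound[of _ 1]) auto
  have conv: "(\<integral>\<^sup>+x. ennreal (?\<rho> x * k x) \<partial>lborel) = ennreal (\<integral>x. k x \<partial>std_normal)"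
    if [measurable]: "k \<in> borel_measurable borel" and k: "\<And>x. k x \<in> {0..1}" for k :: "real \<Rightarrow> real"
  proof -
    have "(\<integral>\<^sup>+x. ennreal (?\<rho> x * k x) \<partial>lborel) = (\<integral>\<^sup>+x. ennreal (k x) \<partial>std_normal)"
      by (subst nn_integral_density) (auto simp: ennreal_mult')
    also have "\<dots> = ennreal (\<integral>x. k x \<partial>std_normal)"
      using k by (intro nn_integral_eq_integral int) auto
    finally show ?thesis .
  qed
  have \<rho>: "?\<rho> x * ?\<rho> y \<le> (?\<rho> ((x + y) / 2))\<^sup>2" for x y
  proof -
    have "?\<rho> x * ?\<rho> y = (1 / sqrt (2 * pi))\<^sup>2 * exp (- (x\<^sup>2 + y\<^sup>2) / 2)"
      by (simp add: std_normal_density_def power2_eq_square exp_add[symmetric] add_divide_distrib)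
    also have "\<dots> \<le> (1 / sqrt (2 * pi))\<^sup>2 * exp (- ((x + y) / 2)\<^sup>2)"
    proof -
      have "((x + y) / 2)\<^sup>2 \<le> (x\<^sup>2 + y\<^sup>2) / 2"
        using zero_le_power2[of "x - y"] by (simp add: power2_eq_square field_simps)
      then show ?thesis by (intro mult_left_mono) auto
    qed
    also have "\<dots> = (?\<rho> ((x + y) / 2))\<^sup>2"
    proof -
      have "exp (- ((x + y) / 2)\<^sup>2) = (exp (- ((x + y) / 2)\<^sup>2 / 2))\<^sup>2"
        unfolding power2_eq_square[of "exp _"] by (simp flip: exp_add)
      then show ?thesis by (simp add: std_normal_density_def power_mult_distrib power_divide)
    qed
    finally show ?thesis .
  qed
  have \<rho>1: "?\<rho> x \<le> 1" for x
  proof -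
    have "1 / sqrt (2 * pi) \<le> 1" using pi_gt3 by (simp add: divide_le_eq)
    moreover have "exp (- x\<^sup>2 / 2) \<le> 1" by simp
    ultimately show ?thesis unfolding std_normal_density_def by (intro mult_le_one) auto
  qed
  have "(\<integral>\<^sup>+x. ennreal (?\<rho> x * f x) \<partial>lborel) * (\<integral>\<^sup>+x. ennreal (?\<rho> x * g x) \<partial>lborel)
     \<le> (\<integral>\<^sup>+x. ennreal (?\<rho> x * h x) \<partial>lborel) * (\<integral>\<^sup>+x. ennreal (?\<rho> x * h x) \<partial>lborel)"
  proof (rule prekopa_leindler[where B = 1])
    fix x y
    have "?\<rho> x * f x * (?\<rho> y * g y) = (?\<rho> x * ?\<rho> y) * (f x * g y)" by (simp add: ac_simps)
    also have "\<dots> \<le> (?\<rho> ((x + y) / 2))\<^sup>2 * (h ((x + y) / 2))\<^sup>2"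
      using nn by (intro mult_mono \<rho> mid) (auto intro: mult_nonneg_nonneg)
    finally show "?\<rho> x * f x * (?\<rho> y * g y) \<le> (?\<rho> ((x + y) / 2) * h ((x + y) / 2))\<^sup>2"
      by (simp add: power_mult_distrib)
  qed (use nn \<rho>1 in \<open>auto intro!: mult_nonneg_nonneg mult_le_one\<close>)
  then have "ennreal (\<integral>x. f x \<partial>std_normal) * ennreal (\<integral>x. g x \<partial>std_normal)
     \<le> ennreal (\<integral>x. h x \<partial>std_normal) * ennreal (\<integral>x. h x \<partial>std_normal)"
    using nn by (simp add: conv)
  moreover have "(\<integral>x. f x \<partial>std_normal) \<ge> 0" "(\<integral>x. g x \<partial>std_normal) \<ge> 0" "(\<integral>x. h x \<partial>std_normal) \<ge> 0"
    using nn by (auto intro!: integral_nonneg_AE)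
  ultimately show ?thesis by (simp add: power2_eq_square flip: ennreal_mult)
qed

text \<open>The inequality tensorises: integrating out one coordinate turns the hypothesis for
  \<^term>\<open>insert i I\<close> into the hypothesis for \<^term>\<open>I\<close>.\<close>

lemma prekopa_leindler_PiM_std_normal:
  fixes f g h :: "('i \<Rightarrow> real) \<Rightarrow> real"
  assumes "finite I"
    and "f \<in> borel_measurable (PiM I (\<lambda>_. std_normal))" "g \<in> borel_measurable (PiM I (\<lambda>_. std_normal))"
      "h \<in> borel_measurable (PiM I (\<lambda>_. std_normal))"
    and "\<And>x. f x \<in> {0..1}" "\<And>x. g x \<in> {0..1}" "\<And>x. h x \<in> {0..1}"
    and "\<And>x y. x \<in> extensional I \<Longrightarrow> y \<in> extensional I \<Longrightarrow>
       f x * g y \<le> (h (\<lambda>i\<in>I. (x i + y i) / 2))\<^sup>2"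
  shows "(\<integral>x. f x \<partial>PiM I (\<lambda>_. std_normal)) * (\<integral>x. g x \<partial>PiM I (\<lambda>_. std_normal))
     \<le> (\<integral>x. h x \<partial>PiM I (\<lambda>_. std_normal))\<^sup>2"
  using assms
proof (induction I arbitrary: f g h rule: finite_induct)
  case empty
  have "(\<lambda>i\<in>{}. (undefined + undefined) / 2) = (\<lambda>_. undefined :: real)"
    by (simp add: restrict_def)
  with empty(7)[of "\<lambda>_. undefined" "\<lambda>_. undefined"] show ?case
    by (simp add: PiM_empty lebesgue_integral_count_space_finite)
next
  case (insert i I)
  interpret N: prob_space std_normal by (rule prob_space_std_normal)
  interpret product_sigma_finite "\<lambda>_::'i. std_normal"
    by (rule product_sigma_finite.intro) (rule N.sigma_finite_measure_axioms)
  interpret P: prob_space "PiM (insert i I) (\<lambda>_. std_normal)"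
    by (rule prob_space_PiM) (rule prob_space_std_normal)
  have int: "integrable (PiM (insert i I) (\<lambda>_. std_normal)) k"
    if "k \<in> borel_measurable (PiM (insert i I) (\<lambda>_. std_normal))" "\<And>x. k x \<in> {0..1}" for k :: "('i \<Rightarrow> real) \<Rightarrow> real"
    using that by (intro P.integrable_const_bound[of _ 1]) auto
  have fub: "(\<integral>x. k x \<partial>PiM (insert i I) (\<lambda>_. std_normal))
      = (\<integral>x. (\<integral>y. k (x(i := y)) \<partial>std_normal) \<partial>PiM I (\<lambda>_. std_normal))"
    if "k \<in> borel_measurable (PiM (insert i I) (\<lambda>_. std_normal))" "\<And>x. k x \<in> {0..1}" for k :: "('i \<Rightarrow> real) \<Rightarrow> real"
    using insert.hyps that by (intro product_integral_insert int) auto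
  have meas_pair: "(\<lambda>(x, y). k (x(i := y))) \<in> borel_measurable (PiM I (\<lambda>_. std_normal) \<Otimes>\<^sub>M std_normal)"
    if [measurable]: "k \<in> borel_measurable (PiM (insert i I) (\<lambda>_. std_normal))" for k :: "('i \<Rightarrow> real) \<Rightarrow> real"
    by measurable
  define \<Phi> where "\<Phi> k x = (if x \<in> extensional I then \<integral>y. k (x(i := y)) \<partial>std_normal else 0)"
    for k :: "('i \<Rightarrow> real) \<Rightarrow> real" and x
  have ext: "(\<integral>x. (\<integral>y. k (x(i := y)) \<partial>std_normal) \<partial>PiM I (\<lambda>_. std_normal)) = (\<integral>x. \<Phi> k x \<partial>PiM I (\<lambda>_. std_normal))"
    for k by (intro Bochner_Integration.integral_cong) (auto simp: \<Phi>_def space_PiM PiE_def)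
  have meas: "\<Phi> k \<in> borel_measurable (PiM I (\<lambda>_. std_normal))"
    if [measurable]: "k \<in> borel_measurable (PiM (insert i I) (\<lambda>_. std_normal))" for k :: "('i \<Rightarrow> real) \<Rightarrow> real"
  proof -
    have "(\<lambda>x. \<integral>y. k (x(i := y)) \<partial>std_normal) \<in> borel_measurable (PiM I (\<lambda>_. std_normal))"
      using meas_pair[OF that] by (intro N.borel_measurable_lebesgue_integral) auto
    then show ?thesis
      by (subst measurable_cong) (auto simp: \<Phi>_def space_PiM PiE_def)
  qed
  have meas1: "(\<lambda>y. k (x(i := y))) \<in> borel_measurable borel"
    if "k \<in> borel_measurable (PiM (insert i I) (\<lambda>_. std_normal))" "x \<in> extensional I" for k :: "('i \<Rightarrow> real) \<Rightarrow> real" and x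
  proof -
    have "x \<in> space (PiM I (\<lambda>_. std_normal))" using that by (auto simp: space_PiM PiE_def)
    from measurable_compose[OF measurable_Pair1'[OF this] meas_pair[OF that(1)]] show ?thesis by simp
  qed
  have bds: "\<Phi> k x \<in> {0..1}"
    if k: "k \<in> borel_measurable (PiM (insert i I) (\<lambda>_. std_normal))" "\<And>x. k x \<in> {0..1}" for k :: "('i \<Rightarrow> real) \<Rightarrow> real" and x
  proof (cases "x \<in> extensional I")
    case True
    have i: "integrable std_normal (\<lambda>y. k (x(i := y)))"
      using meas1[OF k(1) True] k(2) by (intro N.integrable_const_bound[of _ 1]) auto
    have "(\<integral>y. k (x(i := y)) \<partial>std_normal) \<le> (\<integral>y. 1 \<partial>std_normal)"
      using i k(2) by (intro integral_mono) auto
    moreover have "(\<integral>y. k (x(i := y)) \<partial>std_normal) \<ge> 0"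
      using k(2) by (intro integral_nonneg_AE) auto
    ultimately show ?thesis using True by (simp add: \<Phi>_def N.prob_space[simplified])
  qed (simp add: \<Phi>_def)
  show ?case
    unfolding fub[OF insert.prems(1,4)] fub[OF insert.prems(2,5)] fub[OF insert.prems(3,6)] ext
  proof (rule insert.IH)
    fix x y :: "'i \<Rightarrow> real" assume xy: "x \<in> extensional I" "y \<in> extensional I"
    let ?z = "\<lambda>j\<in>I. (x j + y j) / 2"
    have z: "?z \<in> extensional I" by simp
    have "(\<integral>s. f (x(i := s)) \<partial>std_normal) * (\<integral>s. g (y(i := s)) \<partial>std_normal)
       \<le> (\<integral>s. h (?z(i := s)) \<partial>std_normal)\<^sup>2"
    proof (rule prekopa_leindler_std_normal)
      fix s t
      have "f (x(i := s)) * g (y(i := t)) \<le> (h (\<lambda>j\<in>insert i I. ((x(i := s)) j + (y(i := t)) j) / 2))\<^sup>2"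
        using xy by (intro insert.prems(7)) (auto simp: extensional_def)
      also have "(\<lambda>j\<in>insert i I. ((x(i := s)) j + (y(i := t)) j) / 2) = ?z(i := (s + t) / 2)"
        using insert.hyps by (auto simp: fun_eq_iff)
      finally show "f (x(i := s)) * g (y(i := t)) \<le> (h (?z(i := (s + t) / 2)))\<^sup>2" .
    qed (use insert.prems xy z in \<open>auto intro!: meas1\<close>)
    then show "\<Phi> f x * \<Phi> g y \<le> (\<Phi> h ?z)\<^sup>2" using xy by (simp add: \<Phi>_def)
  qed (use insert.prems in \<open>auto intro!: meas bds simp del: atLeastAtMost_iff\<close>)
qed

section \<open>Sidak's inequality for slabs in a product of standard normal laws\<close>

text \<open>A gap of \<^term>\<open>S\<close> around \<^term>\<open>x\<close> would contain the midpoint of its two end points.\<close>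

lemma midpoint_closed_interval:
  fixes S :: "real set"
  assumes "closed S" and mid: "\<And>s t. s \<in> S \<Longrightarrow> t \<in> S \<Longrightarrow> (s + t) / 2 \<in> S"
    and "u \<in> S" "v \<in> S" "u \<le> x" "x \<le> v"
  shows "x \<in> S"
proof (rule ccontr)
  assume x: "x \<notin> S"
  have c1: "compact (S \<inter> {u..x})" and c2: "compact (S \<inter> {x..v})"
    using assms(1) by (auto intro: closed_Int_compact)
  have n1: "S \<inter> {u..x} \<noteq> {}" and n2: "S \<inter> {x..v} \<noteq> {}"
    using assms by auto
  obtain l where l: "l \<in> S" "l \<le> x" "\<And>s. s \<in> S \<Longrightarrow> u \<le> s \<Longrightarrow> s \<le> x \<Longrightarrow> s \<le> l" "u \<le> l"
    using compact_attains_sup[OF c1 n1] by auto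
  obtain r where r: "r \<in> S" "x \<le> r" "\<And>s. s \<in> S \<Longrightarrow> s \<le> v \<Longrightarrow> x \<le> s \<Longrightarrow> r \<le> s" "r \<le> v"
    using compact_attains_inf[OF c2 n2] by auto
  have lr: "l < x" "x < r" using l r x by (metis order_le_less)+
  have m: "(l + r) / 2 \<in> S" using mid l r by auto
  show False
  proof (cases "(l + r) / 2 \<le> x")
    case True
    then have "(l + r) / 2 \<le> l" using l m lr by (intro l(3)) auto
    then show False using lr by auto
  next
    case False
    then have "r \<le> (l + r) / 2" using r m lr by (intro r(3)) auto
    then show False using lr by auto
  qed
qed

lemma std_normal_uminus: "distr std_normal borel uminus = std_normal"
proof -
  have "distr std_normal borel uminus = distr (density lborel (\<lambda>x. ennreal (std_normal_density (- x)))) borel uminus"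
    by (simp add: std_normal_density_def)
  also have "\<dots> = density (distr lborel borel uminus) (\<lambda>x. ennreal (std_normal_density x))"
    by (subst density_distr) auto
  finally show ?thesis by (simp add: lborel_distr_uminus)
qed

lemma PiM_std_normal_uminus:
  assumes "finite I"
  shows "distr (PiM I (\<lambda>_. std_normal)) (PiM I (\<lambda>_. std_normal)) (\<lambda>w. \<lambda>i\<in>I. - w i)
    = PiM I (\<lambda>_. std_normal)"
proof -
  interpret N: prob_space std_normal by (rule prob_space_std_normal)
  interpret product_sigma_finite "\<lambda>_::'a. std_normal"
    by (rule product_sigma_finite.intro) (rule N.sigma_finite_measure_axioms)
  show ?thesis
  proof (rule PiM_eqI[OF assms])
    fix A :: "'a \<Rightarrow> real set" assume A: "\<And>i. i \<in> I \<Longrightarrow> A i \<in> sets std_normal"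
    have m: "(\<lambda>w. \<lambda>i\<in>I. - w i) \<in> measurable (PiM I (\<lambda>_. std_normal)) (PiM I (\<lambda>_. std_normal))"
      by measurable
    have mA: "uminus -` A i \<in> sets borel" if "i \<in> I" for i
    proof -
      have "(uminus :: real \<Rightarrow> real) \<in> borel_measurable borel" by measurable
      from measurable_sets[OF this, of "A i"] A[OF that] show ?thesis by simp
    qed
    have "emeasure (distr (PiM I (\<lambda>_. std_normal)) (PiM I (\<lambda>_. std_normal)) (\<lambda>w. \<lambda>i\<in>I. - w i)) (Pi\<^sub>E I A)
      = emeasure (PiM I (\<lambda>_. std_normal)) (Pi\<^sub>E I (\<lambda>i. uminus -` A i))"
      using A assms m
      by (subst emeasure_distr[OF m sets_PiM_I_finite])
         (auto intro!: arg_cong[where f="emeasure _"] simp: space_PiM PiE_def Pi_def)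
    also have "\<dots> = (\<Prod>i\<in>I. emeasure std_normal (uminus -` A i))"
      using assms mA by (subst emeasure_PiM) auto
    also have "\<dots> = (\<Prod>i\<in>I. emeasure std_normal (A i))"
    proof (rule prod.cong[OF refl])
      fix i assume "i \<in> I"
      have "emeasure std_normal (A i) = emeasure (distr std_normal borel uminus) (A i)"
        by (simp add: std_normal_uminus)
      also have "\<dots> = emeasure std_normal (uminus -` A i)"
        using A[OF \<open>i \<in> I\<close>] by (subst emeasure_distr) auto
      finally show "emeasure std_normal (uminus -` A i) = emeasure std_normal (A i)" by simp
    qed
    finally show "emeasure (distr (PiM I (\<lambda>_. std_normal)) (PiM I (\<lambda>_. std_normal)) (\<lambda>w. \<lambda>i\<in>I. - w i)) (Pi\<^sub>E I A)
      = (\<Prod>i\<in>I. emeasure std_normal (A i))" .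
  qed simp
qed

text \<open>With the coordinates in \<^term>\<open>I\<close> random, this is the section at \<^term>\<open>x\<close> of an
  intersection of slabs in one more dimension; \<^term>\<open>c\<close> holds the coefficients of the extra
  coordinate.\<close>

definition slabs :: "'i set \<Rightarrow> 'k set \<Rightarrow> ('k \<Rightarrow> 'i \<Rightarrow> real) \<Rightarrow> ('k \<Rightarrow> real) \<Rightarrow> ('k \<Rightarrow> real) \<Rightarrow> real \<Rightarrow> ('i \<Rightarrow> real) set" where
  "slabs I L A c t x = {w \<in> extensional I. \<forall>k\<in>L. \<bar>c k * x + (\<Sum>j\<in>I. A k j * w j)\<bar> \<le> t k}"

lemma slabs_measurable:
  assumes "finite I" "finite L"
  shows "slabs I L A c t x \<in> sets (PiM I (\<lambda>_. std_normal))"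
proof -
  have "slabs I L A c t x = {w \<in> space (PiM I (\<lambda>_. std_normal)). \<forall>k\<in>L. \<bar>c k * x + (\<Sum>j\<in>I. A k j * w j)\<bar> \<le> t k}"
    by (auto simp: slabs_def space_PiM PiE_def)
  also have "\<dots> \<in> sets (PiM I (\<lambda>_. std_normal))"
    using assms by measurable
  finally show ?thesis .
qed

context
  fixes I :: "'i set" and L :: "'k set" and A :: "'k \<Rightarrow> 'i \<Rightarrow> real" and c t :: "'k \<Rightarrow> real"
  assumes fin: "finite I" "finite L"
begin

lemma slab_prob_midpoint:
  "measure (PiM I (\<lambda>_. std_normal)) (slabs I L A c t x) * measure (PiM I (\<lambda>_. std_normal)) (slabs I L A c t y)
    \<le> (measure (PiM I (\<lambda>_. std_normal)) (slabs I L A c t ((x + y) / 2)))\<^sup>2"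
proof -
  note m[measurable] = slabs_measurable[OF fin, of A c t]
  have "(\<integral>w. indicator (slabs I L A c t x) w \<partial>PiM I (\<lambda>_. std_normal)) * (\<integral>w. indicator (slabs I L A c t y) w \<partial>PiM I (\<lambda>_. std_normal))
     \<le> (\<integral>w. indicator (slabs I L A c t ((x + y) / 2)) w \<partial>PiM I (\<lambda>_. std_normal) :: real)\<^sup>2"
  proof (rule prekopa_leindler_PiM_std_normal[OF fin(1)])
    fix v w :: "'i \<Rightarrow> real"
    let ?z = "\<lambda>i\<in>I. (v i + w i) / 2"
    have "?z \<in> slabs I L A c t ((x + y) / 2)" if "v \<in> slabs I L A c t x" "w \<in> slabs I L A c t y"
    proof -
      have "\<bar>c k * ((x + y) / 2) + (\<Sum>j\<in>I. A k j * ?z j)\<bar> \<le> t k" if k: "k \<in> L" for k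
      proof -
        have e: "c k * ((x + y) / 2) + (\<Sum>j\<in>I. A k j * ?z j)
          = ((c k * x + (\<Sum>j\<in>I. A k j * v j)) + (c k * y + (\<Sum>j\<in>I. A k j * w j))) / 2"
          by (simp add: sum_divide_distrib[symmetric] distrib_left sum.distrib add_divide_distrib)
        have "\<bar>c k * x + (\<Sum>j\<in>I. A k j * v j)\<bar> \<le> t k" "\<bar>c k * y + (\<Sum>j\<in>I. A k j * w j)\<bar> \<le> t k"
          using \<open>v \<in> _\<close> \<open>w \<in> _\<close> k by (auto simp: slabs_def)
        then show ?thesis unfolding e by (auto simp: abs_le_iff)
      qed
      then show ?thesis by (auto simp: slabs_def)
    qed
    then show "indicator (slabs I L A c t x) v * indicator (slabs I L A c t y) w
        \<le> (indicator (slabs I L A c t ((x + y) / 2)) ?z :: real)\<^sup>2"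
      by (auto split: split_indicator)
  qed (auto split: split_indicator)
  then show ?thesis by simp
qed

lemma slab_prob_uminus:
  "measure (PiM I (\<lambda>_. std_normal)) (slabs I L A c t (- x)) = measure (PiM I (\<lambda>_. std_normal)) (slabs I L A c t x)"
proof -
  note m[measurable] = slabs_measurable[OF fin, of A c t]
  have "measure (PiM I (\<lambda>_. std_normal)) (slabs I L A c t x)
    = measure (distr (PiM I (\<lambda>_. std_normal)) (PiM I (\<lambda>_. std_normal)) (\<lambda>w. \<lambda>i\<in>I. - w i)) (slabs I L A c t x)"
    by (simp add: PiM_std_normal_uminus[OF fin(1)])
  also have "\<dots> = measure (PiM I (\<lambda>_. std_normal)) ((\<lambda>w. \<lambda>i\<in>I. - w i) -` slabs I L A c t x \<inter> space (PiM I (\<lambda>_. std_normal)))"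
    by (rule measure_distr) measurable
  also have "(\<lambda>w. \<lambda>i\<in>I. - w i) -` slabs I L A c t x \<inter> space (PiM I (\<lambda>_. std_normal)) = slabs I L A c t (- x)"
  proof -
    have "\<bar>c k * x - s\<bar> = \<bar>s - c k * x\<bar>" for k s by simp
    then show ?thesis
      by (auto simp: slabs_def space_PiM PiE_def sum_negf)
  qed
  finally show ?thesis ..
qed

text \<open>The probability is upper semicontinuous in the shift because the slabs are closed.\<close>

lemma slab_prob_superlevel_closed:
  "closed {x. p \<le> measure (PiM I (\<lambda>_. std_normal)) (slabs I L A c t x)}"
  unfolding closed_sequential_limits
proof (intro allI impI, elim conjE)
  interpret P: prob_space "PiM I (\<lambda>_. std_normal)"
    by (rule prob_space_PiM) (rule prob_space_std_normal)
  note m[measurable] = slabs_measurable[OF fin, of A c t]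
  fix z x assume z: "\<forall>n. z n \<in> {x. p \<le> measure (PiM I (\<lambda>_. std_normal)) (slabs I L A c t x)}"
    and lim: "z \<longlonglongrightarrow> x"
  define U where "U n = (\<Union>k\<in>{n..}. slabs I L A c t (z k))" for n :: nat
  have Um[measurable]: "U n \<in> sets (PiM I (\<lambda>_. std_normal))" for n unfolding U_def by measurable
  have dec: "decseq U" by (fastforce simp: decseq_def U_def)
  have "p \<le> P.prob (U n)" for n
  proof -
    have "p \<le> P.prob (slabs I L A c t (z n))" using z by auto
    also have "\<dots> \<le> P.prob (U n)" by (rule P.finite_measure_mono) (auto simp: U_def)
    finally show ?thesis .
  qed
  moreover have "(\<lambda>n. P.prob (U n)) \<longlonglongrightarrow> P.prob (\<Inter>n. U n)"
    by (rule P.finite_Lim_measure_decseq) (use dec in auto)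
  ultimately have "p \<le> P.prob (\<Inter>n. U n)"
    by (intro LIMSEQ_le_const) auto
  also have "\<dots> \<le> P.prob (slabs I L A c t x)"
  proof (rule P.finite_measure_mono)
    show "(\<Inter>n. U n) \<subseteq> slabs I L A c t x"
    proof
      fix w assume w: "w \<in> (\<Inter>n. U n)"
      then have "\<forall>n. \<exists>k\<ge>n. w \<in> slabs I L A c t (z k)" by (auto simp: U_def)
      then obtain \<kappa> where \<kappa>: "\<And>n. \<kappa> n \<ge> n" "\<And>n. w \<in> slabs I L A c t (z (\<kappa> n))" by metis
      have "filterlim \<kappa> at_top sequentially"
        using \<kappa>(1) by (intro filterlim_at_top_mono[OF filterlim_ident]) auto
      then have lim': "(\<lambda>n. z (\<kappa> n)) \<longlonglongrightarrow> x" using lim by (rule filterlim_compose[rotated])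
      have "\<bar>c k * x + (\<Sum>j\<in>I. A k j * w j)\<bar> \<le> t k" if k: "k \<in> L" for k
      proof (rule LIMSEQ_le_const2)
        show "(\<lambda>n. \<bar>c k * z (\<kappa> n) + (\<Sum>j\<in>I. A k j * w j)\<bar>) \<longlonglongrightarrow> \<bar>c k * x + (\<Sum>j\<in>I. A k j * w j)\<bar>"
          by (intro tendsto_intros lim')
        show "\<exists>N. \<forall>n\<ge>N. \<bar>c k * z (\<kappa> n) + (\<Sum>j\<in>I. A k j * w j)\<bar> \<le> t k"
          using \<kappa>(2) k by (auto simp: slabs_def)
      qed
      moreover have "w \<in> extensional I" using \<kappa>(2)[of 0] by (auto simp: slabs_def)
      ultimately show "w \<in> slabs I L A c t x" by (auto simp: slabs_def)
    qed
  qed simp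
  finally show "x \<in> {x. p \<le> P.prob (slabs I L A c t x)}" by simp
qed

text \<open>Anderson's inequality along a line. The set of shifts at which the probability is at
  least its value at \<^term>\<open>y\<close> is closed, closed under midpoints, and contains
  \<open>y\<close> and \<open>- y\<close>; hence it contains everything in between.\<close>

lemma slab_prob_antimono:
  assumes "\<bar>x\<bar> \<le> \<bar>y\<bar>"
  shows "measure (PiM I (\<lambda>_. std_normal)) (slabs I L A c t y) \<le> measure (PiM I (\<lambda>_. std_normal)) (slabs I L A c t x)"
proof -
  let ?\<phi> = "\<lambda>x. measure (PiM I (\<lambda>_. std_normal)) (slabs I L A c t x)"
  let ?S = "{x. ?\<phi> y \<le> ?\<phi> x}"
  have "x \<in> ?S"
  proof (rule midpoint_closed_interval[of _ "- \<bar>y\<bar>" "\<bar>y\<bar>"])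
    show "closed ?S" by (rule slab_prob_superlevel_closed)
    show "(s + u) / 2 \<in> ?S" if "s \<in> ?S" "u \<in> ?S" for s u
    proof -
      have "(?\<phi> y)\<^sup>2 \<le> ?\<phi> s * ?\<phi> u" using that by (auto simp: power2_eq_square intro!: mult_mono)
      also have "\<dots> \<le> (?\<phi> ((s + u) / 2))\<^sup>2" by (rule slab_prob_midpoint)
      finally show ?thesis by (auto intro: power2_le_imp_le)
    qed
    show "- \<bar>y\<bar> \<in> ?S" "\<bar>y\<bar> \<in> ?S"
      using slab_prob_uminus[of y] by (auto simp: abs_if)
  qed (use assms in auto)
  then show ?thesis by simp
qed

end

text \<open>Chebyshev's association inequality: inside the interval \<^term>\<open>\<phi>\<close> is at least
  \<^term>\<open>\<phi> s\<close> and outside at most \<^term>\<open>\<phi> s\<close>, so the centered indicator of the interval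
  times \<open>\<phi> - \<phi> s\<close> is nonnegative everywhere.\<close>

lemma interval_antimono_association:
  fixes \<phi> :: "real \<Rightarrow> real"
  assumes "prob_space N" and sets: "sets N = sets borel" and [measurable]: "\<phi> \<in> borel_measurable borel"
    and \<phi>: "\<And>x. \<phi> x \<in> {0..1}" and anti: "\<And>x y. \<bar>x\<bar> \<le> \<bar>y\<bar> \<Longrightarrow> \<phi> y \<le> \<phi> x" and "s \<ge> 0"
  shows "measure N {-s..s} * (\<integral>x. \<phi> x \<partial>N) \<le> (\<integral>x. indicator {-s..s} x * \<phi> x \<partial>N)"
proof -
  interpret prob_space N by fact
  have [measurable_cong]: "sets N = sets borel" by fact
  have i1: "integrable N \<phi>" using \<phi> by (intro integrable_const_bound[of _ 1]) auto
  have i2: "integrable N (\<lambda>x. indicator {-s..s} x * \<phi> x)"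
    using \<phi> by (intro integrable_const_bound[of _ 1]) (auto split: split_indicator)
  have i3: "integrable N (\<lambda>x. indicator {-s..s} x :: real)"
    by (intro integrable_const_bound[of _ 1]) auto
  have e3: "(\<integral>x. indicator {-s..s} x \<partial>N) = prob {-s..s}"
    using sets_eq_imp_space_eq[OF sets] by simp
  let ?p = "prob {-s..s}"
  have "0 \<le> (\<integral>x. (indicator {-s..s} x - ?p) * (\<phi> x - \<phi> s) \<partial>N)"
  proof (rule integral_nonneg_AE, rule AE_I2)
    fix x
    show "0 \<le> (indicator {-s..s} x - ?p) * (\<phi> x - \<phi> s)"
    proof (cases "x \<in> {-s..s}")
      case True
      then have "\<phi> s \<le> \<phi> x" using \<open>s \<ge> 0\<close> by (intro anti) auto
      then show ?thesis using True by auto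
    next
      case False
      then have "\<phi> x \<le> \<phi> s" using \<open>s \<ge> 0\<close> by (intro anti) auto
      then show ?thesis using False by (auto intro!: mult_nonneg_nonpos)
    qed
  qed
  also have "\<dots> = (\<integral>x. indicator {-s..s} x * \<phi> x - \<phi> s * indicator {-s..s} x - ?p * \<phi> x + ?p * \<phi> s \<partial>N)"
    by (intro Bochner_Integration.integral_cong) (auto simp: algebra_simps)
  also have "\<dots> = (\<integral>x. indicator {-s..s} x * \<phi> x \<partial>N) - \<phi> s * ?p - ?p * (\<integral>x. \<phi> x \<partial>N) + ?p * \<phi> s"
    using i1 i2 i3 by (simp add: prob_space e3)
  finally show ?thesis by simp
qed

text \<open>Integrating out all coordinates but \<^term>\<open>i\<close> leaves a function of \<open>w i\<close> that decreases in
\<open>\<bar>w i\<bar>\<close> by Anderson's inequality, so the association inequality applies.\<close>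

lemma sidak_PiM_std_normal:
  assumes fin: "finite I" "finite L" and i: "i \<notin> I" and "s \<ge> 0"
  defines "N \<equiv> PiM (insert i I) (\<lambda>_. std_normal)"
  shows "measure N {w \<in> space N. \<bar>w i\<bar> \<le> s} * measure N {w \<in> space N. \<forall>k\<in>L. \<bar>\<Sum>j\<in>insert i I. A k j * w j\<bar> \<le> t k}
    \<le> measure N {w \<in> space N. \<bar>w i\<bar> \<le> s \<and> (\<forall>k\<in>L. \<bar>\<Sum>j\<in>insert i I. A k j * w j\<bar> \<le> t k)}"
proof -
  interpret G: prob_space std_normal by (rule prob_space_std_normal)
  interpret product_sigma_finite "\<lambda>_::'a. std_normal"
    by (rule product_sigma_finite.intro) (rule G.sigma_finite_measure_axioms)
  interpret P: prob_space "PiM I (\<lambda>_. std_normal)"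
    by (rule prob_space_PiM) (rule prob_space_std_normal)
  interpret N: prob_space N
    unfolding N_def by (rule prob_space_PiM) (rule prob_space_std_normal)
  define \<phi> where "\<phi> x = P.prob (slabs I L A (\<lambda>k. A k i) t x)" for x
  define K where "K = {w \<in> space N. \<forall>k\<in>L. \<bar>\<Sum>j\<in>insert i I. A k j * w j\<bar> \<le> t k}"
  have Km[measurable]: "K \<in> sets (PiM (insert i I) (\<lambda>_. std_normal))"
    using fin unfolding K_def N_def by measurable
  have sum: "(\<Sum>j\<in>insert i I. A k j * (x(i := y)) j) = A k i * y + (\<Sum>j\<in>I. A k j * x j)" for k x y
    using i fin by (auto intro!: sum.cong)
  have \<phi>m[measurable]: "\<phi> \<in> borel_measurable borel"
  proof -
    have "{q \<in> space (borel \<Otimes>\<^sub>M PiM I (\<lambda>_. std_normal)). \<forall>k\<in>L. \<bar>A k i * fst q + (\<Sum>j\<in>I. A k j * snd q j)\<bar> \<le> t k}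
        \<in> sets (borel \<Otimes>\<^sub>M PiM I (\<lambda>_. std_normal))"
      using fin by measurable
    from P.measurable_emeasure_Pair[OF this]
    have "(\<lambda>x. emeasure (PiM I (\<lambda>_. std_normal)) (slabs I L A (\<lambda>k. A k i) t x)) \<in> borel_measurable borel"
      by (rule measurable_cong[THEN iffD1, rotated])
         (auto simp: slabs_def space_PiM PiE_def space_pair_measure intro!: arg_cong[where f="emeasure _"])
    then show ?thesis unfolding \<phi>_def measure_def by measurable
  qed
  have \<phi>01: "\<phi> x \<in> {0..1}" for x by (simp add: \<phi>_def)
  have key: "N.prob {w \<in> space N. w i \<in> B \<and> w \<in> K} = (\<integral>y. indicator B y * \<phi> y \<partial>std_normal)"
    if B[measurable]: "B \<in> sets borel" for B
  proof -
    have Bm[measurable]: "{w \<in> space N. w i \<in> B \<and> w \<in> K} \<in> sets N"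
      unfolding N_def by measurable
    have "ennreal (N.prob {w \<in> space N. w i \<in> B \<and> w \<in> K})
      = (\<integral>\<^sup>+w. indicator {w \<in> space N. w i \<in> B \<and> w \<in> K} w \<partial>N)"
      using Bm by (subst nn_integral_indicator) (auto simp: N.emeasure_eq_measure)
    also have "\<dots> = (\<integral>\<^sup>+y. (\<integral>\<^sup>+x. indicator {w \<in> space N. w i \<in> B \<and> w \<in> K} (x(i := y)) \<partial>PiM I (\<lambda>_. std_normal)) \<partial>std_normal)"
      using fin i unfolding N_def[symmetric] by (subst N_def, intro product_nn_integral_insert_rev) (use Bm in \<open>auto simp: N_def[symmetric]\<close>)
    also have "\<dots> = (\<integral>\<^sup>+y. (\<integral>\<^sup>+x. indicator B y * indicator (slabs I L A (\<lambda>k. A k i) t y) x \<partial>PiM I (\<lambda>_. std_normal)) \<partial>std_normal)"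
    proof (intro nn_integral_cong)
      fix x :: "'a \<Rightarrow> real" and y :: real assume x: "x \<in> space (PiM I (\<lambda>_. std_normal))"
      have "x(i := y) \<in> space N" using x by (auto simp: N_def space_PiM PiE_def extensional_def)
      then show "indicator {w \<in> space N. w i \<in> B \<and> w \<in> K} (x(i := y))
        = (indicator B y * indicator (slabs I L A (\<lambda>k. A k i) t y) x :: ennreal)"
        using x unfolding K_def slabs_def by (simp add: sum indicator_def space_PiM PiE_def del: fun_upd_apply) simp
    qed
    also have "\<dots> = (\<integral>\<^sup>+y. ennreal (indicator B y * \<phi> y) \<partial>std_normal)"
      using slabs_measurable[OF fin, of A "\<lambda>k. A k i" t]
      by (intro nn_integral_cong, subst nn_integral_cmult)
         (auto simp: \<phi>_def P.emeasure_eq_measure split: split_indicator)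
    also have "\<dots> = ennreal (\<integral>y. indicator B y * \<phi> y \<partial>std_normal)"
      using \<phi>01 by (intro nn_integral_eq_integral G.integrable_const_bound[of _ 1])
        (auto split: split_indicator)
    finally show ?thesis
      using \<phi>01 by (subst (asm) ennreal_inj) (auto intro!: integral_nonneg_AE split: split_indicator)
  qed
  have 1: "N.prob K = (\<integral>y. \<phi> y \<partial>std_normal)"
  proof -
    have "{w \<in> space N. w i \<in> UNIV \<and> w \<in> K} = K" by (auto simp: K_def)
    then show ?thesis using key[of UNIV] by simp
  qed
  have 2: "N.prob {w \<in> space N. \<bar>w i\<bar> \<le> s} = G.prob {-s..s}"
  proof -
    have "distr N std_normal (\<lambda>w. w i) = std_normal"
      unfolding N_def by (rule distr_PiM_component) (use fin prob_space_std_normal in auto)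
    then have "G.prob {-s..s} = measure (distr N std_normal (\<lambda>w. w i)) {-s..s}" by simp
    also have "\<dots> = N.prob ((\<lambda>w. w i) -` {-s..s} \<inter> space N)"
      unfolding N_def by (rule measure_distr) auto
    also have "(\<lambda>w. w i) -` {-s..s} \<inter> space N = {w \<in> space N. \<bar>w i\<bar> \<le> s}" by auto
    finally show ?thesis ..
  qed
  have 3: "{w \<in> space N. \<bar>w i\<bar> \<le> s \<and> (\<forall>k\<in>L. \<bar>\<Sum>j\<in>insert i I. A k j * w j\<bar> \<le> t k)} = {w \<in> space N. w i \<in> {-s..s} \<and> w \<in> K}"
    by (auto simp: K_def)
  have "G.prob {-s..s} * (\<integral>y. \<phi> y \<partial>std_normal) \<le> (\<integral>y. indicator {-s..s} y * \<phi> y \<partial>std_normal)"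
  proof (rule interval_antimono_association)
    show "\<phi> y \<le> \<phi> x" if "\<bar>x\<bar> \<le> \<bar>y\<bar>" for x y
      unfolding \<phi>_def by (rule slab_prob_antimono[OF fin that])
  qed (use \<phi>01 \<open>s \<ge> 0\<close> prob_space_std_normal in auto)
  then show ?thesis
    unfolding 2 3 K_def[symmetric] 1 using key[of "{-s..s}"] by simp
qed

section \<open>Gaussian spaces\<close>

text \<open>A linear space of centered, jointly Gaussian variables. Closure under scaling makes the
  identity for the characteristic function at \<open>1\<close> determine the law of every member, so joint
  normality needs no mention of finite-dimensional distributions.\<close>

locale gaussian_space = prob_space M for M :: "'w measure" +
  fixes H :: "('w \<Rightarrow> real) set"
  assumes zero: "(\<lambda>_. 0) \<in> H"
    and lin: "\<And>Y Z r. Y \<in> H \<Longrightarrow> Z \<in> H \<Longrightarrow> (\<lambda>\<omega>. r * Y \<omega> + Z \<omega>) \<in> H"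
    and meas[measurable_dest]: "\<And>Y. Y \<in> H \<Longrightarrow> Y \<in> borel_measurable M"
    and sq: "\<And>Y. Y \<in> H \<Longrightarrow> integrable M (\<lambda>\<omega>. (Y \<omega>)\<^sup>2)"
    and chf: "\<And>Y. Y \<in> H \<Longrightarrow> (\<integral>\<omega>. iexp (Y \<omega>) \<partial>M) = complex_of_real (exp (- (\<integral>\<omega>. (Y \<omega>)\<^sup>2 \<partial>M) / 2))"

lemma integrable_mult_of_square_integrable:
  fixes Y Z :: "'w \<Rightarrow> real"
  assumes [measurable]: "Y \<in> borel_measurable M" "Z \<in> borel_measurable M"
    and "integrable M (\<lambda>\<omega>. (Y \<omega>)\<^sup>2)" "integrable M (\<lambda>\<omega>. (Z \<omega>)\<^sup>2)"
  shows "integrable M (\<lambda>\<omega>. Y \<omega> * Z \<omega>)"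
proof (rule Bochner_Integration.integrable_bound)
  show "integrable M (\<lambda>\<omega>. (Y \<omega>)\<^sup>2 + (Z \<omega>)\<^sup>2)" using assms by auto
  show "AE \<omega> in M. norm (Y \<omega> * Z \<omega>) \<le> norm ((Y \<omega>)\<^sup>2 + (Z \<omega>)\<^sup>2)"
  proof (rule AE_I2)
    fix \<omega>
    have "2 * (\<bar>Y \<omega>\<bar> * \<bar>Z \<omega>\<bar>) \<le> (Y \<omega>)\<^sup>2 + (Z \<omega>)\<^sup>2"
      using zero_le_power2[of "\<bar>Y \<omega>\<bar> - \<bar>Z \<omega>\<bar>"] by (simp add: power2_diff)
    moreover have "0 \<le> \<bar>Y \<omega>\<bar> * \<bar>Z \<omega>\<bar>" by (intro mult_nonneg_nonneg) auto
    ultimately have "\<bar>Y \<omega>\<bar> * \<bar>Z \<omega>\<bar> \<le> (Y \<omega>)\<^sup>2 + (Z \<omega>)\<^sup>2" by linarith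
    then show "norm (Y \<omega> * Z \<omega>) \<le> norm ((Y \<omega>)\<^sup>2 + (Z \<omega>)\<^sup>2)"
      by (simp add: abs_mult)
  qed
qed simp

lemma square_integrable_lin:
  fixes Y Z :: "'w \<Rightarrow> real"
  assumes [measurable]: "Y \<in> borel_measurable M" "Z \<in> borel_measurable M"
    and i: "integrable M (\<lambda>\<omega>. (Y \<omega>)\<^sup>2)" "integrable M (\<lambda>\<omega>. (Z \<omega>)\<^sup>2)"
  shows "integrable M (\<lambda>\<omega>. (r * Y \<omega> + s * Z \<omega>)\<^sup>2)"
    and "(\<integral>\<omega>. (r * Y \<omega> + s * Z \<omega>)\<^sup>2 \<partial>M)
      = r\<^sup>2 * (\<integral>\<omega>. (Y \<omega>)\<^sup>2 \<partial>M) + 2 * r * s * (\<integral>\<omega>. Y \<omega> * Z \<omega> \<partial>M) + s\<^sup>2 * (\<integral>\<omega>. (Z \<omega>)\<^sup>2 \<partial>M)"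
    and "(\<integral>\<omega>. (r * Y \<omega> + s * Z \<omega>)\<^sup>2 \<partial>M) \<le> 2 * r\<^sup>2 * (\<integral>\<omega>. (Y \<omega>)\<^sup>2 \<partial>M) + 2 * s\<^sup>2 * (\<integral>\<omega>. (Z \<omega>)\<^sup>2 \<partial>M)"
proof -
  have e: "(r * Y \<omega> + s * Z \<omega>)\<^sup>2 = r\<^sup>2 * (Y \<omega>)\<^sup>2 + 2 * r * s * (Y \<omega> * Z \<omega>) + s\<^sup>2 * (Z \<omega>)\<^sup>2" for \<omega>
    by (simp add: power2_eq_square algebra_simps)
  have iYZ: "integrable M (\<lambda>\<omega>. Y \<omega> * Z \<omega>)" using i by (intro integrable_mult_of_square_integrable) auto
  show i3: "integrable M (\<lambda>\<omega>. (r * Y \<omega> + s * Z \<omega>)\<^sup>2)" unfolding e using i iYZ by auto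
  show "(\<integral>\<omega>. (r * Y \<omega> + s * Z \<omega>)\<^sup>2 \<partial>M)
      = r\<^sup>2 * (\<integral>\<omega>. (Y \<omega>)\<^sup>2 \<partial>M) + 2 * r * s * (\<integral>\<omega>. Y \<omega> * Z \<omega> \<partial>M) + s\<^sup>2 * (\<integral>\<omega>. (Z \<omega>)\<^sup>2 \<partial>M)"
    unfolding e using i iYZ by simp
  have "(\<integral>\<omega>. (r * Y \<omega> + s * Z \<omega>)\<^sup>2 \<partial>M) \<le> (\<integral>\<omega>. 2 * r\<^sup>2 * (Y \<omega>)\<^sup>2 + 2 * s\<^sup>2 * (Z \<omega>)\<^sup>2 \<partial>M)"
  proof (rule integral_mono)
    fix \<omega>
    have "0 \<le> (r * Y \<omega> - s * Z \<omega>)\<^sup>2" by simp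
    then show "(r * Y \<omega> + s * Z \<omega>)\<^sup>2 \<le> 2 * r\<^sup>2 * (Y \<omega>)\<^sup>2 + 2 * s\<^sup>2 * (Z \<omega>)\<^sup>2"
      unfolding e by (simp add: power2_diff power_mult_distrib algebra_simps)
  qed (use i i3 in auto)
  then show "(\<integral>\<omega>. (r * Y \<omega> + s * Z \<omega>)\<^sup>2 \<partial>M) \<le> 2 * r\<^sup>2 * (\<integral>\<omega>. (Y \<omega>)\<^sup>2 \<partial>M) + 2 * s\<^sup>2 * (\<integral>\<omega>. (Z \<omega>)\<^sup>2 \<partial>M)"
    using i by simp
qed

text \<open>A division-free form of the Cauchy-Schwarz inequality.\<close>

lemma abs_integral_mult_le:
  fixes Y D :: "'w \<Rightarrow> real"
  assumes [measurable]: "Y \<in> borel_measurable M" "D \<in> borel_measurable M"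
    and i: "integrable M (\<lambda>\<omega>. (Y \<omega>)\<^sup>2)" "integrable M (\<lambda>\<omega>. (D \<omega>)\<^sup>2)"
    and \<delta>: "\<delta> > 0" "(\<integral>\<omega>. (D \<omega>)\<^sup>2 \<partial>M) \<le> \<delta>\<^sup>2"
  shows "(\<integral>\<omega>. \<bar>Y \<omega> * D \<omega>\<bar> \<partial>M) \<le> \<delta> * ((\<integral>\<omega>. (Y \<omega>)\<^sup>2 \<partial>M) + 1) / 2"
    and "\<bar>\<integral>\<omega>. Y \<omega> * D \<omega> \<partial>M\<bar> \<le> \<delta> * ((\<integral>\<omega>. (Y \<omega>)\<^sup>2 \<partial>M) + 1) / 2"
proof -
  have iYD: "integrable M (\<lambda>\<omega>. Y \<omega> * D \<omega>)" using i by (intro integrable_mult_of_square_integrable) auto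
  have "(\<integral>\<omega>. \<bar>Y \<omega> * D \<omega>\<bar> \<partial>M) \<le> (\<integral>\<omega>. \<delta> / 2 * (Y \<omega>)\<^sup>2 + 1 / (2 * \<delta>) * (D \<omega>)\<^sup>2 \<partial>M)"
  proof (rule integral_mono)
    fix \<omega>
    have "0 \<le> (\<delta> * \<bar>Y \<omega>\<bar> - \<bar>D \<omega>\<bar>)\<^sup>2" by simp
    then have "2 * \<delta> * \<bar>Y \<omega> * D \<omega>\<bar> \<le> \<delta>\<^sup>2 * (Y \<omega>)\<^sup>2 + (D \<omega>)\<^sup>2"
      by (simp add: power2_diff power_mult_distrib abs_mult mult.assoc)
    then show "\<bar>Y \<omega> * D \<omega>\<bar> \<le> \<delta> / 2 * (Y \<omega>)\<^sup>2 + 1 / (2 * \<delta>) * (D \<omega>)\<^sup>2"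
      using \<delta> by (simp add: field_simps power2_eq_square)
  qed (use i iYD in auto)
  also have "\<dots> = \<delta> / 2 * (\<integral>\<omega>. (Y \<omega>)\<^sup>2 \<partial>M) + 1 / (2 * \<delta>) * (\<integral>\<omega>. (D \<omega>)\<^sup>2 \<partial>M)" using i by simp
  also have "\<dots> \<le> \<delta> / 2 * (\<integral>\<omega>. (Y \<omega>)\<^sup>2 \<partial>M) + 1 / (2 * \<delta>) * \<delta>\<^sup>2"
    using \<delta> by (intro add_left_mono mult_left_mono) auto
  also have "\<dots> = \<delta> * ((\<integral>\<omega>. (Y \<omega>)\<^sup>2 \<partial>M) + 1) / 2" using \<delta> by (simp add: power2_eq_square field_simps)
  finally show "(\<integral>\<omega>. \<bar>Y \<omega> * D \<omega>\<bar> \<partial>M) \<le> \<delta> * ((\<integral>\<omega>. (Y \<omega>)\<^sup>2 \<partial>M) + 1) / 2" .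
  then show "\<bar>\<integral>\<omega>. Y \<omega> * D \<omega> \<partial>M\<bar> \<le> \<delta> * ((\<integral>\<omega>. (Y \<omega>)\<^sup>2 \<partial>M) + 1) / 2"
    using integral_abs_bound[of M "\<lambda>\<omega>. Y \<omega> * D \<omega>"] by linarith
qed

context gaussian_space
begin

lemma scale: "Y \<in> H \<Longrightarrow> (\<lambda>\<omega>. r * Y \<omega>) \<in> H"
  using lin[OF _ zero, of Y r] by simp

lemma diff: "Y \<in> H \<Longrightarrow> Z \<in> H \<Longrightarrow> (\<lambda>\<omega>. Y \<omega> - Z \<omega>) \<in> H"
  using lin[of Z Y "-1"] by simp

lemma lincomb:
  assumes "finite J" "\<And>j. j \<in> J \<Longrightarrow> Z j \<in> H"
  shows "(\<lambda>\<omega>. \<Sum>j\<in>J. r j * Z j \<omega>) \<in> H"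
  using assms by (induction J) (auto simp: zero intro!: lin)

lemma mult_integrable: "Y \<in> H \<Longrightarrow> Z \<in> H \<Longrightarrow> integrable M (\<lambda>\<omega>. Y \<omega> * Z \<omega>)"
  by (intro integrable_mult_of_square_integrable meas sq)

lemma integral_sq_lin:
  assumes "Y \<in> H" "Z \<in> H"
  shows "(\<integral>\<omega>. (r * Y \<omega> + Z \<omega>)\<^sup>2 \<partial>M)
    = r\<^sup>2 * (\<integral>\<omega>. (Y \<omega>)\<^sup>2 \<partial>M) + 2 * r * (\<integral>\<omega>. Y \<omega> * Z \<omega> \<partial>M) + (\<integral>\<omega>. (Z \<omega>)\<^sup>2 \<partial>M)"
  using square_integrable_lin(2)[OF meas meas sq sq, OF assms assms, of r 1] by simp

lemma real_distribution_distr: "Y \<in> H \<Longrightarrow> real_distribution (distr M borel Y)"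
  using meas by (intro real_distribution_distr) auto

lemma char_distr:
  assumes Y: "Y \<in> H"
  shows "char (distr M borel Y) t = complex_of_real (exp (- (t\<^sup>2 * (\<integral>\<omega>. (Y \<omega>)\<^sup>2 \<partial>M)) / 2))"
proof -
  have [measurable]: "Y \<in> borel_measurable M" using meas Y by simp
  have "char (distr M borel Y) t = (\<integral>\<omega>. iexp (t * Y \<omega>) \<partial>M)"
    unfolding char_def by (subst integral_distr) auto
  also have "\<dots> = complex_of_real (exp (- (t\<^sup>2 * (\<integral>\<omega>. (Y \<omega>)\<^sup>2 \<partial>M)) / 2))"
    by (subst chf[OF scale[OF Y]]) (simp add: power_mult_distrib)
  finally show ?thesis .
qed

lemma distr_std_normal:
  assumes "Y \<in> H" "(\<integral>\<omega>. (Y \<omega>)\<^sup>2 \<partial>M) = 1"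
  shows "distr M borel Y = std_normal"
  using assms real_distribution_distr[of Y] real_dist_normal_dist
  by (intro Levy_uniqueness) (auto simp: char_distr char_std_normal_distribution)

lemma AE_zero:
  assumes "Y \<in> H" "(\<integral>\<omega>. (Y \<omega>)\<^sup>2 \<partial>M) = 0"
  shows "AE \<omega> in M. Y \<omega> = 0"
  using integral_nonneg_eq_0_iff_AE[OF sq[OF assms(1)]] assms(2) by simp

lemma prob_abs_le:
  assumes Y: "Y \<in> H" and s: "s > 0" "(\<integral>\<omega>. (Y \<omega>)\<^sup>2 \<partial>M) = s\<^sup>2"
  shows "prob {\<omega> \<in> space M. \<bar>Y \<omega>\<bar> \<le> t} = measure std_normal {- (t / s)..t / s}"
proof -
  have Z: "(\<lambda>\<omega>. (1/s) * Y \<omega>) \<in> H" by (rule scale[OF Y])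
  have [measurable]: "Y \<in> borel_measurable M" using meas Y by simp
  have "(\<integral>\<omega>. ((1/s) * Y \<omega>)\<^sup>2 \<partial>M) = 1"
    using s by (simp add: power_divide)
  then have "measure std_normal {- (t / s)..t / s} = measure (distr M borel (\<lambda>\<omega>. (1/s) * Y \<omega>)) {- (t / s)..t / s}"
    by (subst distr_std_normal[OF Z]) auto
  also have "\<dots> = prob ((\<lambda>\<omega>. (1/s) * Y \<omega>) -` {- (t / s)..t / s} \<inter> space M)"
    by (rule measure_distr) auto
  also have "(\<lambda>\<omega>. (1/s) * Y \<omega>) -` {- (t / s)..t / s} \<inter> space M = {\<omega> \<in> space M. \<bar>Y \<omega>\<bar> \<le> t}"
    using s by (auto simp: divide_le_cancel abs_le_iff minus_divide_left simp del: minus_divide_left[symmetric])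
  finally show ?thesis ..
qed

text \<open>A nonnegative weight uncorrelated with all characters of \<^term>\<open>\<xi>\<close> becomes, after
  normalisation, a density under which \<^term>\<open>\<xi>\<close> has an unchanged characteristic function and
  hence an unchanged law.\<close>

lemma weighted_distr:
  assumes \<xi>: "\<xi> \<in> H" and [measurable]: "w \<in> borel_measurable M" and w: "\<And>\<omega>. 0 \<le> w \<omega>" "\<And>\<omega>. w \<omega> \<le> 2"
    and pos: "(\<integral>\<omega>. w \<omega> \<partial>M) > 0"
    and fac: "\<And>t. (\<integral>\<omega>. w \<omega> *\<^sub>R iexp (t * \<xi> \<omega>) \<partial>M) = (\<integral>\<omega>. w \<omega> \<partial>M) *\<^sub>R (\<integral>\<omega>. iexp (t * \<xi> \<omega>) \<partial>M)"
    and A[measurable]: "A \<in> sets borel"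
  shows "(\<integral>\<omega>. indicator A (\<xi> \<omega>) * w \<omega> \<partial>M) = prob {\<omega> \<in> space M. \<xi> \<omega> \<in> A} * (\<integral>\<omega>. w \<omega> \<partial>M)"
proof -
  have [measurable]: "\<xi> \<in> borel_measurable M" using meas \<xi> by simp
  define e where "e = (\<integral>\<omega>. w \<omega> \<partial>M)"
  have e: "e > 0" using pos by (simp add: e_def)
  have wi: "integrable M w" using w by (intro integrable_const_bound[of _ 2]) auto
  define N where "N = density M (\<lambda>\<omega>. ennreal (w \<omega> / e))"
  have [measurable_cong, simp]: "sets N = sets M" "space N = space M" by (simp_all add: N_def)
  have intN: "(\<integral>\<omega>. f \<omega> \<partial>N) = (\<integral>\<omega>. (w \<omega> / e) *\<^sub>R f \<omega> \<partial>M)"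
    if [measurable]: "f \<in> borel_measurable M" for f :: "'w \<Rightarrow> 'b::{banach, second_countable_topology}"
    unfolding N_def using w e by (intro integral_density) auto
  have prN: "prob_space N"
  proof
    have "emeasure N (space N) = (\<integral>\<^sup>+\<omega>. ennreal (w \<omega> / e) \<partial>M)"
      unfolding N_def by (subst emeasure_density) (auto intro!: nn_integral_cong)
    also have "\<dots> = ennreal (\<integral>\<omega>. w \<omega> / e \<partial>M)"
      using w e wi by (intro nn_integral_eq_integral) auto
    also have "\<dots> = 1" using e by (simp add: e_def)
    finally show "emeasure N (space N) = 1" .
  qed
  interpret N: prob_space N by (rule prN)
  have "distr N borel \<xi> = distr M borel \<xi>"
  proof (rule Levy_uniqueness)
    show "real_distribution (distr N borel \<xi>)"
      by (rule N.real_distribution_distr) measurable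
    show "real_distribution (distr M borel \<xi>)"
      using \<xi> by (rule real_distribution_distr)
    show "char (distr N borel \<xi>) = char (distr M borel \<xi>)"
    proof
      fix t
      have "char (distr N borel \<xi>) t = (\<integral>\<omega>. iexp (t * \<xi> \<omega>) \<partial>N)"
        unfolding char_def by (subst integral_distr) auto
      also have "\<dots> = (\<integral>\<omega>. (w \<omega> / e) *\<^sub>R iexp (t * \<xi> \<omega>) \<partial>M)" by (rule intN) measurable
      also have "\<dots> = (\<integral>\<omega>. (1 / e) *\<^sub>R (w \<omega> *\<^sub>R iexp (t * \<xi> \<omega>)) \<partial>M)" by simp
      also have "\<dots> = (1 / e) *\<^sub>R (\<integral>\<omega>. w \<omega> *\<^sub>R iexp (t * \<xi> \<omega>) \<partial>M)" by (rule integral_scaleR_right)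
      also have "\<dots> = (\<integral>\<omega>. iexp (t * \<xi> \<omega>) \<partial>M)"
        unfolding fac using e by (simp add: e_def[symmetric])
      also have "\<dots> = char (distr M borel \<xi>) t"
        unfolding char_def by (subst integral_distr) auto
      finally show "char (distr N borel \<xi>) t = char (distr M borel \<xi>) t" .
    qed
  qed
  then have "measure (distr N borel \<xi>) A = measure (distr M borel \<xi>) A" by simp
  then have "N.prob (\<xi> -` A \<inter> space M) = prob (\<xi> -` A \<inter> space M)"
    by (simp add: measure_distr)
  moreover have "N.prob (\<xi> -` A \<inter> space M) = (\<integral>\<omega>. indicator (\<xi> -` A \<inter> space M) \<omega> \<partial>N)" by simp
  moreover have "\<dots> = (\<integral>\<omega>. (w \<omega> / e) *\<^sub>R indicator (\<xi> -` A \<inter> space M) \<omega> \<partial>M)"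
    by (rule intN) measurable
  moreover have "\<dots> = (\<integral>\<omega>. (indicator A (\<xi> \<omega>) * w \<omega>) / e \<partial>M)"
    by (intro Bochner_Integration.integral_cong) (auto split: split_indicator)
  moreover have "\<dots> = (\<integral>\<omega>. indicator A (\<xi> \<omega>) * w \<omega> \<partial>M) / e" by simp
  moreover have "\<xi> -` A \<inter> space M = {\<omega> \<in> space M. \<xi> \<omega> \<in> A}" by auto
  ultimately show ?thesis using e by (simp add: e_def[symmetric] field_simps)
qed

text \<open>The functions \<open>1 + cos Z\<close> and \<open>1 + sin Z\<close> are nonnegative weights to which the previous lemma
applies; they yield the real and the imaginary part. In this way independence needs no
uniqueness theorem beyond the one-dimensional one.\<close>

lemma orthogonal_factorisation:
  assumes \<xi>: "\<xi> \<in> H" and Z: "Z \<in> H" and orth: "(\<integral>\<omega>. Z \<omega> * \<xi> \<omega> \<partial>M) = 0" and A[measurable]: "A \<in> sets borel"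
  shows "(\<integral>\<omega>. indicator A (\<xi> \<omega>) *\<^sub>R iexp (Z \<omega>) \<partial>M)
    = prob {\<omega> \<in> space M. \<xi> \<omega> \<in> A} *\<^sub>R (\<integral>\<omega>. iexp (Z \<omega>) \<partial>M)"
proof -
  have [measurable]: "\<xi> \<in> borel_measurable M" "Z \<in> borel_measurable M" using meas \<xi> Z by auto
  define z where "z = (\<integral>\<omega>. (Z \<omega>)\<^sup>2 \<partial>M)"
  have iexpi: "integrable M (\<lambda>\<omega>. iexp (f \<omega>))" if [measurable]: "f \<in> borel_measurable M" for f
    by (rule integrable_iexp) measurable
  have ic: "integrable M (\<lambda>\<omega>. cos (Z \<omega>))" and isn: "integrable M (\<lambda>\<omega>. sin (Z \<omega>))"
    by (auto intro!: integrable_const_bound[of _ 1])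
  have split: "iexp x = complex_of_real (cos x) + \<i> * complex_of_real (sin x)" for x
    by (simp add: exp_Euler cos_of_real sin_of_real)
  have EZ: "(\<integral>\<omega>. iexp (Z \<omega>) \<partial>M) = complex_of_real (\<integral>\<omega>. cos (Z \<omega>) \<partial>M) + \<i> * complex_of_real (\<integral>\<omega>. sin (Z \<omega>) \<partial>M)"
    unfolding split using ic isn by (simp add: integrable_of_real)
  then have "complex_of_real (exp (- z / 2)) = complex_of_real (\<integral>\<omega>. cos (Z \<omega>) \<partial>M) + \<i> * complex_of_real (\<integral>\<omega>. sin (Z \<omega>) \<partial>M)"
    using chf[OF Z] by (simp add: z_def)
  from arg_cong[OF this, of Re] arg_cong[OF this, of Im]
  have Ec: "(\<integral>\<omega>. cos (Z \<omega>) \<partial>M) = exp (- z / 2)" and Es: "(\<integral>\<omega>. sin (Z \<omega>) \<partial>M) = 0" by simp_all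
  have sq_pm: "(\<integral>\<omega>. (t * \<xi> \<omega> + r * Z \<omega>)\<^sup>2 \<partial>M) = t\<^sup>2 * (\<integral>\<omega>. (\<xi> \<omega>)\<^sup>2 \<partial>M) + r\<^sup>2 * z" for t r
    using integral_sq_lin[OF \<xi> scale[OF Z], of t r] orth
    by (simp add: z_def power_mult_distrib mult.left_commute mult.commute)
  have pm: "(\<integral>\<omega>. iexp (t * \<xi> \<omega> + r * Z \<omega>) \<partial>M)
      = complex_of_real (exp (- (t\<^sup>2 * (\<integral>\<omega>. (\<xi> \<omega>)\<^sup>2 \<partial>M)) / 2) * exp (- (r\<^sup>2 * z) / 2))" for t r
    by (subst chf[OF lin[OF \<xi> scale[OF Z]]]) (simp add: sq_pm exp_add[symmetric] add_divide_distrib)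
  have t0: "(\<integral>\<omega>. iexp (t * \<xi> \<omega>) \<partial>M) = complex_of_real (exp (- (t\<^sup>2 * (\<integral>\<omega>. (\<xi> \<omega>)\<^sup>2 \<partial>M)) / 2))" for t
    using pm[of t 0] by simp
  have c_iexp: "(1 + cos y) *\<^sub>R iexp x = iexp x + iexp (x + y) / 2 + iexp (x - y) / 2" for x y
    by (simp add: scaleR_conv_of_real exp_add exp_diff distrib_left right_diff_distrib cos_of_real[symmetric] cos_exp_eq exp_minus field_simps)
  have s_iexp: "(1 + sin y) *\<^sub>R iexp x = iexp x + iexp (x + y) / (2 * \<i>) - iexp (x - y) / (2 * \<i>)" for x y
    by (simp add: scaleR_conv_of_real exp_add exp_diff distrib_left right_diff_distrib sin_of_real[symmetric] sin_exp_eq exp_minus field_simps)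
  let ?P = "prob {\<omega> \<in> space M. \<xi> \<omega> \<in> A}"
  have iA: "integrable M (\<lambda>\<omega>. indicator A (\<xi> \<omega>) :: real)"
    by (intro integrable_const_bound[of _ 1]) auto
  have EA: "(\<integral>\<omega>. indicator A (\<xi> \<omega>) \<partial>M) = ?P"
  proof -
    have "(\<integral>\<omega>. indicator A (\<xi> \<omega>) \<partial>M) = (\<integral>\<omega>. indicator {\<omega> \<in> space M. \<xi> \<omega> \<in> A} \<omega> \<partial>M :: real)"
      by (intro Bochner_Integration.integral_cong) (auto split: split_indicator)
    then show ?thesis by simp
  qed
  have iAc: "integrable M (\<lambda>\<omega>. indicator A (\<xi> \<omega>) * cos (Z \<omega>))"
    and iAs: "integrable M (\<lambda>\<omega>. indicator A (\<xi> \<omega>) * sin (Z \<omega>))"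
    by (auto intro!: integrable_const_bound[of _ 1] split: split_indicator)
  have "(\<integral>\<omega>. indicator A (\<xi> \<omega>) * (1 + cos (Z \<omega>)) \<partial>M) = ?P * (\<integral>\<omega>. (1 + cos (Z \<omega>)) \<partial>M)"
  proof (rule weighted_distr[OF \<xi>])
    show "0 \<le> 1 + cos (Z \<omega>)" "1 + cos (Z \<omega>) \<le> 2" for \<omega>
      using cos_ge_minus_one[of "Z \<omega>"] cos_le_one[of "Z \<omega>"] by linarith+
    show "0 < (\<integral>\<omega>. (1 + cos (Z \<omega>)) \<partial>M)"
      using ic by (simp add: Ec prob_space add_pos_pos)
    fix t
    have "(\<integral>\<omega>. (1 + cos (Z \<omega>)) *\<^sub>R iexp (t * \<xi> \<omega>) \<partial>M)
       = (\<integral>\<omega>. iexp (t * \<xi> \<omega>) + iexp (t * \<xi> \<omega> + 1 * Z \<omega>) / 2 + iexp (t * \<xi> \<omega> + (-1) * Z \<omega>) / 2 \<partial>M)"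
      unfolding c_iexp by simp
    also have "\<dots> = (\<integral>\<omega>. iexp (t * \<xi> \<omega>) \<partial>M) + (\<integral>\<omega>. iexp (t * \<xi> \<omega> + 1 * Z \<omega>) \<partial>M) / 2 + (\<integral>\<omega>. iexp (t * \<xi> \<omega> + (-1) * Z \<omega>) \<partial>M) / 2"
      by (subst Bochner_Integration.integral_add, (intro Bochner_Integration.integrable_add integrable_divide iexpi; measurable)+)+ simp
    also have "\<dots> = (\<integral>\<omega>. (1 + cos (Z \<omega>)) \<partial>M) *\<^sub>R (\<integral>\<omega>. iexp (t * \<xi> \<omega>) \<partial>M)"
      unfolding pm t0 using ic by (simp add: Ec prob_space scaleR_conv_of_real field_simps)
    finally show "(\<integral>\<omega>. (1 + cos (Z \<omega>)) *\<^sub>R iexp (t * \<xi> \<omega>) \<partial>M)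
       = (\<integral>\<omega>. (1 + cos (Z \<omega>)) \<partial>M) *\<^sub>R (\<integral>\<omega>. iexp (t * \<xi> \<omega>) \<partial>M)" .
  qed auto
  then have cA: "(\<integral>\<omega>. indicator A (\<xi> \<omega>) * cos (Z \<omega>) \<partial>M) = ?P * exp (- z / 2)"
    using ic iA iAc by (simp add: distrib_left EA Ec prob_space)
  have "(\<integral>\<omega>. indicator A (\<xi> \<omega>) * (1 + sin (Z \<omega>)) \<partial>M) = ?P * (\<integral>\<omega>. (1 + sin (Z \<omega>)) \<partial>M)"
  proof (rule weighted_distr[OF \<xi>])
    show "0 \<le> 1 + sin (Z \<omega>)" "1 + sin (Z \<omega>) \<le> 2" for \<omega>
      using sin_ge_minus_one[of "Z \<omega>"] sin_le_one[of "Z \<omega>"] by linarith+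
    show "0 < (\<integral>\<omega>. (1 + sin (Z \<omega>)) \<partial>M)"
      using isn by (simp add: Es prob_space)
    fix t
    have "(\<integral>\<omega>. (1 + sin (Z \<omega>)) *\<^sub>R iexp (t * \<xi> \<omega>) \<partial>M)
       = (\<integral>\<omega>. iexp (t * \<xi> \<omega>) + (iexp (t * \<xi> \<omega> + 1 * Z \<omega>) / (2 * \<i>) - iexp (t * \<xi> \<omega> + (-1) * Z \<omega>) / (2 * \<i>)) \<partial>M)"
      unfolding s_iexp by (intro Bochner_Integration.integral_cong) (simp_all add: algebra_simps)
    also have "\<dots> = (\<integral>\<omega>. iexp (t * \<xi> \<omega>) \<partial>M) + ((\<integral>\<omega>. iexp (t * \<xi> \<omega> + 1 * Z \<omega>) \<partial>M) / (2 * \<i>) - (\<integral>\<omega>. iexp (t * \<xi> \<omega> + (-1) * Z \<omega>) \<partial>M) / (2 * \<i>))"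
    proof (subst Bochner_Integration.integral_add)
      have 1: "integrable M (\<lambda>\<omega>. iexp (t * \<xi> \<omega> + 1 * Z \<omega>) / (2 * \<i>))"
        and 2: "integrable M (\<lambda>\<omega>. iexp (t * \<xi> \<omega> + (-1) * Z \<omega>) / (2 * \<i>))"
        by (rule integrable_divide, rule iexpi, measurable)+
      show "integrable M (\<lambda>\<omega>. iexp (t * \<xi> \<omega>))" by (rule iexpi) measurable
      show "integrable M (\<lambda>\<omega>. iexp (t * \<xi> \<omega> + 1 * Z \<omega>) / (2 * \<i>) - iexp (t * \<xi> \<omega> + (-1) * Z \<omega>) / (2 * \<i>))"
        by (rule Bochner_Integration.integrable_diff[OF 1 2])
      show "(\<integral>\<omega>. iexp (t * \<xi> \<omega>) \<partial>M) + (\<integral>\<omega>. iexp (t * \<xi> \<omega> + 1 * Z \<omega>) / (2 * \<i>) - iexp (t * \<xi> \<omega> + (-1) * Z \<omega>) / (2 * \<i>) \<partial>M)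
        = (\<integral>\<omega>. iexp (t * \<xi> \<omega>) \<partial>M) + ((\<integral>\<omega>. iexp (t * \<xi> \<omega> + 1 * Z \<omega>) \<partial>M) / (2 * \<i>) - (\<integral>\<omega>. iexp (t * \<xi> \<omega> + (-1) * Z \<omega>) \<partial>M) / (2 * \<i>))"
        by (subst Bochner_Integration.integral_diff[OF 1 2]) simp
    qed
    also have "\<dots> = (\<integral>\<omega>. (1 + sin (Z \<omega>)) \<partial>M) *\<^sub>R (\<integral>\<omega>. iexp (t * \<xi> \<omega>) \<partial>M)"
      unfolding pm t0 using isn by (simp add: Es prob_space)
    finally show "(\<integral>\<omega>. (1 + sin (Z \<omega>)) *\<^sub>R iexp (t * \<xi> \<omega>) \<partial>M)
       = (\<integral>\<omega>. (1 + sin (Z \<omega>)) \<partial>M) *\<^sub>R (\<integral>\<omega>. iexp (t * \<xi> \<omega>) \<partial>M)" .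
  qed auto
  then have sA: "(\<integral>\<omega>. indicator A (\<xi> \<omega>) * sin (Z \<omega>) \<partial>M) = 0"
    using isn iA iAs by (simp add: distrib_left EA Es prob_space)
  have "(\<integral>\<omega>. indicator A (\<xi> \<omega>) *\<^sub>R iexp (Z \<omega>) \<partial>M)
    = (\<integral>\<omega>. complex_of_real (indicator A (\<xi> \<omega>) * cos (Z \<omega>)) + \<i> * complex_of_real (indicator A (\<xi> \<omega>) * sin (Z \<omega>)) \<partial>M)"
    unfolding split by (intro Bochner_Integration.integral_cong) (auto simp: scaleR_conv_of_real algebra_simps)
  also have "\<dots> = complex_of_real (\<integral>\<omega>. indicator A (\<xi> \<omega>) * cos (Z \<omega>) \<partial>M) + \<i> * complex_of_real (\<integral>\<omega>. indicator A (\<xi> \<omega>) * sin (Z \<omega>) \<partial>M)"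
    using iAc iAs by (subst Bochner_Integration.integral_add) (simp_all only: integrable_of_real integrable_mult_right integral_mult_right_zero integral_complex_of_real)
  also have "\<dots> = ?P *\<^sub>R (\<integral>\<omega>. iexp (Z \<omega>) \<partial>M)"
    unfolding cA sA EZ Ec Es by (simp add: scaleR_conv_of_real)
  finally show ?thesis .
qed

end

lemma integral_uniform_measure:
  fixes f :: "'w \<Rightarrow> 'b::{banach, second_countable_topology}"
  assumes "finite_measure M" and [measurable]: "B \<in> sets M" "f \<in> borel_measurable M"
    and pos: "measure M B > 0"
  shows "(\<integral>\<omega>. f \<omega> \<partial>uniform_measure M B) = (1 / measure M B) *\<^sub>R (\<integral>\<omega>. indicator B \<omega> *\<^sub>R f \<omega> \<partial>M)"
proof -
  interpret finite_measure M by fact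
  have "uniform_measure M B = density M (\<lambda>\<omega>. ennreal (indicator B \<omega> / measure M B))"
    unfolding uniform_measure_def emeasure_eq_measure using pos
    by (intro density_cong) (auto split: split_indicator simp: divide_ennreal[symmetric])
  then have "(\<integral>\<omega>. f \<omega> \<partial>uniform_measure M B) = (\<integral>\<omega>. (indicator B \<omega> / measure M B) *\<^sub>R f \<omega> \<partial>M)"
    by (simp add: integral_density)
  also have "\<dots> = (\<integral>\<omega>. (1 / measure M B) *\<^sub>R (indicator B \<omega> *\<^sub>R f \<omega>) \<partial>M)" by simp
  also have "\<dots> = (1 / measure M B) *\<^sub>R (\<integral>\<omega>. indicator B \<omega> *\<^sub>R f \<omega> \<partial>M)" by (rule integral_scaleR_right)
  finally show ?thesis .
qed

context gaussian_space
begin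

text \<open>Conditioning on an event determined by \<^term>\<open>\<xi>\<close> leaves the orthogonal
  complement of \<^term>\<open>\<xi>\<close> Gaussian with unchanged covariances. Independence is used
  below only in this form.\<close>

lemma
  assumes \<xi>: "\<xi> \<in> H" and A[measurable]: "A \<in> sets borel"
    and pos: "prob {\<omega> \<in> space M. \<xi> \<omega> \<in> A} > 0"
  defines "M' \<equiv> uniform_measure M {\<omega> \<in> space M. \<xi> \<omega> \<in> A}"
    and "H' \<equiv> {Z \<in> H. (\<integral>\<omega>. Z \<omega> * \<xi> \<omega> \<partial>M) = 0}"
  shows conditional_gaussian_space: "gaussian_space M' H'"
    and conditional_integral_sq: "\<And>Z. Z \<in> H' \<Longrightarrow> (\<integral>\<omega>. (Z \<omega>)\<^sup>2 \<partial>M') = (\<integral>\<omega>. (Z \<omega>)\<^sup>2 \<partial>M)"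
    and conditional_integral_mult: "\<And>Y Z. Y \<in> H' \<Longrightarrow> Z \<in> H' \<Longrightarrow> (\<integral>\<omega>. Y \<omega> * Z \<omega> \<partial>M') = (\<integral>\<omega>. Y \<omega> * Z \<omega> \<partial>M)"
proof -
  have [measurable]: "\<xi> \<in> borel_measurable M" using meas \<xi> by simp
  define B where "B = {\<omega> \<in> space M. \<xi> \<omega> \<in> A}"
  have [measurable]: "B \<in> sets M" unfolding B_def by measurable
  have B: "prob B > 0" using pos by (simp add: B_def)
  have M': "M' = uniform_measure M B" by (simp add: M'_def B_def)
  have [measurable_cong, simp]: "sets M' = sets M" "space M' = space M" by (simp_all add: M')
  interpret M': prob_space M'
    unfolding M' using B by (intro prob_space_uniform_measure) (auto simp: emeasure_eq_measure)
  have H'H: "Z \<in> H" if "Z \<in> H'" for Z using that by (simp add: H'_def)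
  have lin': "(\<lambda>\<omega>. r * Y \<omega> + Z \<omega>) \<in> H'" if "Y \<in> H'" "Z \<in> H'" for Y Z r
  proof -
    have "(\<integral>\<omega>. (r * Y \<omega> + Z \<omega>) * \<xi> \<omega> \<partial>M) = (\<integral>\<omega>. r * (Y \<omega> * \<xi> \<omega>) + Z \<omega> * \<xi> \<omega> \<partial>M)"
      by (intro Bochner_Integration.integral_cong) (auto simp: algebra_simps)
    also have "\<dots> = 0" using that \<xi> by (simp add: H'_def mult_integrable)
    finally show ?thesis using that lin by (auto simp: H'_def)
  qed
  have zero': "(\<lambda>_. 0) \<in> H'" using zero by (simp add: H'_def)
  have scale': "(\<lambda>\<omega>. r * Y \<omega>) \<in> H'" if "Y \<in> H'" for Y r
    using lin'[OF that zero', of r] by simp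
  have chf': "(\<integral>\<omega>. iexp (Z \<omega>) \<partial>M') = (\<integral>\<omega>. iexp (Z \<omega>) \<partial>M)" if Z: "Z \<in> H'" for Z
  proof -
    have [measurable]: "Z \<in> borel_measurable M" using meas H'H Z by auto
    have "(\<integral>\<omega>. iexp (Z \<omega>) \<partial>M') = (1 / prob B) *\<^sub>R (\<integral>\<omega>. indicator B \<omega> *\<^sub>R iexp (Z \<omega>) \<partial>M)"
      unfolding M' using B by (intro integral_uniform_measure) (auto simp: finite_measure_axioms)
    also have "(\<integral>\<omega>. indicator B \<omega> *\<^sub>R iexp (Z \<omega>) \<partial>M) = (\<integral>\<omega>. indicator A (\<xi> \<omega>) *\<^sub>R iexp (Z \<omega>) \<partial>M)"
      by (intro Bochner_Integration.integral_cong) (auto simp: B_def split: split_indicator)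
    also have "\<dots> = prob B *\<^sub>R (\<integral>\<omega>. iexp (Z \<omega>) \<partial>M)"
      unfolding B_def using Z by (intro orthogonal_factorisation[OF \<xi>]) (auto simp: H'_def)
    finally show ?thesis using B by simp
  qed
  have distr': "distr M' borel Z = distr M borel Z" if Z: "Z \<in> H'" for Z
  proof (rule Levy_uniqueness)
    have Zm[measurable]: "Z \<in> borel_measurable M" using meas H'H Z by auto
    show "real_distribution (distr M' borel Z)" by (rule M'.real_distribution_distr) measurable
    show "real_distribution (distr M borel Z)" using H'H[OF Z] by (rule real_distribution_distr)
    show "char (distr M' borel Z) = char (distr M borel Z)"
      unfolding char_def using chf'[OF scale'[OF Z]] by (auto simp: fun_eq_iff integral_distr)
  qed
  have sq': "integrable M' (\<lambda>\<omega>. (Z \<omega>)\<^sup>2) \<and> (\<integral>\<omega>. (Z \<omega>)\<^sup>2 \<partial>M') = (\<integral>\<omega>. (Z \<omega>)\<^sup>2 \<partial>M)" if Z: "Z \<in> H'" for Z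
  proof -
    have Zm[measurable]: "Z \<in> borel_measurable M" using meas H'H Z by auto
    have "integrable (distr M borel Z) (\<lambda>x. x\<^sup>2)"
      using sq[OF H'H[OF Z]] by (subst integrable_distr_eq) auto
    then have "integrable (distr M' borel Z) (\<lambda>x. x\<^sup>2)" by (simp add: distr'[OF Z])
    then have 1: "integrable M' (\<lambda>\<omega>. (Z \<omega>)\<^sup>2)" by (subst (asm) integrable_distr_eq) auto
    have "(\<integral>\<omega>. (Z \<omega>)\<^sup>2 \<partial>M') = (\<integral>x. x\<^sup>2 \<partial>distr M' borel Z)" by (subst integral_distr) auto
    also have "\<dots> = (\<integral>\<omega>. (Z \<omega>)\<^sup>2 \<partial>M)" unfolding distr'[OF Z] by (subst integral_distr) auto
    finally show ?thesis using 1 by simp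
  qed
  show G: "gaussian_space M' H'"
  proof
    fix Z assume Z: "Z \<in> H'"
    show "Z \<in> borel_measurable M'" using meas H'H Z by auto
    show "integrable M' (\<lambda>\<omega>. (Z \<omega>)\<^sup>2)" using sq' Z by simp
    show "(\<integral>\<omega>. iexp (Z \<omega>) \<partial>M') = complex_of_real (exp (- (\<integral>\<omega>. (Z \<omega>)\<^sup>2 \<partial>M') / 2))"
      using chf'[OF Z] sq'[OF Z] chf[OF H'H[OF Z]] by simp
  qed (use zero' lin' in auto)
  interpret G: gaussian_space M' H' by (rule G)
  show "(\<integral>\<omega>. (Z \<omega>)\<^sup>2 \<partial>M') = (\<integral>\<omega>. (Z \<omega>)\<^sup>2 \<partial>M)" if "Z \<in> H'" for Z
    using sq' that by simp
  show "(\<integral>\<omega>. Y \<omega> * Z \<omega> \<partial>M') = (\<integral>\<omega>. Y \<omega> * Z \<omega> \<partial>M)" if "Y \<in> H'" "Z \<in> H'" for Y Z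
    using G.integral_sq_lin[OF that, of 1] integral_sq_lin[OF H'H H'H, OF that, of 1]
      sq'[OF that(1)] sq'[OF that(2)] sq'[OF lin'[OF that, of 1]] by simp
qed

end

text \<open>The induction conditions on one coordinate at a time. The remaining ones are orthonormal in
a Gaussian space over the conditioned measure, hence the generalisation over the measure.\<close>

lemma orthonormal_box_prob:
  assumes "finite I" "gaussian_space M H" "\<And>i. i \<in> I \<Longrightarrow> g i \<in> H"
    and "\<And>i j. i \<in> I \<Longrightarrow> j \<in> I \<Longrightarrow> (\<integral>\<omega>. g i \<omega> * g j \<omega> \<partial>M) = (if i = j then 1 else 0)"
    and "\<And>i. i \<in> I \<Longrightarrow> A i \<in> sets borel"
  shows "measure M {\<omega> \<in> space M. \<forall>i\<in>I. g i \<omega> \<in> A i} = (\<Prod>i\<in>I. measure std_normal (A i))"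
  using assms
proof (induction I arbitrary: M H rule: finite_induct)
  case empty
  then interpret gaussian_space M H by simp
  show ?case by (simp add: prob_space)
next
  case (insert i I)
  interpret gaussian_space M H by fact
  have gi: "g i \<in> H" using insert by simp
  have [measurable]: "g j \<in> borel_measurable M" if "j \<in> insert i I" for j
    using insert.prems(2)[OF that] meas by simp
  have [measurable]: "A j \<in> sets borel" if "j \<in> insert i I" for j
    using insert.prems(4) that by simp
  define B where "B = {\<omega> \<in> space M. g i \<omega> \<in> A i}"
  have [measurable]: "B \<in> sets M" unfolding B_def by measurable
  define C where "C = {\<omega> \<in> space M. \<forall>j\<in>I. g j \<omega> \<in> A j}"
  have [measurable]: "C \<in> sets M" unfolding C_def using insert.hyps by measurable
  have int: "{\<omega> \<in> space M. \<forall>j\<in>insert i I. g j \<omega> \<in> A j} = B \<inter> C" by (auto simp: B_def C_def)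
  have "(\<integral>\<omega>. (g i \<omega>)\<^sup>2 \<partial>M) = 1"
    using insert.prems(3)[of i i] by (simp add: power2_eq_square)
  from distr_std_normal[OF gi this] have "measure std_normal (A i) = measure (distr M borel (g i)) (A i)" by simp
  also have "\<dots> = prob B" by (subst measure_distr) (auto simp: B_def intro!: arg_cong[where f=prob])
  finally have PB: "measure std_normal (A i) = prob B" .
  show ?case
  proof (cases "prob B = 0")
    case True
    have "prob (B \<inter> C) \<le> prob B" by (rule finite_measure_mono) auto
    then have "prob (B \<inter> C) = 0" using True measure_nonneg[of M "B \<inter> C"] by linarith
    then show ?thesis unfolding int using insert.hyps True PB by simp
  next
    case False
    then have pos: "prob {\<omega> \<in> space M. g i \<omega> \<in> A i} > 0"
      using measure_nonneg[of M B] by (simp add: B_def less_le)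
    define M' where "M' = uniform_measure M {\<omega> \<in> space M. g i \<omega> \<in> A i}"
    define H' where "H' = {Z \<in> H. (\<integral>\<omega>. Z \<omega> * g i \<omega> \<partial>M) = 0}"
    have Ai: "A i \<in> sets borel" by simp
    note cond = conditional_gaussian_space[OF gi Ai pos] conditional_integral_mult[OF gi Ai pos]
    have gH': "g j \<in> H'" if "j \<in> I" for j
      using insert.prems(2,3)[of j] insert.prems(3)[of j i] insert.hyps that by (auto simp: H'_def)
    have "measure M' {\<omega> \<in> space M'. \<forall>j\<in>I. g j \<omega> \<in> A j} = (\<Prod>j\<in>I. measure std_normal (A j))"
    proof (rule insert.IH)
      show "gaussian_space M' H'" unfolding M'_def H'_def by (rule cond(1))
      fix j k assume "j \<in> I" "k \<in> I"
      then show "(\<integral>\<omega>. g j \<omega> * g k \<omega> \<partial>M') = (if j = k then 1 else 0)"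
        using cond(2)[of "g j" "g k"] gH'[of j] gH'[of k] insert.prems(3)[of j k]
        unfolding M'_def H'_def by simp
    qed (use gH' in auto)
    moreover have "measure M' {\<omega> \<in> space M'. \<forall>j\<in>I. g j \<omega> \<in> A j} = prob (B \<inter> C) / prob B"
    proof -
      have "{\<omega> \<in> space M'. \<forall>j\<in>I. g j \<omega> \<in> A j} = C" by (simp add: M'_def C_def)
      then show ?thesis unfolding M'_def B_def[symmetric]
        using pos by (simp add: emeasure_eq_measure B_def[symmetric] less_le)
    qed
    ultimately show ?thesis
      unfolding int using False insert.hyps PB by (simp add: field_simps)
  qed
qed

context gaussian_space
begin

lemma distr_orthonormal:
  assumes I: "finite I" and g: "\<And>i. i \<in> I \<Longrightarrow> g i \<in> H"
    and on: "\<And>i j. i \<in> I \<Longrightarrow> j \<in> I \<Longrightarrow> (\<integral>\<omega>. g i \<omega> * g j \<omega> \<partial>M) = (if i = j then 1 else 0)"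
  shows "distr M (PiM I (\<lambda>_. std_normal)) (\<lambda>\<omega>. \<lambda>i\<in>I. g i \<omega>) = PiM I (\<lambda>_. std_normal)"
proof -
  interpret G: prob_space std_normal by (rule prob_space_std_normal)
  have [measurable]: "g i \<in> borel_measurable M" if "i \<in> I" for i using g[OF that] meas by simp
  have m: "(\<lambda>\<omega>. \<lambda>i\<in>I. g i \<omega>) \<in> measurable M (PiM I (\<lambda>_. std_normal))"
    by measurable
  show ?thesis
  proof (rule product_sigma_finite.PiM_eqI)
    show "product_sigma_finite (\<lambda>_::'a. std_normal)"
      by (rule product_sigma_finite.intro) (rule G.sigma_finite_measure_axioms)
    fix A :: "'a \<Rightarrow> real set" assume A: "\<And>i. i \<in> I \<Longrightarrow> A i \<in> sets std_normal"
    have "emeasure (distr M (PiM I (\<lambda>_. std_normal)) (\<lambda>\<omega>. \<lambda>i\<in>I. g i \<omega>)) (Pi\<^sub>E I A)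
      = emeasure M {\<omega> \<in> space M. \<forall>i\<in>I. g i \<omega> \<in> A i}"
      using A I by (subst emeasure_distr[OF m sets_PiM_I_finite])
        (auto intro!: arg_cong[where f="emeasure _"] simp: PiE_def Pi_def)
    also have "\<dots> = ennreal (\<Prod>i\<in>I. measure std_normal (A i))"
      unfolding emeasure_eq_measure using A
      by (subst orthonormal_box_prob[OF I gaussian_space_axioms g on]) auto
    also have "\<dots> = (\<Prod>i\<in>I. emeasure std_normal (A i))"
      by (simp add: G.emeasure_eq_measure prod_ennreal)
    finally show "emeasure (distr M (PiM I (\<lambda>_. std_normal)) (\<lambda>\<omega>. \<lambda>i\<in>I. g i \<omega>)) (Pi\<^sub>E I A)
      = (\<Prod>i\<in>I. emeasure std_normal (A i))" .
  qed (use I in auto)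
qed

text \<open>Gram-Schmidt, with the linear combinations valid almost surely because a residual of
  variance zero vanishes only almost surely.\<close>

lemma orthonormal_extension:
  fixes g0 :: "nat \<Rightarrow> 'w \<Rightarrow> real" and \<eta> :: "'k \<Rightarrow> 'w \<Rightarrow> real"
  assumes "finite L" "\<And>k. k \<in> L \<Longrightarrow> \<eta> k \<in> H"
    and "finite I0" "\<And>i. i \<in> I0 \<Longrightarrow> g0 i \<in> H"
    and "\<And>i j. i \<in> I0 \<Longrightarrow> j \<in> I0 \<Longrightarrow> (\<integral>\<omega>. g0 i \<omega> * g0 j \<omega> \<partial>M) = (if i = j then 1 else 0)"
  shows "\<exists>I g A. finite I \<and> I0 \<subseteq> I \<and> (\<forall>i\<in>I0. g i = g0 i) \<and> (\<forall>i\<in>I. g i \<in> H)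
    \<and> (\<forall>i\<in>I. \<forall>j\<in>I. (\<integral>\<omega>. g i \<omega> * g j \<omega> \<partial>M) = (if i = j then 1 else 0))
    \<and> (\<forall>k\<in>L. AE \<omega> in M. \<eta> k \<omega> = (\<Sum>j\<in>I. A k j * g j \<omega>))"
  using assms(1,2)
proof (induction L rule: finite_induct)
  case empty
  show ?case using assms(3-5) by (intro exI[of _ I0] exI[of _ g0]) auto
next
  case (insert l L)
  then obtain I :: "nat set" and g A where I: "finite I" "I0 \<subseteq> I" "\<forall>i\<in>I0. g i = g0 i" "\<forall>i\<in>I. g i \<in> H"
    and on: "\<forall>i\<in>I. \<forall>j\<in>I. (\<integral>\<omega>. g i \<omega> * g j \<omega> \<partial>M) = (if i = j then 1 else 0)"
    and A: "\<forall>k\<in>L. AE \<omega> in M. \<eta> k \<omega> = (\<Sum>j\<in>I. A k j * g j \<omega>)"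
    by auto
  have l: "\<eta> l \<in> H" using insert by simp
  define a where "a j = (\<integral>\<omega>. \<eta> l \<omega> * g j \<omega> \<partial>M)" for j
  define S where "S \<omega> = (\<Sum>j\<in>I. a j * g j \<omega>)" for \<omega>
  have S: "S \<in> H" unfolding S_def using I by (intro lincomb) auto
  define r where "r \<omega> = \<eta> l \<omega> - S \<omega>" for \<omega>
  have r: "r \<in> H" unfolding r_def by (rule diff[OF l S])
  have rg: "(\<integral>\<omega>. r \<omega> * g i \<omega> \<partial>M) = 0" if i: "i \<in> I" for i
  proof -
    have "(\<integral>\<omega>. r \<omega> * g i \<omega> \<partial>M) = (\<integral>\<omega>. \<eta> l \<omega> * g i \<omega> - (\<Sum>j\<in>I. a j * (g j \<omega> * g i \<omega>)) \<partial>M)"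
      by (intro Bochner_Integration.integral_cong) (auto simp: r_def S_def left_diff_distrib sum_distrib_right mult.assoc)
    also have "\<dots> = a i - (\<Sum>j\<in>I. a j * (\<integral>\<omega>. g j \<omega> * g i \<omega> \<partial>M))"
      using I l i by (subst Bochner_Integration.integral_diff)
        (auto simp: a_def Bochner_Integration.integral_sum mult_integrable)
    also have "(\<Sum>j\<in>I. a j * (\<integral>\<omega>. g j \<omega> * g i \<omega> \<partial>M)) = (\<Sum>j\<in>I. if j = i then a j else 0)"
      using on i by (intro sum.cong) auto
    also have "\<dots> = a i" using I i by simp
    finally show ?thesis by simp
  qed
  show ?case
  proof (cases "(\<integral>\<omega>. (r \<omega>)\<^sup>2 \<partial>M) = 0")
    case True
    then have "AE \<omega> in M. r \<omega> = 0" using r AE_zero by simp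
    then have "AE \<omega> in M. \<eta> l \<omega> = (\<Sum>j\<in>I. (A(l := a)) l j * g j \<omega>)"
      by eventually_elim (simp add: r_def S_def)
    then show ?thesis
      using I on A insert.hyps by (intro exI[of _ I] exI[of _ g] exI[of _ "A(l := a)"]) auto
  next
    case False
    define s where "s = sqrt (\<integral>\<omega>. (r \<omega>)\<^sup>2 \<partial>M)"
    have r2: "(\<integral>\<omega>. (r \<omega>)\<^sup>2 \<partial>M) > 0" using False by (simp add: less_le)
    have s: "s > 0" "s\<^sup>2 = (\<integral>\<omega>. (r \<omega>)\<^sup>2 \<partial>M)" using r2 by (simp_all add: s_def)
    obtain n where n: "n \<notin> I" using I(1) ex_new_if_finite[of I] by auto
    define h where "h = g(n := (\<lambda>\<omega>. (1/s) * r \<omega>))"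
    have hn: "h n = (\<lambda>\<omega>. (1/s) * r \<omega>)" and hi: "\<And>i. i \<in> I \<Longrightarrow> h i = g i"
      using n by (auto simp: h_def)
    have hH: "\<forall>i\<in>insert n I. h i \<in> H"
      using I hn hi scale[OF r, of "1/s"] by simp
    have nn: "(\<integral>\<omega>. h n \<omega> * h n \<omega> \<partial>M) = 1"
    proof -
      have "(\<integral>\<omega>. h n \<omega> * h n \<omega> \<partial>M) = (\<integral>\<omega>. (1/s)\<^sup>2 * (r \<omega>)\<^sup>2 \<partial>M)"
        unfolding hn by (intro Bochner_Integration.integral_cong) (auto simp: power2_eq_square)
      then show ?thesis using s r2 by (simp add: power_divide)
    qed
    have ni: "(\<integral>\<omega>. h n \<omega> * h i \<omega> \<partial>M) = 0" "(\<integral>\<omega>. h i \<omega> * h n \<omega> \<partial>M) = 0" if "i \<in> I" for i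
    proof -
      have "(\<integral>\<omega>. h n \<omega> * h i \<omega> \<partial>M) = (\<integral>\<omega>. (1/s) * (r \<omega> * g i \<omega>) \<partial>M)"
        unfolding hn hi[OF that] by (intro Bochner_Integration.integral_cong) auto
      then show "(\<integral>\<omega>. h n \<omega> * h i \<omega> \<partial>M) = 0" using rg[OF that] by simp
      then show "(\<integral>\<omega>. h i \<omega> * h n \<omega> \<partial>M) = 0" by (simp add: mult.commute)
    qed
    have on': "\<forall>i\<in>insert n I. \<forall>j\<in>insert n I. (\<integral>\<omega>. h i \<omega> * h j \<omega> \<partial>M) = (if i = j then 1 else 0)"
      using on nn ni n hi by auto
    define A' where "A' k j = (if k = l then (if j = n then s else a j) else (if j = n then 0 else A k j))" for k j
    have sumA: "(\<Sum>j\<in>insert n I. A' k j * h j \<omega>) = A' k n * h n \<omega> + (\<Sum>j\<in>I. A' k j * g j \<omega>)" for k \<omega>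
      using n I hi by simp
    have "AE \<omega> in M. \<eta> k \<omega> = (\<Sum>j\<in>insert n I. A' k j * h j \<omega>)" if k: "k \<in> insert l L" for k
    proof (cases "k = l")
      case True
      have "(\<Sum>j\<in>I. A' l j * g j \<omega>) = S \<omega>" for \<omega>
        unfolding S_def using n by (intro sum.cong) (auto simp: A'_def)
      then have "\<eta> k \<omega> = (\<Sum>j\<in>insert n I. A' k j * h j \<omega>)" for \<omega>
        unfolding sumA True hn using s by (simp add: A'_def[of l n] r_def)
      then show ?thesis by simp
    next
      case False
      then have "AE \<omega> in M. \<eta> k \<omega> = (\<Sum>j\<in>I. A k j * g j \<omega>)" using A k by auto
      moreover have "(\<Sum>j\<in>I. A' k j * g j \<omega>) = (\<Sum>j\<in>I. A k j * g j \<omega>)" for \<omega>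
        using n False by (intro sum.cong) (auto simp: A'_def)
      ultimately show ?thesis unfolding sumA using False by (simp add: A'_def[of k n])
    qed
    then show ?thesis
      using I on' hH n by (intro exI[of _ "insert n I"] exI[of _ h] exI[of _ A']) (auto simp: hi)
  qed
qed

text \<open>In an orthonormal basis whose first vector is the normalised \<^term>\<open>\<xi>\<close>, the event becomes a
slab intersection in a product of standard normal laws.\<close>

lemma sidak_step:
  assumes \<xi>: "\<xi> \<in> H" and s: "s \<ge> 0" and L: "finite L" and \<eta>: "\<And>k. k \<in> L \<Longrightarrow> \<eta> k \<in> H"
  shows "prob {\<omega> \<in> space M. \<bar>\<xi> \<omega>\<bar> \<le> s} * prob {\<omega> \<in> space M. \<forall>k\<in>L. \<bar>\<eta> k \<omega>\<bar> \<le> t k}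
    \<le> prob {\<omega> \<in> space M. \<bar>\<xi> \<omega>\<bar> \<le> s \<and> (\<forall>k\<in>L. \<bar>\<eta> k \<omega>\<bar> \<le> t k)}"
proof -
  have [measurable]: "\<xi> \<in> borel_measurable M" using meas \<xi> by simp
  have \<eta>m[measurable]: "\<eta> k \<in> borel_measurable M" if "k \<in> L" for k using meas \<eta> that by simp
  have K[measurable]: "{\<omega> \<in> space M. \<forall>k\<in>L. \<bar>\<eta> k \<omega>\<bar> \<le> t k} \<in> sets M"
    using L by measurable
  show ?thesis
  proof (cases "(\<integral>\<omega>. (\<xi> \<omega>)\<^sup>2 \<partial>M) = 0")
    case True
    then have "AE \<omega> in M. \<xi> \<omega> = 0" using \<xi> AE_zero by simp
    then have "prob {\<omega> \<in> space M. \<bar>\<xi> \<omega>\<bar> \<le> s \<and> (\<forall>k\<in>L. \<bar>\<eta> k \<omega>\<bar> \<le> t k)} = prob {\<omega> \<in> space M. \<forall>k\<in>L. \<bar>\<eta> k \<omega>\<bar> \<le> t k}"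
      using s L by (intro finite_measure_eq_AE) auto
    then show ?thesis by (simp add: mult_left_le_one_le)
  next
    case False
    define \<tau> where "\<tau> = sqrt (\<integral>\<omega>. (\<xi> \<omega>)\<^sup>2 \<partial>M)"
    have \<tau>: "\<tau> > 0" "\<tau>\<^sup>2 = (\<integral>\<omega>. (\<xi> \<omega>)\<^sup>2 \<partial>M)" using False by (simp_all add: \<tau>_def less_le)
    define g0 where "g0 = (\<lambda>_::nat. \<lambda>\<omega>. (1/\<tau>) * \<xi> \<omega>)"
    have g0: "g0 i \<in> H" for i unfolding g0_def by (rule scale[OF \<xi>])
    have on0: "(\<integral>\<omega>. g0 i \<omega> * g0 j \<omega> \<partial>M) = 1" for i j
    proof -
      have "(\<integral>\<omega>. g0 i \<omega> * g0 j \<omega> \<partial>M) = (\<integral>\<omega>. (1/\<tau>)\<^sup>2 * (\<xi> \<omega>)\<^sup>2 \<partial>M)"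
        unfolding g0_def by (intro Bochner_Integration.integral_cong) (auto simp: power2_eq_square)
      then show ?thesis using \<tau> False by (simp add: power_divide)
    qed
    obtain I :: "nat set" and g A where I: "finite I" "{0} \<subseteq> I" "\<forall>i\<in>{0}. g i = g0 i" "\<forall>i\<in>I. g i \<in> H"
      and on: "\<forall>i\<in>I. \<forall>j\<in>I. (\<integral>\<omega>. g i \<omega> * g j \<omega> \<partial>M) = (if i = j then 1 else 0)"
      and A: "\<forall>k\<in>L. AE \<omega> in M. \<eta> k \<omega> = (\<Sum>j\<in>I. A k j * g j \<omega>)"
      using orthonormal_extension[OF L, where \<eta> = \<eta> and ?I0.0 = "{0}" and ?g0.0 = g0] \<eta> g0 on0 by auto
    define N where "N = PiM I (\<lambda>_. std_normal)"
    have gm[measurable]: "g i \<in> borel_measurable M" if "i \<in> I" for i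
      using meas[of "g i"] I(4) that by blast
    define G where "G = (\<lambda>\<omega>. \<lambda>i\<in>I. g i \<omega>)"
    have Gm: "G \<in> measurable M N" unfolding N_def G_def by measurable
    have dG: "distr M N G = N" unfolding N_def G_def using I on by (intro distr_orthonormal) auto
    have transfer: "measure N {w \<in> space N. Q w} = prob {\<omega> \<in> space M. R \<omega>}"
      if Q: "{w \<in> space N. Q w} \<in> sets N" and R: "{\<omega> \<in> space M. R \<omega>} \<in> sets M"
        and QR: "AE \<omega> in M. Q (G \<omega>) = R \<omega>" for Q R
    proof -
      have "measure N {w \<in> space N. Q w} = measure (distr M N G) {w \<in> space N. Q w}" by (simp add: dG)
      also have "\<dots> = prob (G -` {w \<in> space N. Q w} \<inter> space M)" by (rule measure_distr[OF Gm Q])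
      also have "\<dots> = prob {\<omega> \<in> space M. R \<omega>}"
      proof (rule finite_measure_eq_AE)
        show "AE \<omega> in M. \<omega> \<in> G -` {w \<in> space N. Q w} \<inter> space M \<longleftrightarrow> \<omega> \<in> {\<omega> \<in> space M. R \<omega>}"
          using QR AE_space by eventually_elim (use measurable_space[OF Gm] in auto)
      qed (use Gm Q R in auto)
      finally show ?thesis .
    qed
    have A': "AE \<omega> in M. \<forall>k\<in>L. \<eta> k \<omega> = (\<Sum>j\<in>I. A k j * G \<omega> j)"
      using A L by (subst AE_finite_all) (auto simp: G_def)
    have ins: "insert 0 (I - {0}) = I" using I by auto
    have G0: "\<bar>G \<omega> 0\<bar> \<le> s / \<tau> \<longleftrightarrow> \<bar>\<xi> \<omega>\<bar> \<le> s" for \<omega>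
      using I \<tau> by (simp add: G_def g0_def abs_mult divide_le_cancel)
    have 0: "0 \<in> I" using I by simp
    have m1: "{w \<in> space N. \<bar>w 0\<bar> \<le> s / \<tau>} \<in> sets N"
      unfolding N_def using 0 by measurable
    have m2: "{w \<in> space N. \<forall>k\<in>L. \<bar>\<Sum>j\<in>I. A k j * w j\<bar> \<le> t k} \<in> sets N"
      unfolding N_def using L by measurable
    have m3: "{w \<in> space N. \<bar>w 0\<bar> \<le> s / \<tau> \<and> (\<forall>k\<in>L. \<bar>\<Sum>j\<in>I. A k j * w j\<bar> \<le> t k)} \<in> sets N"
      unfolding N_def using L 0 by measurable
    have e1: "measure N {w \<in> space N. \<bar>w 0\<bar> \<le> s / \<tau>} = prob {\<omega> \<in> space M. \<bar>\<xi> \<omega>\<bar> \<le> s}"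
      using m1 by (intro transfer) (auto simp: G0)
    have e2: "measure N {w \<in> space N. \<forall>k\<in>L. \<bar>\<Sum>j\<in>I. A k j * w j\<bar> \<le> t k} = prob {\<omega> \<in> space M. \<forall>k\<in>L. \<bar>\<eta> k \<omega>\<bar> \<le> t k}"
    proof (rule transfer[OF m2 K])
      show "AE \<omega> in M. (\<forall>k\<in>L. \<bar>\<Sum>j\<in>I. A k j * G \<omega> j\<bar> \<le> t k) = (\<forall>k\<in>L. \<bar>\<eta> k \<omega>\<bar> \<le> t k)"
        using A' by eventually_elim auto
    qed
    have e3: "measure N {w \<in> space N. \<bar>w 0\<bar> \<le> s / \<tau> \<and> (\<forall>k\<in>L. \<bar>\<Sum>j\<in>I. A k j * w j\<bar> \<le> t k)}
      = prob {\<omega> \<in> space M. \<bar>\<xi> \<omega>\<bar> \<le> s \<and> (\<forall>k\<in>L. \<bar>\<eta> k \<omega>\<bar> \<le> t k)}"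
    proof (rule transfer[OF m3])
      show "{\<omega> \<in> space M. \<bar>\<xi> \<omega>\<bar> \<le> s \<and> (\<forall>k\<in>L. \<bar>\<eta> k \<omega>\<bar> \<le> t k)} \<in> sets M"
        using L by measurable
      show "AE \<omega> in M. (\<bar>G \<omega> 0\<bar> \<le> s / \<tau> \<and> (\<forall>k\<in>L. \<bar>\<Sum>j\<in>I. A k j * G \<omega> j\<bar> \<le> t k))
        = (\<bar>\<xi> \<omega>\<bar> \<le> s \<and> (\<forall>k\<in>L. \<bar>\<eta> k \<omega>\<bar> \<le> t k))"
        using A' by eventually_elim (auto simp: G0)
    qed
    have "0 \<le> s / \<tau>" using s \<tau> by simp
    from sidak_PiM_std_normal[OF _ L _ this, of "I - {0}" 0 A t] I(1)
    show ?thesis unfolding ins N_def[symmetric] e1 e2 e3 by simp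
  qed
qed

lemma sidak:
  assumes "finite L" and "\<And>k. k \<in> L \<Longrightarrow> \<eta> k \<in> H" and "\<And>k. k \<in> L \<Longrightarrow> t k \<ge> 0"
  shows "(\<Prod>k\<in>L. prob {\<omega> \<in> space M. \<bar>\<eta> k \<omega>\<bar> \<le> t k}) \<le> prob {\<omega> \<in> space M. \<forall>k\<in>L. \<bar>\<eta> k \<omega>\<bar> \<le> t k}"
  using assms
proof (induction L rule: finite_induct)
  case empty
  then show ?case by (simp add: prob_space)
next
  case (insert l L)
  have "(\<Prod>k\<in>insert l L. prob {\<omega> \<in> space M. \<bar>\<eta> k \<omega>\<bar> \<le> t k})
    = prob {\<omega> \<in> space M. \<bar>\<eta> l \<omega>\<bar> \<le> t l} * (\<Prod>k\<in>L. prob {\<omega> \<in> space M. \<bar>\<eta> k \<omega>\<bar> \<le> t k})"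
    using insert.hyps by simp
  also have "\<dots> \<le> prob {\<omega> \<in> space M. \<bar>\<eta> l \<omega>\<bar> \<le> t l} * prob {\<omega> \<in> space M. \<forall>k\<in>L. \<bar>\<eta> k \<omega>\<bar> \<le> t k}"
    using insert by (intro mult_left_mono) auto
  also have "\<dots> \<le> prob {\<omega> \<in> space M. \<bar>\<eta> l \<omega>\<bar> \<le> t l \<and> (\<forall>k\<in>L. \<bar>\<eta> k \<omega>\<bar> \<le> t k)}"
    using insert by (intro sidak_step) auto
  finally show ?case by simp
qed

end

section \<open>Small balls of Hoelder continuous Gaussian processes\<close>

text \<open>Markov's inequality for an even moment.\<close>

lemma std_normal_interval_lower_large:
  assumes r: "r > 0"
  shows "measure std_normal {-r..r} \<ge> 1 - (fact (2 * k) / (2^k * fact k)) / r ^ (2 * k)"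
proof -
  interpret prob_space std_normal by (rule prob_space_std_normal)
  have "prob {x \<in> space std_normal. x ^ (2 * k) \<ge> r ^ (2 * k)} \<le> expectation (\<lambda>x. x ^ (2 * k)) / r ^ (2 * k)"
    using r std_normal_distribution_even_moments(2)[of k]
    by (intro integral_Markov_inequality_measure[where A = "{}"]) auto
  then have "prob {x \<in> space std_normal. x ^ (2 * k) \<ge> r ^ (2 * k)} \<le> (fact (2 * k) / (2^k * fact k)) / r ^ (2 * k)"
    using std_normal_distribution_even_moments(1)[of k] by simp
  moreover have "prob (space std_normal - {-r..r}) \<le> prob {x \<in> space std_normal. x ^ (2 * k) \<ge> r ^ (2 * k)}"
  proof (rule finite_measure_mono)
    show "space std_normal - {-r..r} \<subseteq> {x \<in> space std_normal. x ^ (2 * k) \<ge> r ^ (2 * k)}"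
    proof
      fix x assume "x \<in> space std_normal - {-r..r}"
      then have "r \<le> \<bar>x\<bar>" by auto
      then have "r ^ (2 * k) \<le> \<bar>x\<bar> ^ (2 * k)" using r by (intro power_mono) auto
      then show "x \<in> {x \<in> space std_normal. x ^ (2 * k) \<ge> r ^ (2 * k)}" by (simp add: power_even_abs)
    qed
  qed simp
  moreover have "prob (space std_normal - {-r..r}) = 1 - prob {-r..r}"
    by (rule prob_compl) simp
  ultimately show ?thesis by linarith
qed

lemma std_normal_interval_lower_small:
  assumes r: "0 < r" "r \<le> R"
  shows "measure std_normal {-r..r} \<ge> 2 * r * std_normal_density R"
proof -
  interpret prob_space std_normal by (rule prob_space_std_normal)
  have "ennreal (2 * r * std_normal_density R) = (\<integral>\<^sup>+x. ennreal (std_normal_density R) * indicator {-r..r} x \<partial>lborel)"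
    using r by (subst nn_integral_cmult_indicator) (auto simp: ennreal_mult'[symmetric] mult.commute)
  also have "\<dots> \<le> (\<integral>\<^sup>+x. ennreal (std_normal_density x) * indicator {-r..r} x \<partial>lborel)"
  proof (rule nn_integral_mono)
    fix x :: real
    show "ennreal (std_normal_density R) * indicator {-r..r} x \<le> ennreal (std_normal_density x) * indicator {-r..r} x"
    proof (cases "x \<in> {-r..r}")
      case True
      then have "\<bar>x\<bar> \<le> R" using r by auto
      then have "x\<^sup>2 \<le> R\<^sup>2" using r abs_le_square_iff[of x R] by simp
      then have "std_normal_density R \<le> std_normal_density x"
        unfolding std_normal_density_def by (intro mult_left_mono) auto
      then show ?thesis using True by (simp add: ennreal_leI)
    qed simp
  qed
  also have "\<dots> = emeasure std_normal {-r..r}"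
    by (subst emeasure_density) auto
  finally show ?thesis by (simp add: emeasure_eq_measure)
qed

text \<open>For small \<open>r\<close> the probability is of order \<open>r\<close>, for large \<open>r\<close> the complementary
  probability decays faster than any power; one power therefore serves both regimes.\<close>

lemma std_normal_interval_lower:
  assumes p: "p > 0"
  obtains C where "C > 0" "\<And>r. r > 0 \<Longrightarrow> measure std_normal {-r..r} \<ge> exp (- C * r powr (- p))"
proof -
  obtain k :: nat where k: "p \<le> real k" "k \<ge> 1"
    using real_arch_simple[of "max p 1"] by auto
  define D :: real where "D = fact (2 * k) / (2^k * fact k)"
  have D: "D > 0" by (simp add: D_def)
  define R where "R = max 1 (2 * D)"
  have R: "R \<ge> 1" "R \<ge> 2 * D" by (simp_all add: R_def)
  let ?\<rho> = "2 * std_normal_density R"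
  have \<rho>: "?\<rho> > 0" by (simp add: normal_density_pos)
  define C where "C = 2 * D + 1 / p + \<bar>ln ?\<rho>\<bar> * R powr p"
  have C: "C > 0" unfolding C_def using D p by (intro add_pos_nonneg add_pos_pos) auto
  have "measure std_normal {-r..r} \<ge> exp (- C * r powr (- p))" if r: "r > 0" for r
  proof (cases "r \<ge> R")
    case True
    then have r1: "r \<ge> 1" using R by simp
    define x where "x = D / r ^ (2 * k)"
    have "r \<le> r ^ (2 * k)" using r1 k by (intro self_le_power) auto
    then have "2 * D \<le> r ^ (2 * k)" using R True by linarith
    then have x: "0 \<le> x" "x \<le> 1/2" using D r by (auto simp: x_def field_simps)
    have "x \<le> D * r powr (- p)"
    proof -
      have "r powr p \<le> r powr (real (2 * k))" using r1 k by (intro powr_mono) auto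
      also have "\<dots> = r ^ (2 * k)" using r by (rule powr_realpow)
      finally show ?thesis unfolding x_def powr_minus_divide using r D by (simp add: divide_left_mono)
    qed
    then have 1: "- C * r powr (- p) \<le> - 2 * x"
    proof -
      have "2 * D * r powr (- p) \<le> C * r powr (- p)"
        using p by (intro mult_right_mono) (auto simp: C_def)
      then show ?thesis using \<open>x \<le> D * r powr (- p)\<close> by simp
    qed
    have "x * x \<le> x * (1/2)" using x by (intro mult_left_mono) auto
    then have "- 2 * x \<le> - x - 2 * x\<^sup>2" by (simp add: power2_eq_square)
    also have "\<dots> \<le> ln (1 - x)" using x by (intro ln_one_minus_pos_lower_bound) auto
    finally have "exp (- 2 * x) \<le> exp (ln (1 - x))" by simp
    also have "\<dots> = 1 - x" using x by simp
    also have "\<dots> \<le> measure std_normal {-r..r}"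
      using std_normal_interval_lower_large[OF r, of k] by (simp add: x_def D_def)
    finally show ?thesis using 1 by (meson exp_le_cancel_iff order_trans)
  next
    case False
    have e: "- C * r powr (- p) \<le> ln r + ln ?\<rho>"
    proof -
      have "ln (r powr (- p)) \<le> r powr (- p)" using r by (intro ln_bound) auto
      then have "- p * ln r \<le> r powr (- p)" using r by (simp add: ln_powr)
      then have 1: "- ln r \<le> 1 / p * r powr (- p)" using p by (simp add: field_simps)
      have "1 \<le> (R / r) powr p" using False r p by (intro ge_one_powr_ge_zero) auto
      also have "(R / r) powr p = R powr p * r powr (- p)"
        using r R by (simp add: powr_divide powr_minus_divide)
      finally have "\<bar>ln ?\<rho>\<bar> * 1 \<le> \<bar>ln ?\<rho>\<bar> * (R powr p * r powr (- p))" by (intro mult_left_mono) auto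
      then have 2: "- ln ?\<rho> \<le> \<bar>ln ?\<rho>\<bar> * R powr p * r powr (- p)" by (simp add: mult.assoc)
      have "0 \<le> 2 * D * r powr (- p)" using D by simp
      moreover have "- C * r powr (- p) = - (2 * D * r powr (- p)) - 1 / p * r powr (- p) - \<bar>ln ?\<rho>\<bar> * R powr p * r powr (- p)"
        by (simp add: C_def algebra_simps)
      ultimately show ?thesis using 1 2 by linarith
    qed
    have "exp (- C * r powr (- p)) \<le> exp (ln r + ln ?\<rho>)" using e by simp
    also have "\<dots> = 2 * r * std_normal_density R" using r \<rho> by (simp add: exp_add)
    also have "\<dots> \<le> measure std_normal {-r..r}"
      using False r by (intro std_normal_interval_lower_small) auto
    finally show ?thesis .
  qed
  then show ?thesis using that C by blast
qed

lemma (in gaussian_space) prob_abs_le_lower: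
  assumes Y: "Y \<in> H" and s: "s > 0" "(\<integral>\<omega>. (Y \<omega>)\<^sup>2 \<partial>M) \<le> s\<^sup>2" and t: "t \<ge> 0"
  shows "prob {\<omega> \<in> space M. \<bar>Y \<omega>\<bar> \<le> t} \<ge> measure std_normal {- (t / s)..t / s}"
proof (cases "(\<integral>\<omega>. (Y \<omega>)\<^sup>2 \<partial>M) = 0")
  case True
  have [measurable]: "Y \<in> borel_measurable M" using meas Y by simp
  interpret N: prob_space std_normal by (rule prob_space_std_normal)
  have "AE \<omega> in M. Y \<omega> = 0" using Y True by (rule AE_zero)
  then have "prob {\<omega> \<in> space M. \<bar>Y \<omega>\<bar> \<le> t} = prob (space M)"
    using t by (intro finite_measure_eq_AE) auto
  then show ?thesis by (simp add: prob_space)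
next
  case False
  interpret N: prob_space std_normal by (rule prob_space_std_normal)
  define \<tau> where "\<tau> = sqrt (\<integral>\<omega>. (Y \<omega>)\<^sup>2 \<partial>M)"
  have \<tau>: "\<tau> > 0" "(\<integral>\<omega>. (Y \<omega>)\<^sup>2 \<partial>M) = \<tau>\<^sup>2" using False by (simp_all add: \<tau>_def less_le)
  have "\<tau> \<le> s" using s \<tau> by (metis power2_le_imp_le less_imp_le)
  then have "t / s \<le> t / \<tau>" using t \<tau> s by (intro divide_left_mono) auto
  then have "measure std_normal {- (t / s)..t / s} \<le> measure std_normal {- (t / \<tau>)..t / \<tau>}"
    by (intro N.finite_measure_mono) auto
  then show ?thesis using prob_abs_le[OF Y \<tau>] by simp
qed

lemma sum_power_le_geometric:
  fixes x :: real
  assumes x: "0 < x" "x < 1" and "finite A" "inj_on f A"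
  shows "(\<Sum>j\<in>A. x ^ f j) \<le> 1 / (1 - x)"
proof -
  have "(\<Sum>j\<in>A. x ^ f j) = (\<Sum>m\<in>f ` A. x ^ m)"
    using assms by (simp add: sum.reindex)
  also have "\<dots> \<le> (\<Sum>m. x ^ m)"
    using assms by (intro sum_le_suminf summable_geometric) auto
  also have "\<dots> = 1 / (1 - x)" using x by (simp add: suminf_geometric)
  finally show ?thesis .
qed

definition nat_dist :: "nat \<Rightarrow> nat \<Rightarrow> nat" where
  "nat_dist i j = (i - j) + (j - i)"

lemma sum_power_nat_dist_le:
  fixes x :: real
  assumes x: "0 < x" "x < 1"
  shows "(\<Sum>j\<le>n. x ^ nat_dist j m) \<le> 2 / (1 - x)"
proof -
  have "{..n} = ({..n} \<inter> {..m}) \<union> ({..n} \<inter> {m<..})" by auto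
  then have "(\<Sum>j\<le>n. x ^ nat_dist j m) = (\<Sum>j\<in>({..n} \<inter> {..m}) \<union> ({..n} \<inter> {m<..}). x ^ nat_dist j m)" by simp
  also have "\<dots> = (\<Sum>j\<in>{..n} \<inter> {..m}. x ^ nat_dist j m) + (\<Sum>j\<in>{..n} \<inter> {m<..}. x ^ nat_dist j m)"
    by (rule sum.union_disjoint) auto
  also have "(\<Sum>j\<in>{..n} \<inter> {..m}. x ^ nat_dist j m) \<le> 1 / (1 - x)"
    using x by (intro sum_power_le_geometric) (auto simp: nat_dist_def inj_on_def)
  also have "(\<Sum>j\<in>{..n} \<inter> {m<..}. x ^ nat_dist j m) \<le> 1 / (1 - x)"
    using x by (intro sum_power_le_geometric) (auto simp: nat_dist_def inj_on_def)
  finally show ?thesis by simp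
qed

lemma power_two_between:
  fixes x :: real
  assumes "x \<ge> 1"
  obtains j :: nat where "x \<le> 2 ^ j" "2 ^ j \<le> 2 * x"
proof -
  obtain n where "x < 2 ^ n" using real_arch_pow[of 2 x] by auto
  then have ex: "\<exists>n. x \<le> 2 ^ n" by (auto intro: less_imp_le)
  define j where "j = (LEAST n. x \<le> 2 ^ n)"
  have j: "x \<le> 2 ^ j" unfolding j_def by (rule LeastI_ex[OF ex])
  have "2 ^ j \<le> 2 * x"
  proof (cases j)
    case 0
    then show ?thesis using assms by simp
  next
    case (Suc i)
    then have "\<not> x \<le> 2 ^ i" using not_less_Least[of i "\<lambda>n. x \<le> 2 ^ n"] by (simp add: j_def)
    then show ?thesis using Suc by simp
  qed
  then show ?thesis using that j by blast
qed

lemma dyadic_mem_unit_interval: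
  fixes k n :: nat
  assumes "k < 2 ^ n"
  shows "real k / 2 ^ n \<in> {0..1}"
proof -
  have "real k < real (2 ^ n)" using assms by (simp only: of_nat_less_iff)
  then show ?thesis by simp
qed

text \<open>The increment from the parent of a dyadic point of level \<^term>\<open>j\<close>; the root
  contributes the value of the process itself.\<close>

definition dyadic_increment :: "(real \<Rightarrow> 'w \<Rightarrow> real) \<Rightarrow> nat \<Rightarrow> nat \<Rightarrow> 'w \<Rightarrow> real" where
  "dyadic_increment Z j i \<omega> =
    (if j = 0 then Z 0 \<omega> else Z (real i / 2 ^ j) \<omega> - Z (real (i div 2) / 2 ^ (j - 1)) \<omega>)"

lemma dyadic_chain:
  "k < 2 ^ n \<Longrightarrow> Z (real k / 2 ^ n) \<omega> = (\<Sum>j\<le>n. dyadic_increment Z j (k div 2 ^ (n - j)) \<omega>)"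
proof (induction n arbitrary: k)
  case 0
  then show ?case by (simp add: dyadic_increment_def)
next
  case (Suc n)
  have "k div 2 < 2 ^ n" using Suc.prems by auto
  note IH = Suc.IH[OF this]
  have "k div 2 ^ (Suc n - j) = k div 2 div 2 ^ (n - j)" if "j \<le> n" for j
    using that by (simp add: Suc_diff_le div_mult2_eq)
  then have "(\<Sum>j\<le>n. dyadic_increment Z j (k div 2 ^ (Suc n - j)) \<omega>) = (\<Sum>j\<le>n. dyadic_increment Z j (k div 2 div 2 ^ (n - j)) \<omega>)"
    by (intro sum.cong) auto
  also have "\<dots> = Z (real (k div 2) / 2 ^ n) \<omega>" using IH by simp
  finally show ?case by (simp add: dyadic_increment_def)
qed

text \<open>Talagrand's small ball estimate for processes that are Hoelder continuous in mean square.
  The constant depends on the process only through \<^term>\<open>\<beta>\<close> and \<^term>\<open>K\<close>.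
  The thresholds \<open>\<alpha>\<close> peak at the level \<open>m\<close> whose increments have standard deviation
  comparable to \<open>\<epsilon>\<close>. Above \<open>m\<close> the thresholds decay slower than the standard deviations,
  below \<open>m\<close> there are only few increments; in both cases the \<open>2 ^ j\<close> factors of level \<open>j\<close>
  cost, up to a constant, at most \<open>2 ^ m\<close> times a geometrically small factor. By Sidak's inequality these costs
  add up.\<close>

lemma small_ball:
  fixes \<beta> K :: real
  assumes \<beta>: "\<beta> > 0" and K: "K > 0"
  obtains C where "C > 0"
    "\<And>(M::'w measure) H Z n \<epsilon>. \<lbrakk>gaussian_space M H; \<And>t. t \<in> {0..1} \<Longrightarrow> Z t \<in> H;
       (\<integral>\<omega>. (Z 0 \<omega>)\<^sup>2 \<partial>M) \<le> K\<^sup>2;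
       \<And>s t. s \<in> {0..1} \<Longrightarrow> t \<in> {0..1} \<Longrightarrow> (\<integral>\<omega>. (Z s \<omega> - Z t \<omega>)\<^sup>2 \<partial>M) \<le> (K * \<bar>s - t\<bar> powr \<beta>)\<^sup>2;
       0 < \<epsilon>; \<epsilon> \<le> 1\<rbrakk>
     \<Longrightarrow> measure M {\<omega> \<in> space M. \<forall>k<2^n. \<bar>Z (real k / 2 ^ n) \<omega>\<bar> \<le> \<epsilon>} \<ge> exp (- C * \<epsilon> powr (- 1 / \<beta>))"
proof -
  define y where "y = 2 powr (- \<beta> / 2)"
  define \<theta> where "\<theta> = 2 powr (- 1 / 2 :: real)"
  have y: "0 < y" "y < 1" using \<beta> by (auto simp: y_def powr_less_one)
  have \<theta>: "0 < \<theta>" "\<theta> < 1" by (auto simp: \<theta>_def powr_less_one)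
  define A where "A = 2 / (1 - y)"
  have A: "A \<ge> 2" using y by (simp add: A_def field_simps)
  \<comment> \<open>The exponents trade the ratio of threshold to standard deviation for powers of two. Above
    level \<open>m\<close> the ratio grows like \<open>2 powr (\<beta> / 2)\<close> per level, and \<open>p1\<close> turns this into a
    factor \<open>1 / 4\<close> that beats the doubling of the number of increments. Below level \<open>m\<close> the
    ratio shrinks by \<open>2 powr (3 * \<beta> / 2)\<close> per level further down, and \<open>p2\<close> limits the cost to
    a factor \<open>sqrt 2\<close> against the halving of their number.\<close>
  define p1 where "p1 = 4 / \<beta>"
  define p2 where "p2 = 1 / (3 * \<beta>)"
  have p: "p1 > 0" "p2 > 0" using \<beta> by (auto simp: p1_def p2_def)
  obtain C1 where C1: "C1 > 0" "\<And>r. r > 0 \<Longrightarrow> measure std_normal {-r..r} \<ge> exp (- C1 * r powr (- p1))"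
    using std_normal_interval_lower[OF p(1)] by blast
  obtain C2 where C2: "C2 > 0" "\<And>r. r > 0 \<Longrightarrow> measure std_normal {-r..r} \<ge> exp (- C2 * r powr (- p2))"
    using std_normal_interval_lower[OF p(2)] by blast
  define D where "D = C1 * K powr p1 + C2 * K powr p2"
  have D: "D > 0" using C1 C2 K by (auto simp: D_def intro!: add_pos_pos)
  define C where "C = D * (2 / (1 - \<theta>)) * (2 * A powr (1 / \<beta>))"
  have C: "C > 0" using D \<theta> A by (simp add: C_def)
  show ?thesis
  proof (rule that[OF C])
    fix M :: "'w measure" and H :: "('w \<Rightarrow> real) set" and Z :: "real \<Rightarrow> 'w \<Rightarrow> real" and n :: nat and \<epsilon> :: real
    assume G: "gaussian_space M H" and Z: "\<And>t. t \<in> {0..1} \<Longrightarrow> Z t \<in> H"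
      and Z0: "(\<integral>\<omega>. (Z 0 \<omega>)\<^sup>2 \<partial>M) \<le> K\<^sup>2"
      and incr: "\<And>s t. s \<in> {0..1} \<Longrightarrow> t \<in> {0..1} \<Longrightarrow> (\<integral>\<omega>. (Z s \<omega> - Z t \<omega>)\<^sup>2 \<partial>M) \<le> (K * \<bar>s - t\<bar> powr \<beta>)\<^sup>2"
      and \<epsilon>: "0 < \<epsilon>" "\<epsilon> \<le> 1"
    interpret gaussian_space M H by (rule G)
    have "1 \<le> (A / \<epsilon>) powr (1 / \<beta>)"
      using A \<epsilon> \<beta> by (intro ge_one_powr_ge_zero) (auto simp: field_simps)
    \<comment> \<open>The left inequality makes the thresholds sum to at most \<open>\<epsilon>\<close>, the right one bounds the
      total cost.\<close>
    then obtain m :: nat where m: "(A / \<epsilon>) powr (1 / \<beta>) \<le> 2 ^ m" "2 ^ m \<le> 2 * (A / \<epsilon>) powr (1 / \<beta>)"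
      using power_two_between by blast
    define \<alpha> where "\<alpha> j = 2 powr (- (real m * \<beta>)) * y ^ nat_dist j m" for j
    have \<alpha>: "\<alpha> j > 0" for j using y by (simp add: \<alpha>_def)
    have sum\<alpha>: "(\<Sum>j\<le>n. \<alpha> j) \<le> \<epsilon>"
    proof -
      have "(\<Sum>j\<le>n. \<alpha> j) \<le> 2 powr (- (real m * \<beta>)) * A"
        unfolding \<alpha>_def sum_distrib_left[symmetric] A_def
        by (intro mult_left_mono sum_power_nat_dist_le y) auto
      also have "\<dots> \<le> \<epsilon>"
      proof -
        have "A / \<epsilon> = ((A / \<epsilon>) powr (1 / \<beta>)) powr \<beta>"
          using \<beta> A \<epsilon> by (simp add: powr_powr)
        also have "\<dots> \<le> (2 ^ m) powr \<beta>" using m(1) \<beta> by (intro powr_mono2) auto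
        also have "\<dots> = 2 powr (real m * \<beta>)" by (simp add: powr_powr powr_realpow[symmetric])
        finally show ?thesis using \<epsilon> by (simp add: powr_minus field_simps)
      qed
      finally show ?thesis .
    qed
    note dy = dyadic_mem_unit_interval
    have half: "i div 2 < 2 ^ (j - 1)" if "i < 2 ^ j" "j > 0" for i j :: nat
      using that by (cases j) auto
    have \<Delta>: "dyadic_increment Z j i \<in> H" if "i < 2 ^ j" for j i
    proof (cases "j = 0")
      case True
      then show ?thesis using Z[of 0] by (simp add: dyadic_increment_def[abs_def])
    next
      case False
      then show ?thesis
        using diff[OF Z[OF dy[OF that]] Z[OF dy[OF half[OF that]]]] by (simp add: dyadic_increment_def[abs_def])
    qed
    have var: "(\<integral>\<omega>. (dyadic_increment Z j i \<omega>)\<^sup>2 \<partial>M) \<le> (K * 2 powr (- (real j * \<beta>)))\<^sup>2" if i: "i < 2 ^ j" for j i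
    proof (cases "j = 0")
      case True
      then show ?thesis using Z0 by (simp add: dyadic_increment_def)
    next
      case False
      let ?s = "real i / 2 ^ j" and ?t = "real (i div 2) / 2 ^ (j - 1)"
      have "\<bar>?s - ?t\<bar> \<le> 1 / 2 ^ j"
      proof -
        have "?t = real (2 * (i div 2)) / 2 ^ j" using False by (cases j) auto
        then have "?s - ?t = (real i - real (2 * (i div 2))) / 2 ^ j" by (simp add: diff_divide_distrib)
        moreover have "real i - real (2 * (i div 2)) = real (i mod 2)"
          by (subst of_nat_diff[symmetric]) (auto simp: minus_mult_div_eq_mod)
        ultimately have "?s - ?t = real (i mod 2) / 2 ^ j" by simp
        then show ?thesis by (auto simp: divide_right_mono)
      qed
      then have "\<bar>?s - ?t\<bar> powr \<beta> \<le> (1 / 2 ^ j) powr \<beta>" using \<beta> by (intro powr_mono2) auto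
      also have "(1 / 2 ^ j) powr \<beta> = 2 powr (- (real j * \<beta>))"
        by (simp add: powr_divide powr_minus_divide powr_powr powr_realpow[symmetric])
      finally have le: "\<bar>?s - ?t\<bar> powr \<beta> \<le> 2 powr (- (real j * \<beta>))" .
      have "(\<integral>\<omega>. (dyadic_increment Z j i \<omega>)\<^sup>2 \<partial>M) \<le> (K * \<bar>?s - ?t\<bar> powr \<beta>)\<^sup>2"
        using incr[OF dy[OF i] dy[OF half[OF i]]] False by (simp add: dyadic_increment_def)
      also have "\<dots> \<le> (K * 2 powr (- (real j * \<beta>)))\<^sup>2"
        using K le by (intro power_mono mult_left_mono) auto
      finally show ?thesis .
    qed
    have lower: "prob {\<omega> \<in> space M. \<bar>dyadic_increment Z j i \<omega>\<bar> \<le> \<alpha> j} \<ge> exp (- (D * 2 ^ m * \<theta> ^ nat_dist j m) / 2 ^ j)"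
      if i: "i < 2 ^ j" for j i
    proof -
      define r where "r = \<alpha> j / (K * 2 powr (- (real j * \<beta>)))"
      have r: "r > 0" using \<alpha> K by (simp add: r_def)
      have req: "r = 2 powr ((real j - real m) * \<beta> - real (nat_dist j m) * \<beta> / 2) / K"
      proof -
        have ye: "y ^ nat_dist j m = 2 powr (- real (nat_dist j m) * \<beta> / 2)"
          unfolding y_def by (simp add: powr_powr powr_realpow[symmetric] mult.commute)
        have gen: "x * z / (K * inverse u) = x * z * u / K" for x z u :: real
          by (simp add: divide_inverse)
        have "r = 2 powr (- (real m * \<beta>)) * 2 powr (- real (nat_dist j m) * \<beta> / 2) * 2 powr (real j * \<beta>) / K"
          unfolding r_def \<alpha>_def ye powr_minus[of 2 "real j * \<beta>"] by (rule gen)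
        also have "\<dots> = 2 powr ((real j - real m) * \<beta> - real (nat_dist j m) * \<beta> / 2) / K"
          by (simp add: powr_add[symmetric] algebra_simps)
        finally show ?thesis .
      qed
      have key: "\<exists>E p. measure std_normal {-r..r} \<ge> exp (- E * r powr (- p)) \<and> E * r powr (- p) \<le> D * 2 ^ m * \<theta> ^ nat_dist j m / 2 ^ j"
      proof (cases "m \<le> j")
        case True
        define d where "d = j - m"
        have j: "j = m + d" using True by (simp add: d_def)
        have nd: "nat_dist j m = d" by (simp add: nat_dist_def j)
        have rr: "r = 2 powr (real d * \<beta> / 2) / K" unfolding req nd by (simp add: j algebra_simps)
        have "r powr (- p1) = K powr p1 * 2 powr (- 2 * real d)"
          unfolding rr using K \<beta> by (simp add: powr_divide powr_powr p1_def powr_minus field_simps)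
        also have "2 powr (- 2 * real d) = (1 / 2 ^ d) * (1 / 2 ^ d)"
          by (simp add: powr_minus powr_add[symmetric] powr_realpow[symmetric] field_simps)
        also have "\<dots> \<le> \<theta> ^ d * (1 / 2 ^ d)"
        proof (rule mult_right_mono)
          have "1 / 2 ^ d = (1 / 2 :: real) ^ d" by (simp add: power_divide)
          also have "\<dots> \<le> \<theta> ^ d"
          proof (rule power_mono)
            have "1 / 2 = 2 powr (- 1 :: real)" by (simp add: powr_minus)
            also have "\<dots> \<le> \<theta>" unfolding \<theta>_def by (rule powr_mono) auto
            finally show "1 / 2 \<le> \<theta>" .
          qed simp
          finally show "1 / 2 ^ d \<le> \<theta> ^ d" .
        qed simp
        finally have "r powr (- p1) \<le> K powr p1 * (\<theta> ^ d * (1 / 2 ^ d))"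
          using K by (simp add: mult_left_mono)
        then have "C1 * r powr (- p1) \<le> C1 * (K powr p1 * (\<theta> ^ d * (1 / 2 ^ d)))"
          using C1 by (intro mult_left_mono) auto
        also have "\<dots> = C1 * K powr p1 * (\<theta> ^ d * (1 / 2 ^ d))" by simp
        also have "\<dots> \<le> D * (\<theta> ^ d * (1 / 2 ^ d))"
          using C2 \<theta> by (intro mult_right_mono) (auto simp: D_def)
        also have "\<dots> = D * 2 ^ m * \<theta> ^ nat_dist j m / 2 ^ j" unfolding nd by (simp add: j power_add)
        finally show ?thesis using C1(2)[OF r] by blast
      next
        case False
        define d where "d = m - j"
        have m': "m = j + d" using False by (simp add: d_def)
        have nd: "nat_dist j m = d" by (simp add: nat_dist_def m')
        have rr: "r = 2 powr (- (real d * (3 * \<beta>) / 2)) / K" unfolding req nd by (simp add: m' algebra_simps)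
        have "r powr (- p2) = K powr p2 * 2 powr (real d / 2)"
          unfolding rr using K \<beta> by (simp add: powr_divide powr_mult powr_powr p2_def powr_minus field_simps)
        also have "2 powr (real d / 2) = 2 ^ d * \<theta> ^ d"
          by (simp add: \<theta>_def powr_powr powr_realpow[symmetric] powr_add[symmetric])
        finally have "C2 * r powr (- p2) = C2 * K powr p2 * (2 ^ d * \<theta> ^ d)" by simp
        also have "\<dots> \<le> D * (2 ^ d * \<theta> ^ d)"
          using C1 \<theta> by (intro mult_right_mono) (auto simp: D_def)
        also have "\<dots> = D * 2 ^ m * \<theta> ^ nat_dist j m / 2 ^ j" unfolding nd by (simp add: m' power_add)
        finally show ?thesis using C2(2)[OF r] by blast
      qed
      have "measure std_normal {-r..r} \<ge> exp (- (D * 2 ^ m * \<theta> ^ nat_dist j m) / 2 ^ j)"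
        using key by (auto elim!: order_trans[rotated])
      moreover have "prob {\<omega> \<in> space M. \<bar>dyadic_increment Z j i \<omega>\<bar> \<le> \<alpha> j} \<ge> measure std_normal {-r..r}"
        unfolding r_def using K \<alpha>[of j] by (intro prob_abs_le_lower \<Delta> var i) auto
      ultimately show ?thesis by linarith
    qed
    define L where "L = (SIGMA j:{..n}. {..<(2::nat) ^ j})"
    have L: "finite L" by (auto simp: L_def)
    have "exp (- C * \<epsilon> powr (- 1 / \<beta>)) \<le> exp (- (D * 2 ^ m * (2 / (1 - \<theta>))))"
    proof -
      have "D * 2 ^ m * (2 / (1 - \<theta>)) \<le> D * (2 * (A / \<epsilon>) powr (1 / \<beta>)) * (2 / (1 - \<theta>))"
        using D \<theta> m(2) by (intro mult_right_mono mult_left_mono) auto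
      also have "(A / \<epsilon>) powr (1 / \<beta>) = A powr (1 / \<beta>) * \<epsilon> powr (- 1 / \<beta>)"
        using A \<epsilon> by (simp add: powr_divide powr_minus_divide)
      finally show ?thesis by (simp add: C_def mult_ac)
    qed
    also have "\<dots> \<le> exp (- (\<Sum>j\<le>n. D * 2 ^ m * \<theta> ^ nat_dist j m))"
      unfolding sum_distrib_left[symmetric] using D
      by (simp add: mult_left_mono sum_power_nat_dist_le[OF \<theta>] del: times_divide_eq_right)
    also have "\<dots> = (\<Prod>j\<le>n. \<Prod>i\<in>{..<(2::nat)^j}. exp (- (D * 2 ^ m * \<theta> ^ nat_dist j m) / 2 ^ j))"
    proof -
      have c: "(2 :: real) ^ j * (x / 2 ^ j) = x" for x j by simp
      show ?thesis
        by (simp add: exp_sum[symmetric] sum_negf[symmetric] exp_of_nat_mult[symmetric] c del: times_divide_eq_right)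
    qed
    also have "\<dots> = (\<Prod>(j, i)\<in>L. exp (- (D * 2 ^ m * \<theta> ^ nat_dist j m) / 2 ^ j))"
      unfolding L_def by (rule prod.Sigma) auto
    also have "\<dots> \<le> (\<Prod>k\<in>L. prob {\<omega> \<in> space M. \<bar>dyadic_increment Z (fst k) (snd k) \<omega>\<bar> \<le> \<alpha> (fst k)})"
      using lower by (intro prod_mono) (auto simp: L_def)
    also have "\<dots> \<le> prob {\<omega> \<in> space M. \<forall>k\<in>L. \<bar>dyadic_increment Z (fst k) (snd k) \<omega>\<bar> \<le> \<alpha> (fst k)}"
      using \<alpha> by (intro sidak L) (auto simp: L_def less_imp_le intro!: \<Delta>)
    also have "\<dots> \<le> prob {\<omega> \<in> space M. \<forall>k<2^n. \<bar>Z (real k / 2 ^ n) \<omega>\<bar> \<le> \<epsilon>}"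
    proof (rule finite_measure_mono)
      show "{\<omega> \<in> space M. \<forall>k\<in>L. \<bar>dyadic_increment Z (fst k) (snd k) \<omega>\<bar> \<le> \<alpha> (fst k)}
        \<subseteq> {\<omega> \<in> space M. \<forall>k<2^n. \<bar>Z (real k / 2 ^ n) \<omega>\<bar> \<le> \<epsilon>}"
      proof (clarify)
        fix \<omega> and k :: nat assume h: "\<forall>k\<in>L. \<bar>dyadic_increment Z (fst k) (snd k) \<omega>\<bar> \<le> \<alpha> (fst k)" and k: "k < 2 ^ n"
        have "\<bar>Z (real k / 2 ^ n) \<omega>\<bar> \<le> (\<Sum>j\<le>n. \<bar>dyadic_increment Z j (k div 2 ^ (n - j)) \<omega>\<bar>)"
          unfolding dyadic_chain[OF k] by (rule sum_abs)
        also have "\<dots> \<le> (\<Sum>j\<le>n. \<alpha> j)"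
        proof (rule sum_mono)
          fix j assume j: "j \<in> {..n}"
          have "k div 2 ^ (n - j) < 2 ^ j"
            using k j by (intro less_mult_imp_div_less) (simp add: power_add[symmetric])
          then have "(j, k div 2 ^ (n - j)) \<in> L" using j by (simp add: L_def)
          then show "\<bar>dyadic_increment Z j (k div 2 ^ (n - j)) \<omega>\<bar> \<le> \<alpha> j" using h by force
        qed
        also have "\<dots> \<le> \<epsilon>" by (rule sum\<alpha>)
        finally show "\<bar>Z (real k / 2 ^ n) \<omega>\<bar> \<le> \<epsilon>" .
      qed
      have [measurable]: "Z (real k / 2 ^ n) \<in> borel_measurable M" if "k < 2 ^ n" for k
        using meas[OF Z[OF dy[OF that]]] .
      have "{\<omega> \<in> space M. \<forall>k\<in>{..<2^n}. \<bar>Z (real k / 2 ^ n) \<omega>\<bar> \<le> \<epsilon>} \<in> sets M"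
        by measurable
      then show "{\<omega> \<in> space M. \<forall>k<2^n. \<bar>Z (real k / 2 ^ n) \<omega>\<bar> \<le> \<epsilon>} \<in> sets M" by (simp add: Ball_def)
    qed
    finally show "exp (- C * \<epsilon> powr (- 1 / \<beta>)) \<le> measure M {\<omega> \<in> space M. \<forall>k<2^n. \<bar>Z (real k / 2 ^ n) \<omega>\<bar> \<le> \<epsilon>}" .
  qed
qed

section \<open>Gaussian spaces generated by a Gaussian process\<close>

lemma centered_gaussian_rv:
  assumes "prob_space M" and rv: "gaussian_rv M Y" and mean: "integral\<^sup>L M Y = 0"
  shows "Y \<in> borel_measurable M" "integrable M Y" "integrable M (\<lambda>\<omega>. (Y \<omega>)\<^sup>2)"
    "(\<integral>\<omega>. iexp (Y \<omega>) \<partial>M) = complex_of_real (exp (- (\<integral>\<omega>. (Y \<omega>)\<^sup>2 \<partial>M) / 2))"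
proof -
  interpret prob_space M by fact
  obtain m s where Y[measurable]: "Y \<in> borel_measurable M" and s: "0 \<le> s" and d: "distr M borel Y = normal_law m s"
    using rv by (auto simp: gaussian_rv_def)
  have *: "integrable M Y \<and> integrable M (\<lambda>\<omega>. (Y \<omega>)\<^sup>2) \<and> (\<integral>\<omega>. iexp (Y \<omega>) \<partial>M) = complex_of_real (exp (- (\<integral>\<omega>. (Y \<omega>)\<^sup>2 \<partial>M) / 2))"
  proof (cases "s = 0")
    case True
    then have d': "distr M borel Y = return borel m" using d by (simp add: normal_law_def)
    have "AE x in distr M borel Y. x = m"
      unfolding d' by (subst AE_return) auto
    then have ae: "AE \<omega> in M. Y \<omega> = m" by (subst (asm) AE_distr_iff) auto
    have "integral\<^sup>L M Y = (\<integral>\<omega>. m \<partial>M)" by (rule integral_cong_AE) (use ae in auto)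
    then have "m = 0" using mean by (simp add: prob_space)
    then have ae: "AE \<omega> in M. Y \<omega> = 0" using ae by simp
    have i1: "integrable M Y" using ae by (subst integrable_cong_AE[of _ _ "\<lambda>_. 0"]) auto
    have i2: "integrable M (\<lambda>\<omega>. (Y \<omega>)\<^sup>2)" using ae by (subst integrable_cong_AE[of _ _ "\<lambda>_. 0"]) auto
    have e2: "(\<integral>\<omega>. (Y \<omega>)\<^sup>2 \<partial>M) = 0" using ae by (subst integral_cong_AE[of _ _ "\<lambda>_. 0"]) auto
    have "(\<integral>\<omega>. iexp (Y \<omega>) \<partial>M) = (\<integral>\<omega>. 1 \<partial>M)" using ae by (intro integral_cong_AE) auto
    then show ?thesis using i1 i2 e2 by (simp add: prob_space)
  next
    case False
    then have s': "s > 0" using s by simp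
    have D: "distributed M lborel Y (normal_density m s)"
      using d False by (simp add: distributed_def normal_law_def cong: distr_cong)
    have "expectation Y = m" by (rule normal_distributed_expectation[OF s' D])
    then have m: "m = 0" using mean by simp
    define N where "N = (\<lambda>\<omega>. Y \<omega> / s)"
    have [measurable]: "N \<in> borel_measurable M" by (simp add: N_def)
    have YN: "Y \<omega> = s * N \<omega>" for \<omega> using s' by (simp add: N_def)
    have "distributed M lborel N std_normal_density"
      using D normal_standard_normal_convert[OF s', of Y m] by (simp add: m N_def)
    then have dN: "distr M borel N = std_normal"
      by (simp add: distributed_def cong: distr_cong)
    have "integrable std_normal (\<lambda>x. x ^ k)" for k by (rule integrable_std_normal_distribution_moment)
    then have iN: "integrable M (\<lambda>\<omega>. N \<omega> ^ k)" for k
      unfolding dN[symmetric] by (subst (asm) integrable_distr_eq) auto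
    have "(\<integral>\<omega>. (N \<omega>)\<^sup>2 \<partial>M) = (\<integral>x. x\<^sup>2 \<partial>distr M borel N)"
      by (subst integral_distr) auto
    also have "\<dots> = 1" unfolding dN using std_normal_distribution_even_moments(1)[of 1] by simp
    finally have eN: "(\<integral>\<omega>. (N \<omega>)\<^sup>2 \<partial>M) = 1" .
    have i2: "integrable M (\<lambda>\<omega>. (Y \<omega>)\<^sup>2)" and e2: "(\<integral>\<omega>. (Y \<omega>)\<^sup>2 \<partial>M) = s\<^sup>2"
      unfolding YN power_mult_distrib using iN[of 2] eN by auto
    have i1: "integrable M Y" using iN[of 1] by (simp add: YN[abs_def])
    have "(\<integral>\<omega>. iexp (Y \<omega>) \<partial>M) = (\<integral>x. iexp (s * x) \<partial>distr M borel N)"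
      by (subst integral_distr) (auto simp: YN)
    also have "\<dots> = complex_of_real (exp (- (s\<^sup>2) / 2))"
      using fun_cong[OF char_std_normal_distribution, of s] unfolding dN char_def .
    finally show ?thesis using i1 i2 e2 by simp
  qed
  show "Y \<in> borel_measurable M" by fact
  show "integrable M Y" "integrable M (\<lambda>\<omega>. (Y \<omega>)\<^sup>2)"
    "(\<integral>\<omega>. iexp (Y \<omega>) \<partial>M) = complex_of_real (exp (- (\<integral>\<omega>. (Y \<omega>)\<^sup>2 \<partial>M) / 2))" using * by auto
qed

definition process_span :: "'i set \<Rightarrow> ('i \<Rightarrow> 'w \<Rightarrow> real) \<Rightarrow> ('w \<Rightarrow> real) set" where
  "process_span T X = {(\<lambda>\<omega>. \<Sum>t\<in>J. c t * X t \<omega>) | J c. finite J \<and> J \<subseteq> T}"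

lemma gaussian_space_process_span:
  assumes "prob_space M" and gp: "centered_gaussian_process M T X"
  shows "gaussian_space M (process_span T X)"
proof -
  interpret prob_space M by fact
  have rv: "gaussian_rv M (\<lambda>\<omega>. \<Sum>t\<in>J. c t * X t \<omega>)" if "finite J" "J \<subseteq> T" for J c
    using gp that by (auto simp: centered_gaussian_process_def gaussian_process_def)
  have iX: "integrable M (X t)" and mX: "integral\<^sup>L M (X t) = 0" if t: "t \<in> T" for t
  proof -
    show "integral\<^sup>L M (X t) = 0" using gp t by (auto simp: centered_gaussian_process_def)
    then show "integrable M (X t)"
      using rv[of "{t}" "\<lambda>_. 1"] t by (intro centered_gaussian_rv(2)[OF assms(1)]) auto
  qed
  have mean: "integral\<^sup>L M (\<lambda>\<omega>. \<Sum>t\<in>J. c t * X t \<omega>) = 0" if "finite J" "J \<subseteq> T" for J c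
    using that iX mX by (subst Bochner_Integration.integral_sum) (auto simp: subset_eq)
  show ?thesis
  proof
    show "(\<lambda>_. 0) \<in> process_span T X"
      unfolding process_span_def by (auto intro!: exI[of _ "{}"])
    fix Y assume "Y \<in> process_span T X"
    then obtain J c where J: "Y = (\<lambda>\<omega>. \<Sum>t\<in>J. c t * X t \<omega>)" "finite J" "J \<subseteq> T"
      by (auto simp: process_span_def)
    note facts = centered_gaussian_rv[OF assms(1) rv[OF J(2,3), of c] mean[OF J(2,3), of c]]
    show "Y \<in> borel_measurable M" "integrable M (\<lambda>\<omega>. (Y \<omega>)\<^sup>2)"
      "(\<integral>\<omega>. iexp (Y \<omega>) \<partial>M) = complex_of_real (exp (- (\<integral>\<omega>. (Y \<omega>)\<^sup>2 \<partial>M) / 2))"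
      unfolding J(1) by (rule facts)+
    fix Z r assume "Z \<in> process_span T X"
    then obtain L d where L: "Z = (\<lambda>\<omega>. \<Sum>t\<in>L. d t * X t \<omega>)" "finite L" "L \<subseteq> T"
      by (auto simp: process_span_def)
    have "(\<Sum>t\<in>J. c t * X t \<omega>) = (\<Sum>t\<in>J \<union> L. (if t \<in> J then c t else 0) * X t \<omega>)" for \<omega>
      using J L by (intro sum.mono_neutral_cong_left) auto
    moreover have "(\<Sum>t\<in>L. d t * X t \<omega>) = (\<Sum>t\<in>J \<union> L. (if t \<in> L then d t else 0) * X t \<omega>)" for \<omega>
      using J L by (intro sum.mono_neutral_cong_left) auto
    ultimately have "r * Y \<omega> + Z \<omega> = (\<Sum>t\<in>J \<union> L. (r * (if t \<in> J then c t else 0) + (if t \<in> L then d t else 0)) * X t \<omega>)" for \<omega>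
      by (simp add: J(1) L(1) sum_distrib_left sum.distrib distrib_right mult.assoc)
    then show "(\<lambda>\<omega>. r * Y \<omega> + Z \<omega>) \<in> process_span T X"
      unfolding process_span_def using J L
      by (auto intro!: exI[of _ "J \<union> L"] exI[of _ "\<lambda>t. r * (if t \<in> J then c t else 0) + (if t \<in> L then d t else 0)"])
  qed
qed

lemma mem_process_span: "t \<in> T \<Longrightarrow> X t \<in> process_span T X"
  unfolding process_span_def by (auto intro!: exI[of _ "{t}"] exI[of _ "\<lambda>_. 1"])

text \<open>The average of the process over a measure is a limit of Riemann sums in mean square but
  in general no finite linear combination, hence the closure.\<close>

definition L2_closure :: "'w measure \<Rightarrow> ('w \<Rightarrow> real) set \<Rightarrow> ('w \<Rightarrow> real) set" where
  "L2_closure M H = {Y \<in> borel_measurable M. integrable M (\<lambda>\<omega>. (Y \<omega>)\<^sup>2) \<and>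
     (\<forall>e>0. \<exists>W\<in>H. (\<integral>\<omega>. (Y \<omega> - W \<omega>)\<^sup>2 \<partial>M) \<le> e)}"

lemma norm_iexp_diff_le: "norm (iexp x - iexp y) \<le> \<bar>x - y\<bar>"
proof -
  have "iexp x - iexp y = iexp y * (iexp (x - y) - 1)"
    by (simp add: right_diff_distrib exp_add[symmetric] distrib_left[symmetric])
  then have "norm (iexp x - iexp y) = norm (iexp (x - y) - 1)" by (simp add: norm_mult)
  also have "\<dots> \<le> \<bar>x - y\<bar>" using iexp_approx1[of "x - y" 0] by simp
  finally show ?thesis .
qed

text \<open>Variances and characteristic functions are both continuous under convergence in mean square,
so the identity between them passes to limits.\<close>

lemma gaussian_space_L2_closure:
  assumes "gaussian_space M H"
  shows "gaussian_space M (L2_closure M H)"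
proof -
  interpret gaussian_space M H by fact
  show ?thesis
  proof
    show "(\<lambda>_. 0) \<in> L2_closure M H"
      using zero by (auto simp: L2_closure_def intro!: bexI[of _ "\<lambda>_. 0"])
    fix Y assume "Y \<in> L2_closure M H"
    then have Ym[measurable]: "Y \<in> borel_measurable M" and Yi: "integrable M (\<lambda>\<omega>. (Y \<omega>)\<^sup>2)"
      and Ya: "\<And>e. e > 0 \<Longrightarrow> \<exists>W\<in>H. (\<integral>\<omega>. (Y \<omega> - W \<omega>)\<^sup>2 \<partial>M) \<le> e"
      by (auto simp: L2_closure_def)
    show "Y \<in> borel_measurable M" "integrable M (\<lambda>\<omega>. (Y \<omega>)\<^sup>2)" by fact+
    have Di: "integrable M (\<lambda>\<omega>. (Y \<omega> - W \<omega>)\<^sup>2)" if "W \<in> H" for W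
      using square_integrable_lin(1)[OF Ym meas[OF that] Yi sq[OF that], of 1 "-1"] by simp
    define \<delta> where "\<delta> n = inverse (real (Suc n))" for n
    have \<delta>: "\<delta> n > 0" for n by (simp add: \<delta>_def)
    have \<delta>0: "\<delta> \<longlonglongrightarrow> 0" unfolding \<delta>_def by (rule LIMSEQ_inverse_real_of_nat)
    have "\<forall>n. \<exists>W\<in>H. (\<integral>\<omega>. (Y \<omega> - W \<omega>)\<^sup>2 \<partial>M) \<le> (\<delta> n)\<^sup>2"
      by (intro allI Ya zero_less_power \<delta>)
    then obtain W where W: "\<And>n. W n \<in> H" "\<And>n. (\<integral>\<omega>. (Y \<omega> - W n \<omega>)\<^sup>2 \<partial>M) \<le> (\<delta> n)\<^sup>2" by metis
    have Wm[measurable]: "W n \<in> borel_measurable M" for n using meas W by simp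
    have "(\<lambda>n. \<integral>\<omega>. (W n \<omega>)\<^sup>2 \<partial>M) \<longlonglongrightarrow> (\<integral>\<omega>. (Y \<omega>)\<^sup>2 \<partial>M)"
    proof (rule LIM_zero_cancel, rule Lim_null_comparison)
      let ?c = "(\<integral>\<omega>. (Y \<omega>)\<^sup>2 \<partial>M) + 1"
      show "\<forall>\<^sub>F n in sequentially. norm ((\<integral>\<omega>. (W n \<omega>)\<^sup>2 \<partial>M) - (\<integral>\<omega>. (Y \<omega>)\<^sup>2 \<partial>M)) \<le> \<delta> n * ?c + (\<delta> n)\<^sup>2"
      proof (rule always_eventually, rule allI)
        fix n
        let ?D = "\<lambda>\<omega>. Y \<omega> - W n \<omega>"
        have "(\<integral>\<omega>. (1 * Y \<omega> + (-1) * ?D \<omega>)\<^sup>2 \<partial>M) = (\<integral>\<omega>. (Y \<omega>)\<^sup>2 \<partial>M) - 2 * (\<integral>\<omega>. Y \<omega> * ?D \<omega> \<partial>M) + (\<integral>\<omega>. (?D \<omega>)\<^sup>2 \<partial>M)"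
          using square_integrable_lin(2)[OF Ym _ Yi Di[OF W(1)[of n]], of 1 "-1"] by simp
        then have "(\<integral>\<omega>. (W n \<omega>)\<^sup>2 \<partial>M) - (\<integral>\<omega>. (Y \<omega>)\<^sup>2 \<partial>M) = - 2 * (\<integral>\<omega>. Y \<omega> * ?D \<omega> \<partial>M) + (\<integral>\<omega>. (?D \<omega>)\<^sup>2 \<partial>M)"
          by simp
        moreover have "\<bar>\<integral>\<omega>. Y \<omega> * ?D \<omega> \<partial>M\<bar> \<le> \<delta> n * ?c / 2"
          by (rule abs_integral_mult_le(2)[OF Ym _ Yi Di[OF W(1)] \<delta> W(2)]) measurable
        moreover have "0 \<le> (\<integral>\<omega>. (?D \<omega>)\<^sup>2 \<partial>M)" by simp
        ultimately show "norm ((\<integral>\<omega>. (W n \<omega>)\<^sup>2 \<partial>M) - (\<integral>\<omega>. (Y \<omega>)\<^sup>2 \<partial>M)) \<le> \<delta> n * ?c + (\<delta> n)\<^sup>2"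
          using W(2)[of n] by (simp only: real_norm_def abs_le_iff) linarith
      qed
      have "(\<lambda>n. \<delta> n * ?c + (\<delta> n)\<^sup>2) \<longlonglongrightarrow> 0 * ?c + 0\<^sup>2" by (intro tendsto_intros \<delta>0)
      then show "(\<lambda>n. \<delta> n * ?c + (\<delta> n)\<^sup>2) \<longlonglongrightarrow> 0" by simp
    qed
    then have "(\<lambda>n. complex_of_real (exp (- (\<integral>\<omega>. (W n \<omega>)\<^sup>2 \<partial>M) / 2))) \<longlonglongrightarrow> complex_of_real (exp (- (\<integral>\<omega>. (Y \<omega>)\<^sup>2 \<partial>M) / 2))"
      by (intro tendsto_intros) auto
    then have lim1: "(\<lambda>n. \<integral>\<omega>. iexp (W n \<omega>) \<partial>M) \<longlonglongrightarrow> complex_of_real (exp (- (\<integral>\<omega>. (Y \<omega>)\<^sup>2 \<partial>M) / 2))"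
      by (simp add: chf[OF W(1)])
    have "(\<lambda>n. \<integral>\<omega>. iexp (W n \<omega>) \<partial>M) \<longlonglongrightarrow> (\<integral>\<omega>. iexp (Y \<omega>) \<partial>M)"
    proof (rule LIM_zero_cancel, rule Lim_null_comparison)
      show "\<forall>\<^sub>F n in sequentially. norm ((\<integral>\<omega>. iexp (W n \<omega>) \<partial>M) - (\<integral>\<omega>. iexp (Y \<omega>) \<partial>M)) \<le> \<delta> n"
      proof (rule always_eventually, rule allI)
        fix n
        let ?D = "\<lambda>\<omega>. Y \<omega> - W n \<omega>"
        have i1: "integrable M (\<lambda>\<omega>. iexp (W n \<omega>))" "integrable M (\<lambda>\<omega>. iexp (Y \<omega>))"
          by (rule integrable_iexp; measurable)+
        have iD: "integrable M (\<lambda>\<omega>. 1 * ?D \<omega>)"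
          using Di[OF W(1)] by (intro integrable_mult_of_square_integrable) auto
        have "(\<integral>\<omega>. iexp (W n \<omega>) \<partial>M) - (\<integral>\<omega>. iexp (Y \<omega>) \<partial>M) = (\<integral>\<omega>. iexp (W n \<omega>) - iexp (Y \<omega>) \<partial>M)"
          using i1 by simp
        also have "norm \<dots> \<le> (\<integral>\<omega>. norm (iexp (W n \<omega>) - iexp (Y \<omega>)) \<partial>M)"
          by (rule integral_norm_bound)
        also have "\<dots> \<le> (\<integral>\<omega>. \<bar>1 * ?D \<omega>\<bar> \<partial>M)"
        proof (rule integral_mono)
          show "norm (iexp (W n \<omega>) - iexp (Y \<omega>)) \<le> \<bar>1 * ?D \<omega>\<bar>" for \<omega>
            using norm_iexp_diff_le[of "W n \<omega>" "Y \<omega>"] by (simp add: abs_minus_commute)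
        qed (use i1 iD in auto)
        also have "\<dots> \<le> \<delta> n * ((\<integral>\<omega>. 1\<^sup>2 \<partial>M) + 1) / 2"
          by (rule abs_integral_mult_le(1)[OF _ _ _ Di[OF W(1)] \<delta> W(2)]) auto
        also have "\<dots> = \<delta> n" by (simp add: prob_space)
        finally show "norm ((\<integral>\<omega>. iexp (W n \<omega>) \<partial>M) - (\<integral>\<omega>. iexp (Y \<omega>) \<partial>M)) \<le> \<delta> n" .
      qed
    qed (rule \<delta>0)
    from LIMSEQ_unique[OF this lim1]
    show "(\<integral>\<omega>. iexp (Y \<omega>) \<partial>M) = complex_of_real (exp (- (\<integral>\<omega>. (Y \<omega>)\<^sup>2 \<partial>M) / 2))" .
    fix Z r assume "Z \<in> L2_closure M H"
    then have Zm[measurable]: "Z \<in> borel_measurable M" and Zi: "integrable M (\<lambda>\<omega>. (Z \<omega>)\<^sup>2)"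
      and Za: "\<And>e. e > 0 \<Longrightarrow> \<exists>W\<in>H. (\<integral>\<omega>. (Z \<omega> - W \<omega>)\<^sup>2 \<partial>M) \<le> e"
      by (auto simp: L2_closure_def)
    have "\<exists>W\<in>H. (\<integral>\<omega>. (r * Y \<omega> + Z \<omega> - W \<omega>)\<^sup>2 \<partial>M) \<le> e" if e: "e > 0" for e
    proof -
      obtain W1 where W1: "W1 \<in> H" "(\<integral>\<omega>. (Y \<omega> - W1 \<omega>)\<^sup>2 \<partial>M) \<le> e / (4 * (r\<^sup>2 + 1))"
        using Ya[of "e / (4 * (r\<^sup>2 + 1))"] e by (auto simp: add_nonneg_pos)
      obtain W2 where W2: "W2 \<in> H" "(\<integral>\<omega>. (Z \<omega> - W2 \<omega>)\<^sup>2 \<partial>M) \<le> e / 4"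
        using Za[of "e / 4"] e by auto
      have [measurable]: "W1 \<in> borel_measurable M" "W2 \<in> borel_measurable M" using W1 W2 meas by auto
      have i2: "integrable M (\<lambda>\<omega>. (Z \<omega> - W2 \<omega>)\<^sup>2)"
        using square_integrable_lin(1)[OF Zm meas[OF W2(1)] Zi sq[OF W2(1)], of 1 "-1"] by simp
      have "(\<integral>\<omega>. (r * Y \<omega> + Z \<omega> - (r * W1 \<omega> + W2 \<omega>))\<^sup>2 \<partial>M) = (\<integral>\<omega>. (r * (Y \<omega> - W1 \<omega>) + 1 * (Z \<omega> - W2 \<omega>))\<^sup>2 \<partial>M)"
        by (simp add: algebra_simps)
      also have "\<dots> \<le> 2 * r\<^sup>2 * (\<integral>\<omega>. (Y \<omega> - W1 \<omega>)\<^sup>2 \<partial>M) + 2 * 1\<^sup>2 * (\<integral>\<omega>. (Z \<omega> - W2 \<omega>)\<^sup>2 \<partial>M)"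
        by (rule square_integrable_lin(3)[OF _ _ Di[OF W1(1)] i2]) auto
      also have "\<dots> \<le> 2 * (r\<^sup>2 + 1) * (e / (4 * (r\<^sup>2 + 1))) + 2 * (e / 4)"
        using W1(2) W2(2) by (intro add_mono mult_mono) auto
      also have "\<dots> = e"
      proof -
        have "r\<^sup>2 + 1 \<noteq> 0" using zero_le_power2[of r] by linarith
        then show ?thesis by (simp add: field_simps)
      qed
      finally show ?thesis using lin[OF W1(1) W2(1), of r] by (auto intro!: bexI)
    qed
    moreover have "integrable M (\<lambda>\<omega>. (r * Y \<omega> + Z \<omega>)\<^sup>2)"
      using square_integrable_lin(1)[OF Ym Zm Yi Zi, of r 1] by simp
    ultimately show "(\<lambda>\<omega>. r * Y \<omega> + Z \<omega>) \<in> L2_closure M H"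
      by (auto simp: L2_closure_def)
  qed
qed

lemma subset_L2_closure:
  assumes "gaussian_space M H"
  shows "H \<subseteq> L2_closure M H"
proof -
  interpret gaussian_space M H by fact
  show ?thesis
  proof
    fix Y assume "Y \<in> H"
    then show "Y \<in> L2_closure M H"
      using meas sq by (auto simp: L2_closure_def intro!: bexI[of _ Y])
  qed
qed

section \<open>The energy minimiser and its constant potential\<close>

lemma (in prob_space) square_integral_le:
  fixes f :: "'a \<Rightarrow> real"
  assumes "integrable M f" "integrable M (\<lambda>x. (f x)\<^sup>2)"
  shows "(\<integral>x. f x \<partial>M)\<^sup>2 \<le> (\<integral>x. (f x)\<^sup>2 \<partial>M)"
proof -
  let ?m = "\<integral>x. f x \<partial>M"
  have "0 \<le> (\<integral>x. (f x - ?m)\<^sup>2 \<partial>M)" by simp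
  also have "\<dots> = (\<integral>x. (f x)\<^sup>2 - 2 * ?m * f x + ?m\<^sup>2 \<partial>M)"
    by (intro Bochner_Integration.integral_cong) (auto simp: power2_eq_square algebra_simps)
  also have "\<dots> = (\<integral>x. (f x)\<^sup>2 \<partial>M) - 2 * ?m * ?m + ?m\<^sup>2"
    using assms by (simp add: prob_space)
  finally show ?thesis by (simp add: power2_eq_square)
qed

text \<open>Once the modulus is replaced by a power of the distance, valid on the whole interval, the
process satisfies the hypotheses of the small ball estimate.\<close>

locale ms_holder_process = prob_space M for M :: "'w measure" +
  fixes X :: "real \<Rightarrow> 'w \<Rightarrow> real" and a b \<beta> K :: real
  assumes ab: "a < b" and gp: "centered_gaussian_process M {a..b} X"
    and cont: "\<And>\<omega>. \<omega> \<in> space M \<Longrightarrow> continuous_on {a..b} (\<lambda>t. X t \<omega>)"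
    and \<beta>: "\<beta> > 0" and K: "K > 0"
    and incr: "\<And>s t. s \<in> {a..b} \<Longrightarrow> t \<in> {a..b} \<Longrightarrow> (\<integral>\<omega>. (X t \<omega> - X s \<omega>)\<^sup>2 \<partial>M) \<le> (K * \<bar>t - s\<bar> powr \<beta>)\<^sup>2"
begin

definition gspace :: "('w \<Rightarrow> real) set" where
  "gspace = L2_closure M (process_span {a..b} X)"

lemma gaussian_space_span: "gaussian_space M (process_span {a..b} X)"
  by (rule gaussian_space_process_span[OF prob_space_axioms gp])

lemma gaussian_space_gspace: "gaussian_space M gspace"
  unfolding gspace_def by (rule gaussian_space_L2_closure[OF gaussian_space_span])

sublocale S: gaussian_space M gspace by (rule gaussian_space_gspace)

lemma X_gspace: "t \<in> {a..b} \<Longrightarrow> X t \<in> gspace"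
  unfolding gspace_def using subset_L2_closure[OF gaussian_space_span] mem_process_span[of t "{a..b}" X] by auto

lemma X_meas[measurable]: "t \<in> {a..b} \<Longrightarrow> X t \<in> borel_measurable M"
  by (rule S.meas[OF X_gspace])

lemma X_sq: "t \<in> {a..b} \<Longrightarrow> integrable M (\<lambda>\<omega>. (X t \<omega>)\<^sup>2)"
  by (rule S.sq[OF X_gspace])

lemma diff_sq: "s \<in> {a..b} \<Longrightarrow> t \<in> {a..b} \<Longrightarrow> integrable M (\<lambda>\<omega>. (X t \<omega> - X s \<omega>)\<^sup>2)"
  by (intro S.sq S.diff X_gspace)

definition second_moment_bound :: real where
  "second_moment_bound = 2 * (\<integral>\<omega>. (X a \<omega>)\<^sup>2 \<partial>M) + 2 * (K * (b - a) powr \<beta>)\<^sup>2"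

lemma second_moment_le:
  assumes t: "t \<in> {a..b}"
  shows "(\<integral>\<omega>. (X t \<omega>)\<^sup>2 \<partial>M) \<le> second_moment_bound"
proof -
  have a: "a \<in> {a..b}" using ab by simp
  have "(\<integral>\<omega>. (X t \<omega>)\<^sup>2 \<partial>M) = (\<integral>\<omega>. (1 * X a \<omega> + 1 * (X t \<omega> - X a \<omega>))\<^sup>2 \<partial>M)" by simp
  also have "\<dots> \<le> 2 * 1\<^sup>2 * (\<integral>\<omega>. (X a \<omega>)\<^sup>2 \<partial>M) + 2 * 1\<^sup>2 * (\<integral>\<omega>. (X t \<omega> - X a \<omega>)\<^sup>2 \<partial>M)"
    using t a by (intro square_integrable_lin(3) X_sq diff_sq borel_measurable_diff X_meas) auto
  also have "\<dots> \<le> 2 * (\<integral>\<omega>. (X a \<omega>)\<^sup>2 \<partial>M) + 2 * (K * \<bar>t - a\<bar> powr \<beta>)\<^sup>2"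
    using incr[OF a t] by simp
  also have "\<dots> \<le> second_moment_bound"
    unfolding second_moment_bound_def using t K \<beta>
    by (intro add_left_mono mult_left_mono power_mono powr_mono2) auto
  finally show ?thesis .
qed

text \<open>Rounding down to level \<^term>\<open>n\<close> of the dyadic grid, clamped to the interval.\<close>

definition round_dyadic :: "nat \<Rightarrow> real \<Rightarrow> real" where
  "round_dyadic n t = max a (min b (real_of_int \<lfloor>t * 2 ^ n\<rfloor> / 2 ^ n))"

lemma round_dyadic_mem: "round_dyadic n t \<in> {a..b}"
  using ab by (auto simp: round_dyadic_def)

lemma round_dyadic_dist:
  assumes "t \<in> {a..b}"
  shows "\<bar>t - round_dyadic n t\<bar> \<le> 1 / 2 ^ n"
proof -
  let ?q = "real_of_int \<lfloor>t * 2 ^ n\<rfloor> / 2 ^ n"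
  have "?q * 2 ^ n \<le> t * 2 ^ n" "t * 2 ^ n < (?q + 1 / 2 ^ n) * 2 ^ n"
    by (simp_all add: distrib_right)
  then have q: "?q \<le> t" "t < ?q + 1 / 2 ^ n" by (simp_all only: mult_le_cancel_right_pos mult_less_cancel_right_pos zero_less_power zero_less_numeral)
  then show ?thesis using assms unfolding round_dyadic_def by (auto simp: max_def min_def)
qed

lemma round_dyadic_tendsto:
  assumes "t \<in> {a..b}"
  shows "(\<lambda>n. round_dyadic n t) \<longlonglongrightarrow> t"
proof (rule LIM_zero_cancel, rule Lim_null_comparison)
  show "\<forall>\<^sub>F n in sequentially. norm (round_dyadic n t - t) \<le> (1/2) ^ n"
    using round_dyadic_dist[OF assms] by (auto simp: abs_minus_commute power_divide)
  show "(\<lambda>n. (1/2) ^ n) \<longlonglongrightarrow> (0::real)" by (intro LIMSEQ_power_zero) auto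
qed

lemma finite_round_dyadic: "finite (round_dyadic n ` {a..b})"
proof -
  have "round_dyadic n ` {a..b} \<subseteq> (\<lambda>i::int. max a (min b (real_of_int i / 2 ^ n))) ` {\<lfloor>a * 2 ^ n\<rfloor>..\<lfloor>b * 2 ^ n\<rfloor>}"
  proof
    fix q assume "q \<in> round_dyadic n ` {a..b}"
    then obtain t where t: "t \<in> {a..b}" "q = round_dyadic n t" by auto
    have "\<lfloor>t * 2 ^ n\<rfloor> \<in> {\<lfloor>a * 2 ^ n\<rfloor>..\<lfloor>b * 2 ^ n\<rfloor>}"
      using t by (auto intro!: floor_mono mult_right_mono)
    then show "q \<in> (\<lambda>i::int. max a (min b (real_of_int i / 2 ^ n))) ` {\<lfloor>a * 2 ^ n\<rfloor>..\<lfloor>b * 2 ^ n\<rfloor>}"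
      unfolding t(2) round_dyadic_def by (rule imageI)
  qed
  then show ?thesis by (rule finite_subset) auto
qed

end

locale ms_holder_process_measure = ms_holder_process +
  fixes \<nu> :: "real measure"
  assumes \<nu>: "\<nu> \<in> M1 a b"
begin

lemma prob_space_\<nu>: "prob_space \<nu>" using \<nu> by (simp add: M1_def)

sublocale N: prob_space \<nu> by (rule prob_space_\<nu>)

sublocale P: pair_sigma_finite \<nu> M ..

lemma sets_\<nu>: "sets \<nu> = sets (restrict_space borel {a..b})"
  using \<nu> by (simp add: M1_def)

lemma space_\<nu>: "space \<nu> = {a..b}"
  using sets_eq_imp_space_eq[OF sets_\<nu>] by (simp add: space_restrict_space)

lemma measurable_\<nu>: "f \<in> borel_measurable borel \<Longrightarrow> f \<in> borel_measurable \<nu>"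
  unfolding measurable_cong_sets[OF sets_\<nu> refl] by (rule measurable_restrict_space1)

lemma measurable_\<nu>_continuous: "continuous_on {a..b} f \<Longrightarrow> f \<in> borel_measurable \<nu>"
  unfolding measurable_cong_sets[OF sets_\<nu> refl] by (rule borel_measurable_continuous_on_restrict)

lemma joint_measurable_round:
  "(\<lambda>p. X (round_dyadic n (fst p)) (snd p)) \<in> borel_measurable (\<nu> \<Otimes>\<^sub>M M)"
  unfolding round_dyadic_def
proof (rule measurable_compose_countable[where f = "\<lambda>i p. X (max a (min b (real_of_int i / 2 ^ n))) (snd p)"
      and g = "\<lambda>p. \<lfloor>fst p * 2 ^ n\<rfloor>"])
  fix i :: int
  have "max a (min b (real_of_int i / 2 ^ n)) \<in> {a..b}" using ab by auto
  from X_meas[OF this]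
  show "(\<lambda>p. X (max a (min b (real_of_int i / 2 ^ n))) (snd p)) \<in> borel_measurable (\<nu> \<Otimes>\<^sub>M M)" by measurable
next
  have "(\<lambda>t. \<lfloor>t * 2 ^ n\<rfloor>) \<in> measurable \<nu> (count_space UNIV)"
    unfolding measurable_cong_sets[OF sets_\<nu> refl] by (rule measurable_restrict_space1) measurable
  from measurable_compose[OF measurable_fst this]
  show "(\<lambda>p. \<lfloor>fst p * 2 ^ n\<rfloor>) \<in> measurable (\<nu> \<Otimes>\<^sub>M M) (count_space UNIV)" .
qed

text \<open>The process rounded to a dyadic grid in time is jointly measurable as it involves only
countably many times; continuity of the paths carries this over to the limit.\<close>

lemma joint_measurable: "(\<lambda>p. X (fst p) (snd p)) \<in> borel_measurable (\<nu> \<Otimes>\<^sub>M M)"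
proof (rule borel_measurable_LIMSEQ_real[where u = "\<lambda>n p. X (round_dyadic n (fst p)) (snd p)"])
  fix p assume "p \<in> space (\<nu> \<Otimes>\<^sub>M M)"
  then have p: "fst p \<in> {a..b}" "snd p \<in> space M" by (auto simp: space_pair_measure space_\<nu>)
  show "(\<lambda>n. X (round_dyadic n (fst p)) (snd p)) \<longlonglongrightarrow> X (fst p) (snd p)"
    using continuous_on_tendsto_compose[OF cont[OF p(2)] round_dyadic_tendsto[OF p(1)] p(1)]
    using round_dyadic_mem by auto
qed (rule joint_measurable_round)

lemma product_integrable:
  fixes F :: "real \<times> 'a \<Rightarrow> real"
  assumes [measurable]: "F \<in> borel_measurable (\<nu> \<Otimes>\<^sub>M M)"
    and "\<And>t. t \<in> {a..b} \<Longrightarrow> integrable M (\<lambda>\<omega>. F (t, \<omega>))"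
    and "\<And>t. t \<in> {a..b} \<Longrightarrow> (\<integral>\<omega>. \<bar>F (t, \<omega>)\<bar> \<partial>M) \<le> B"
  shows "integrable (\<nu> \<Otimes>\<^sub>M M) F"
proof (rule P.Fubini_integrable)
  show "integrable \<nu> (\<lambda>t. \<integral>\<omega>. norm (F (t, \<omega>)) \<partial>M)"
  proof (rule N.integrable_const_bound)
    show "AE t in \<nu>. norm (\<integral>\<omega>. norm (F (t, \<omega>)) \<partial>M) \<le> B"
      using assms(3) by (auto simp: space_\<nu>)
  qed measurable
  show "AE t in \<nu>. integrable M (\<lambda>\<omega>. F (t, \<omega>))"
    using assms(2) by (auto simp: space_\<nu>)
qed fact

lemma path_integrable:
  assumes [measurable]: "\<phi> \<in> borel_measurable \<nu>" and \<phi>: "\<And>t. t \<in> {a..b} \<Longrightarrow> \<bar>\<phi> t\<bar> \<le> C" and \<omega>: "\<omega> \<in> space M"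
  shows "integrable \<nu> (\<lambda>t. \<phi> t * X t \<omega>)" "integrable \<nu> (\<lambda>t. (\<phi> t * X t \<omega>)\<^sup>2)"
proof -
  have [measurable]: "(\<lambda>t. X t \<omega>) \<in> borel_measurable \<nu>" by (rule measurable_\<nu>_continuous[OF cont[OF \<omega>]])
  have "bounded ((\<lambda>t. X t \<omega>) ` {a..b})"
    by (intro compact_imp_bounded compact_continuous_image cont \<omega>) simp
  then obtain D where "\<forall>x\<in>(\<lambda>t. X t \<omega>) ` {a..b}. norm x \<le> D" unfolding bounded_iff by blast
  then have D: "\<bar>X t \<omega>\<bar> \<le> D" if "t \<in> {a..b}" for t using that by force
  have le: "\<bar>\<phi> t * X t \<omega>\<bar> \<le> C * D" if "t \<in> {a..b}" for t
    unfolding abs_mult using \<phi>[OF that] D[OF that] by (intro mult_mono) auto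
  show "integrable \<nu> (\<lambda>t. \<phi> t * X t \<omega>)"
    by (rule N.integrable_const_bound[of _ "C * D"]) (use le in \<open>auto simp: space_\<nu>\<close>)
  have "(\<phi> t * X t \<omega>)\<^sup>2 \<le> (C * D)\<^sup>2" if "t \<in> {a..b}" for t
    using power_mono[OF le[OF that], of 2] by simp
  then show "integrable \<nu> (\<lambda>t. (\<phi> t * X t \<omega>)\<^sup>2)"
    by (intro N.integrable_const_bound[of _ "(C * D)\<^sup>2"]) (auto simp: space_\<nu>)
qed

definition mix :: "(real \<Rightarrow> real) \<Rightarrow> 'a \<Rightarrow> real" where
  "mix \<phi> \<omega> = (\<integral>t. \<phi> t * X t \<omega> \<partial>\<nu>)"

context
  fixes \<phi> :: "real \<Rightarrow> real" and C :: real
  assumes \<phi>m[measurable]: "\<phi> \<in> borel_measurable \<nu>" and \<phi>b: "\<And>t. t \<in> {a..b} \<Longrightarrow> \<bar>\<phi> t\<bar> \<le> C"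
begin

lemma mix_measurable[measurable]: "mix \<phi> \<in> borel_measurable M"
proof -
  have "(\<lambda>p. \<phi> (fst p) * X (fst p) (snd p)) \<in> borel_measurable (\<nu> \<Otimes>\<^sub>M M)"
    by (intro borel_measurable_times joint_measurable) measurable
  from measurable_pair_swap[OF this]
  have "(\<lambda>(\<omega>, t). \<phi> t * X t \<omega>) \<in> borel_measurable (M \<Otimes>\<^sub>M \<nu>)" by (simp add: case_prod_beta)
  from N.borel_measurable_lebesgue_integral[OF this] show ?thesis
    unfolding mix_def[abs_def] .
qed

lemma joint_mult_integrable:
  assumes [measurable]: "W \<in> borel_measurable M" and W: "integrable M (\<lambda>\<omega>. (W \<omega>)\<^sup>2)"
  shows "integrable (\<nu> \<Otimes>\<^sub>M M) (\<lambda>(t, \<omega>). \<phi> t * X t \<omega> * W \<omega>)"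
proof (rule product_integrable)
  show "(\<lambda>(t, \<omega>). \<phi> t * X t \<omega> * W \<omega>) \<in> borel_measurable (\<nu> \<Otimes>\<^sub>M M)"
    unfolding case_prod_beta by (intro borel_measurable_times joint_measurable) measurable
  fix t assume t: "t \<in> {a..b}"
  have iX: "integrable M (\<lambda>\<omega>. X t \<omega> * W \<omega>)"
    using t W by (intro integrable_mult_of_square_integrable X_meas X_sq) auto
  then show "integrable M (\<lambda>\<omega>. case (t, \<omega>) of (t, \<omega>) \<Rightarrow> \<phi> t * X t \<omega> * W \<omega>)" by (simp add: mult.assoc)
  have "0 \<le> C" using \<phi>b[OF t] by linarith
  have "(\<integral>\<omega>. \<bar>\<phi> t * X t \<omega> * W \<omega>\<bar> \<partial>M) \<le> (\<integral>\<omega>. C * ((X t \<omega>)\<^sup>2 + (W \<omega>)\<^sup>2) \<partial>M)"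
  proof (rule integral_mono)
    show "integrable M (\<lambda>\<omega>. \<bar>\<phi> t * X t \<omega> * W \<omega>\<bar>)" using iX by (simp add: mult.assoc)
    show "integrable M (\<lambda>\<omega>. C * ((X t \<omega>)\<^sup>2 + (W \<omega>)\<^sup>2))" using W X_sq[OF t] by auto
    fix \<omega>
    have "2 * (\<bar>X t \<omega>\<bar> * \<bar>W \<omega>\<bar>) \<le> (X t \<omega>)\<^sup>2 + (W \<omega>)\<^sup>2"
      using zero_le_power2[of "\<bar>X t \<omega>\<bar> - \<bar>W \<omega>\<bar>"] by (simp add: power2_diff)
    moreover have "0 \<le> \<bar>X t \<omega>\<bar> * \<bar>W \<omega>\<bar>" by (intro mult_nonneg_nonneg) auto
    ultimately have "\<bar>X t \<omega>\<bar> * \<bar>W \<omega>\<bar> \<le> (X t \<omega>)\<^sup>2 + (W \<omega>)\<^sup>2" by linarith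
    then show "\<bar>\<phi> t * X t \<omega> * W \<omega>\<bar> \<le> C * ((X t \<omega>)\<^sup>2 + (W \<omega>)\<^sup>2)"
      using \<phi>b[OF t] \<open>0 \<le> C\<close> unfolding abs_mult mult.assoc by (intro mult_mono) auto
  qed
  also have "\<dots> = C * ((\<integral>\<omega>. (X t \<omega>)\<^sup>2 \<partial>M) + (\<integral>\<omega>. (W \<omega>)\<^sup>2 \<partial>M))"
    using W X_sq[OF t] by simp
  also have "\<dots> \<le> C * (second_moment_bound + (\<integral>\<omega>. (W \<omega>)\<^sup>2 \<partial>M))"
    using second_moment_le[OF t] \<open>0 \<le> C\<close> by (intro mult_left_mono) auto
  finally show "(\<integral>\<omega>. \<bar>case (t, \<omega>) of (t, \<omega>) \<Rightarrow> \<phi> t * X t \<omega> * W \<omega>\<bar> \<partial>M) \<le> C * (second_moment_bound + (\<integral>\<omega>. (W \<omega>)\<^sup>2 \<partial>M))"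
    by simp
qed

lemma integral_mix_mult:
  assumes [measurable]: "W \<in> borel_measurable M" and W: "integrable M (\<lambda>\<omega>. (W \<omega>)\<^sup>2)"
  shows "(\<integral>\<omega>. mix \<phi> \<omega> * W \<omega> \<partial>M) = (\<integral>t. \<phi> t * (\<integral>\<omega>. X t \<omega> * W \<omega> \<partial>M) \<partial>\<nu>)"
proof -
  have "(\<integral>\<omega>. mix \<phi> \<omega> * W \<omega> \<partial>M) = (\<integral>\<omega>. (\<integral>t. \<phi> t * X t \<omega> * W \<omega> \<partial>\<nu>) \<partial>M)"
    by (simp add: mix_def)
  also have "\<dots> = (\<integral>t. (\<integral>\<omega>. \<phi> t * X t \<omega> * W \<omega> \<partial>M) \<partial>\<nu>)"
    by (rule P.Fubini_integral[OF joint_mult_integrable[OF assms]])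
  finally show ?thesis by (simp add: mult.assoc)
qed

lemma mix_sq: "integrable M (\<lambda>\<omega>. (mix \<phi> \<omega>)\<^sup>2)"
proof (rule Bochner_Integration.integrable_bound)
  have "integrable (\<nu> \<Otimes>\<^sub>M M) (\<lambda>(t, \<omega>). (\<phi> t * X t \<omega>)\<^sup>2)"
  proof (rule product_integrable)
    show "(\<lambda>(t, \<omega>). (\<phi> t * X t \<omega>)\<^sup>2) \<in> borel_measurable (\<nu> \<Otimes>\<^sub>M M)"
      unfolding case_prod_beta by (intro borel_measurable_power borel_measurable_times joint_measurable) measurable
    fix t assume t: "t \<in> {a..b}"
    show "integrable M (\<lambda>\<omega>. case (t, \<omega>) of (t, \<omega>) \<Rightarrow> (\<phi> t * X t \<omega>)\<^sup>2)"
      using X_sq[OF t] by (simp add: power_mult_distrib)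
    have "(\<phi> t)\<^sup>2 \<le> C\<^sup>2" using power_mono[OF \<phi>b[OF t], of 2] by simp
    then have "(\<phi> t)\<^sup>2 * (\<integral>\<omega>. (X t \<omega>)\<^sup>2 \<partial>M) \<le> C\<^sup>2 * second_moment_bound"
      using second_moment_le[OF t] by (intro mult_mono) auto
    then show "(\<integral>\<omega>. \<bar>case (t, \<omega>) of (t, \<omega>) \<Rightarrow> (\<phi> t * X t \<omega>)\<^sup>2\<bar> \<partial>M) \<le> C\<^sup>2 * second_moment_bound"
      by (simp add: power_mult_distrib)
  qed
  from P.integrable_snd[OF this] show "integrable M (\<lambda>\<omega>. \<integral>t. (\<phi> t * X t \<omega>)\<^sup>2 \<partial>\<nu>)" .
  show "AE \<omega> in M. norm ((mix \<phi> \<omega>)\<^sup>2) \<le> norm (\<integral>t. (\<phi> t * X t \<omega>)\<^sup>2 \<partial>\<nu>)"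
  proof (rule AE_I2)
    fix \<omega> assume "\<omega> \<in> space M"
    from N.square_integral_le[OF path_integrable[OF \<phi>m \<phi>b this]]
    show "norm ((mix \<phi> \<omega>)\<^sup>2) \<le> norm (\<integral>t. (\<phi> t * X t \<omega>)\<^sup>2 \<partial>\<nu>)" by (simp add: mix_def)
  qed
qed measurable

text \<open>Interchanging the integrals shows that the energy is the variance of the averaged process.\<close>

lemma energy_density:
  assumes nn: "\<And>t. t \<in> {a..b} \<Longrightarrow> \<phi> t \<ge> 0"
  shows "energy (cov_fun M X) (density \<nu> (\<lambda>t. ennreal (\<phi> t))) = (\<integral>\<omega>. (mix \<phi> \<omega>)\<^sup>2 \<partial>M)"
proof -
  have m: "(\<lambda>t. \<integral>\<omega>. X t \<omega> * W \<omega> \<partial>M) \<in> borel_measurable \<nu>" if [measurable]: "W \<in> borel_measurable M" for W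
    by (rule borel_measurable_lebesgue_integral)
      (unfold case_prod_beta, intro borel_measurable_times joint_measurable, measurable)
  have ae: "AE t in \<nu>. 0 \<le> \<phi> t" using nn by (auto simp: space_\<nu>)
  have inner: "(\<integral>s. cov_fun M X s t \<partial>density \<nu> (\<lambda>t. ennreal (\<phi> t))) = (\<integral>\<omega>. X t \<omega> * mix \<phi> \<omega> \<partial>M)"
    if t: "t \<in> {a..b}" for t
  proof -
    have "(\<integral>s. cov_fun M X s t \<partial>density \<nu> (\<lambda>t. ennreal (\<phi> t))) = (\<integral>s. \<phi> s *\<^sub>R cov_fun M X s t \<partial>\<nu>)"
      using ae t by (intro integral_density) (auto simp: cov_fun_def intro!: m X_meas)
    also have "\<dots> = (\<integral>\<omega>. mix \<phi> \<omega> * X t \<omega> \<partial>M)"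
      using integral_mix_mult[OF X_meas[OF t] X_sq[OF t]] by (simp add: cov_fun_def)
    finally show ?thesis by (simp add: mult.commute)
  qed
  have "energy (cov_fun M X) (density \<nu> (\<lambda>t. ennreal (\<phi> t)))
    = (\<integral>t. (\<integral>\<omega>. X t \<omega> * mix \<phi> \<omega> \<partial>M) \<partial>density \<nu> (\<lambda>t. ennreal (\<phi> t)))"
    unfolding energy_def using inner by (intro Bochner_Integration.integral_cong) (auto simp: space_\<nu>)
  also have "\<dots> = (\<integral>t. \<phi> t *\<^sub>R (\<integral>\<omega>. X t \<omega> * mix \<phi> \<omega> \<partial>M) \<partial>\<nu>)"
    using ae by (intro integral_density) (auto intro!: m mix_measurable)
  also have "\<dots> = (\<integral>\<omega>. mix \<phi> \<omega> * mix \<phi> \<omega> \<partial>M)"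
    using integral_mix_mult[OF mix_measurable mix_sq] by simp
  finally show ?thesis by (simp add: power2_eq_square)
qed

end

definition average :: "'a \<Rightarrow> real" where
  "average = mix (\<lambda>_. 1)"

lemmas average_measurable[measurable] = mix_measurable[of "\<lambda>_. 1" 1, folded average_def, simplified]
lemmas average_sq = mix_sq[of "\<lambda>_. 1" 1, folded average_def, simplified]
lemmas integral_average_mult = integral_mix_mult[of "\<lambda>_. 1" 1, folded average_def, simplified]

lemma energy_\<nu>: "energy (cov_fun M X) \<nu> = (\<integral>\<omega>. (average \<omega>)\<^sup>2 \<partial>M)"
  using energy_density[of "\<lambda>_. 1" 1, folded average_def] by (simp add: density_1)

text \<open>Averaging the rounded process gives Riemann sums. By Jensen's inequality and the Hoelder bound
their mean square distance from \<^term>\<open>average\<close> is at most \<^term>\<open>(K * (1 / 2 ^ n) powr \<beta>)\<^sup>2\<close>.\<close>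

lemma average_gspace: "average \<in> gspace"
  unfolding gspace_def L2_closure_def
proof (intro CollectI conjI allI impI)
  interpret G0: gaussian_space M "process_span {a..b} X" by (rule gaussian_space_span)
  show "average \<in> borel_measurable M" "integrable M (\<lambda>\<omega>. (average \<omega>)\<^sup>2)" by (auto intro: average_sq)
  fix e :: real assume e: "e > 0"
  define d where "d n = (K * (1 / 2 ^ n) powr \<beta>)\<^sup>2" for n :: nat
  have "(\<lambda>n. (1/2) ^ n) \<longlonglongrightarrow> (0::real)" by (intro LIMSEQ_power_zero) auto
  then have "(\<lambda>n. (1 / 2 ^ n) powr \<beta>) \<longlonglongrightarrow> (0::real)"
    using \<beta> tendsto_powr2[of "\<lambda>n. (1/2) ^ n" "0::real" sequentially "\<lambda>_. \<beta>" \<beta>] by (simp add: power_divide)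
  then have "(\<lambda>n. (K * (1 / 2 ^ n) powr \<beta>)\<^sup>2) \<longlonglongrightarrow> (K * 0)\<^sup>2" by (intro tendsto_intros)
  then have "d \<longlonglongrightarrow> 0" by (simp add: d_def[abs_def])
  then obtain n where n: "d n < e" using e order_tendstoD(2)[of d 0 sequentially e] by (auto simp: eventually_sequentially)
  define F where "F = round_dyadic n ` {a..b}"
  have F: "finite F" "F \<subseteq> {a..b}" using finite_round_dyadic round_dyadic_mem by (auto simp: F_def)
  define E where "E q = {t \<in> space \<nu>. round_dyadic n t = q}" for q
  have [measurable]: "(\<lambda>t. round_dyadic n t) \<in> borel_measurable \<nu>"
    by (rule measurable_\<nu>) (unfold round_dyadic_def, measurable)
  have [measurable]: "E q \<in> sets \<nu>" for q unfolding E_def by measurable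
  define W where "W \<omega> = (\<Sum>q\<in>F. N.prob (E q) * X q \<omega>)" for \<omega>
  have W: "W \<in> process_span {a..b} X" unfolding W_def[abs_def] process_span_def using F
    by (intro CollectI exI[of _ F] exI[of _ "\<lambda>q. N.prob (E q)"]) simp
  have eqX: "X (round_dyadic n t) \<omega> = (\<Sum>q\<in>F. indicator (E q) t * X q \<omega>)" if "t \<in> space \<nu>" for t \<omega>
  proof -
    have "round_dyadic n t \<in> F" using that by (auto simp: F_def space_\<nu>)
    moreover have "(\<Sum>q\<in>F. indicator (E q) t * X q \<omega>) = (\<Sum>q\<in>F. if q = round_dyadic n t then X q \<omega> else 0)"
      using that by (intro sum.cong) (auto simp: E_def split: split_indicator)
    ultimately show ?thesis using F by simp
  qed
  have iE: "integrable \<nu> (\<lambda>t. indicator (E q) t * X q \<omega>)" for q \<omega>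
    by (intro integrable_mult_left N.integrable_const_bound[of _ 1]) auto
  have iR: "integrable \<nu> (\<lambda>t. X (round_dyadic n t) \<omega>)" and WR: "W \<omega> = (\<integral>t. X (round_dyadic n t) \<omega> \<partial>\<nu>)" for \<omega>
  proof -
    have "integrable \<nu> (\<lambda>t. \<Sum>q\<in>F. indicator (E q) t * X q \<omega>)" using iE by auto
    then show "integrable \<nu> (\<lambda>t. X (round_dyadic n t) \<omega>)"
      by (rule Bochner_Integration.integrable_cong[THEN iffD2, rotated -1]) (auto simp: eqX)
    have "(\<integral>t. X (round_dyadic n t) \<omega> \<partial>\<nu>) = (\<integral>t. (\<Sum>q\<in>F. indicator (E q) t * X q \<omega>) \<partial>\<nu>)"
      by (intro Bochner_Integration.integral_cong) (auto simp: eqX)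
    also have "\<dots> = W \<omega>"
      using iE by (subst Bochner_Integration.integral_sum) (auto simp: W_def)
    finally show "W \<omega> = (\<integral>t. X (round_dyadic n t) \<omega> \<partial>\<nu>)" ..
  qed
  define D where "D t \<omega> = (X t \<omega> - X (round_dyadic n t) \<omega>)\<^sup>2" for t \<omega>
  have D1: "integrable M (D t)" and D2: "(\<integral>\<omega>. D t \<omega> \<partial>M) \<le> d n" if t: "t \<in> {a..b}" for t
  proof -
    show "integrable M (D t)" unfolding D_def[abs_def] by (rule diff_sq[OF round_dyadic_mem t])
    have "(\<integral>\<omega>. D t \<omega> \<partial>M) \<le> (K * \<bar>t - round_dyadic n t\<bar> powr \<beta>)\<^sup>2"
      unfolding D_def by (rule incr[OF round_dyadic_mem t])
    also have "\<dots> \<le> d n" unfolding d_def using round_dyadic_dist[OF t] K \<beta>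
      by (intro power_mono mult_left_mono powr_mono2) auto
    finally show "(\<integral>\<omega>. D t \<omega> \<partial>M) \<le> d n" .
  qed
  have iD: "integrable (\<nu> \<Otimes>\<^sub>M M) (\<lambda>(t, \<omega>). D t \<omega>)"
  proof (rule product_integrable)
    show "(\<lambda>(t, \<omega>). D t \<omega>) \<in> borel_measurable (\<nu> \<Otimes>\<^sub>M M)"
      unfolding case_prod_beta D_def
      by (intro borel_measurable_power borel_measurable_diff joint_measurable joint_measurable_round)
    show "(\<integral>\<omega>. \<bar>case (t, \<omega>) of (t, \<omega>) \<Rightarrow> D t \<omega>\<bar> \<partial>M) \<le> d n" if "t \<in> {a..b}" for t
      using D2[OF that] by (simp add: D_def)
  qed (use D1 in auto)
  have "(\<integral>\<omega>. (average \<omega> - W \<omega>)\<^sup>2 \<partial>M) \<le> (\<integral>\<omega>. (\<integral>t. D t \<omega> \<partial>\<nu>) \<partial>M)"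
  proof (rule integral_mono)
    have "W \<in> borel_measurable M" using G0.meas W by simp
    then show "integrable M (\<lambda>\<omega>. (average \<omega> - W \<omega>)\<^sup>2)"
      using square_integrable_lin(1)[OF average_measurable _ average_sq G0.sq[OF W], of 1 "-1"] by simp
    show "integrable M (\<lambda>\<omega>. \<integral>t. D t \<omega> \<partial>\<nu>)" by (rule P.integrable_snd[OF iD])
    fix \<omega> assume \<omega>: "\<omega> \<in> space M"
    note iX = path_integrable[of "\<lambda>_. 1" 1, simplified, OF \<omega>]
    have iR2: "integrable \<nu> (\<lambda>t. (X (round_dyadic n t) \<omega>)\<^sup>2)"
    proof (rule N.integrable_const_bound[of _ "Max ((\<lambda>q. (X q \<omega>)\<^sup>2) ` F)"])
      show "AE t in \<nu>. norm ((X (round_dyadic n t) \<omega>)\<^sup>2) \<le> Max ((\<lambda>q. (X q \<omega>)\<^sup>2) ` F)"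
        using F(1) by (auto simp: space_\<nu> F_def intro!: Max_ge)
      show "(\<lambda>t. (X (round_dyadic n t) \<omega>)\<^sup>2) \<in> borel_measurable \<nu>"
        using borel_measurable_integrable[OF iR] by measurable
    qed
    have iDt: "integrable \<nu> (\<lambda>t. D t \<omega>)"
      unfolding D_def
      using square_integrable_lin(1)[OF borel_measurable_integrable[OF iX(1)] borel_measurable_integrable[OF iR] iX(2) iR2, of 1 "-1"]
      by simp
    have "average \<omega> - W \<omega> = (\<integral>t. X t \<omega> - X (round_dyadic n t) \<omega> \<partial>\<nu>)"
      unfolding WR average_def mix_def using iX(1) iR by simp
    also have "\<dots>\<^sup>2 \<le> (\<integral>t. D t \<omega> \<partial>\<nu>)"
      using iX(1) iR iDt unfolding D_def by (intro N.square_integral_le) auto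
    finally show "(average \<omega> - W \<omega>)\<^sup>2 \<le> (\<integral>t. D t \<omega> \<partial>\<nu>)" .
  qed
  also have "\<dots> = (\<integral>t. (\<integral>\<omega>. D t \<omega> \<partial>M) \<partial>\<nu>)" by (rule P.Fubini_integral[OF iD])
  also have "\<dots> \<le> (\<integral>t. d n \<partial>\<nu>)"
    using P.integrable_fst[OF iD] D2 by (intro integral_mono) (auto simp: space_\<nu>)
  also have "\<dots> \<le> e" using n by (simp add: N.prob_space)
  finally show "\<exists>W\<in>process_span {a..b} X. (\<integral>\<omega>. (average \<omega> - W \<omega>)\<^sup>2 \<partial>M) \<le> e" using W by blast
qed

definition potential :: "real \<Rightarrow> real" where
  "potential t = (\<integral>\<omega>. X t \<omega> * average \<omega> \<partial>M)"

lemma potential_continuous: "continuous_on {a..b} potential"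
  unfolding continuous_on
proof
  fix t assume t: "t \<in> {a..b}"
  let ?c = "K * ((\<integral>\<omega>. (average \<omega>)\<^sup>2 \<partial>M) + 1) / 2"
  have le: "\<bar>potential s - potential t\<bar> \<le> \<bar>s - t\<bar> powr \<beta> * ?c" if s: "s \<in> {a..b}" for s
  proof (cases "s = t")
    case False
    have iX: "integrable M (\<lambda>\<omega>. X r \<omega> * average \<omega>)" if "r \<in> {a..b}" for r
      using that average_sq by (intro integrable_mult_of_square_integrable X_meas X_sq) auto
    have "potential s - potential t = (\<integral>\<omega>. average \<omega> * (X s \<omega> - X t \<omega>) \<partial>M)"
      unfolding potential_def using iX s t
      by (subst Bochner_Integration.integral_diff[symmetric]) (auto simp: algebra_simps)
    also have "\<bar>\<dots>\<bar> \<le> (K * \<bar>s - t\<bar> powr \<beta>) * ((\<integral>\<omega>. (average \<omega>)\<^sup>2 \<partial>M) + 1) / 2"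
      using s t K False
      by (intro abs_integral_mult_le(2) average_measurable borel_measurable_diff X_meas average_sq diff_sq incr) auto
    finally show ?thesis by (simp add: mult_ac)
  qed simp
  show "(potential \<longlongrightarrow> potential t) (at t within {a..b})"
  proof (rule LIM_zero_cancel, rule Lim_null_comparison)
    show "\<forall>\<^sub>F s in at t within {a..b}. norm (potential s - potential t) \<le> \<bar>s - t\<bar> powr \<beta> * ?c"
      using le by (auto simp: eventually_at intro!: exI[of _ 1])
    have "((\<lambda>s. \<bar>s - t\<bar>) \<longlongrightarrow> \<bar>t - t\<bar>) (at t within {a..b})" by (intro tendsto_intros)
    then have "((\<lambda>s. \<bar>s - t\<bar> powr \<beta>) \<longlongrightarrow> 0) (at t within {a..b})"
      using \<beta> tendsto_powr2[of "\<lambda>s. \<bar>s - t\<bar>" 0 _ "\<lambda>_. \<beta>" \<beta>] by simp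
    then have "((\<lambda>s. \<bar>s - t\<bar> powr \<beta> * ?c) \<longlongrightarrow> 0 * ?c) (at t within {a..b})" by (intro tendsto_intros)
    then show "((\<lambda>s. \<bar>s - t\<bar> powr \<beta> * ?c) \<longlongrightarrow> 0) (at t within {a..b})" by simp
  qed
qed

text \<open>First variation: moving mass along the density \<open>1 + \<epsilon> (v - h)\<close>, with \<open>h\<close> the
  potential and \<open>v\<close> the minimal energy, changes the energy by
  \<open>- 2 \<epsilon> \<integral> (v - h)\<^sup>2 d\<nu> + O(\<epsilon>\<^sup>2)\<close>.\<close>

lemma optimal_potential_AE:
  assumes opt: "optimal_measure (cov_fun M X) a b \<nu>"
  shows "AE t in \<nu>. potential t = energy (cov_fun M X) \<nu>"
proof -
  define v where "v = energy (cov_fun M X) \<nu>"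
  have hm[measurable]: "potential \<in> borel_measurable \<nu>"
    by (rule measurable_\<nu>_continuous[OF potential_continuous])
  define \<phi> where "\<phi> t = v - potential t" for t
  have [measurable]: "\<phi> \<in> borel_measurable \<nu>" unfolding \<phi>_def by measurable
  have "bounded (\<phi> ` {a..b})"
    unfolding \<phi>_def by (intro compact_imp_bounded compact_continuous_image continuous_intros potential_continuous) simp
  then obtain C where "\<forall>x\<in>\<phi> ` {a..b}. norm x \<le> C" unfolding bounded_iff by blast
  then have C: "\<bar>\<phi> t\<bar> \<le> C" if "t \<in> {a..b}" for t using that by force
  have C0: "C \<ge> 0" using C[of a] ab by auto
  have i\<phi>: "integrable \<nu> \<phi>"
    using C by (intro N.integrable_const_bound[of _ C]) (auto simp: space_\<nu>)
  have "\<And>t. t \<in> {a..b} \<Longrightarrow> (\<phi> t)\<^sup>2 \<le> C\<^sup>2" using power_mono[OF C, of _ 2] by simp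
  then have i\<phi>2: "integrable \<nu> (\<lambda>t. (\<phi> t)\<^sup>2)"
    by (intro N.integrable_const_bound[of _ "C\<^sup>2"]) (auto simp: space_\<nu>)
  have vY: "v = (\<integral>\<omega>. (average \<omega>)\<^sup>2 \<partial>M)" by (simp add: v_def energy_\<nu>)
  have "v = (\<integral>\<omega>. average \<omega> * average \<omega> \<partial>M)" by (simp add: vY power2_eq_square)
  also have "\<dots> = (\<integral>t. potential t \<partial>\<nu>)"
    unfolding potential_def by (rule integral_average_mult[OF average_measurable average_sq])
  finally have vh: "(\<integral>t. potential t \<partial>\<nu>) = v" ..
  have ih: "integrable \<nu> potential"
    using i\<phi> Bochner_Integration.integrable_diff[of \<nu> "\<lambda>_. v" \<phi>] by (simp add: \<phi>_def)
  have \<phi>0: "(\<integral>t. \<phi> t \<partial>\<nu>) = 0" unfolding \<phi>_def using ih by (simp add: vh N.prob_space)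
  define U where "U = mix \<phi>"
  have [measurable]: "U \<in> borel_measurable M" unfolding U_def by (rule mix_measurable[OF _ C]) auto
  have U2: "integrable M (\<lambda>\<omega>. (U \<omega>)\<^sup>2)" unfolding U_def by (rule mix_sq[OF _ C]) auto
  have "(\<integral>\<omega>. average \<omega> * U \<omega> \<partial>M) = (\<integral>\<omega>. U \<omega> * average \<omega> \<partial>M)" by (simp add: mult.commute)
  also have "\<dots> = (\<integral>t. \<phi> t * potential t \<partial>\<nu>)"
    unfolding U_def potential_def by (rule integral_mix_mult[OF _ C average_measurable average_sq]) auto
  also have "\<dots> = (\<integral>t. v * \<phi> t - (\<phi> t)\<^sup>2 \<partial>\<nu>)"
    by (intro Bochner_Integration.integral_cong) (auto simp: \<phi>_def power2_eq_square algebra_simps)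
  also have "\<dots> = - (\<integral>t. (\<phi> t)\<^sup>2 \<partial>\<nu>)" using i\<phi> i\<phi>2 by (simp add: \<phi>0)
  finally have YU: "(\<integral>\<omega>. average \<omega> * U \<omega> \<partial>M) = - (\<integral>t. (\<phi> t)\<^sup>2 \<partial>\<nu>)" .
  have key: "2 * (\<integral>t. (\<phi> t)\<^sup>2 \<partial>\<nu>) \<le> \<epsilon> * (\<integral>\<omega>. (U \<omega>)\<^sup>2 \<partial>M)" if \<epsilon>: "0 < \<epsilon>" "\<epsilon> * C \<le> 1" for \<epsilon>
  proof -
    define g where "g t = 1 + \<epsilon> * \<phi> t" for t
    have [measurable]: "g \<in> borel_measurable \<nu>" unfolding g_def by measurable
    have e\<phi>: "\<bar>\<epsilon> * \<phi> t\<bar> \<le> 1" if "t \<in> {a..b}" for t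
    proof -
      have "\<bar>\<epsilon> * \<phi> t\<bar> = \<epsilon> * \<bar>\<phi> t\<bar>" using \<epsilon> by (simp add: abs_mult)
      also have "\<dots> \<le> \<epsilon> * C" using C[OF that] \<epsilon> by (intro mult_left_mono) auto
      finally show ?thesis using \<epsilon> by simp
    qed
    have g0: "g t \<ge> 0" and g2: "\<bar>g t\<bar> \<le> 2" if "t \<in> {a..b}" for t
      using e\<phi>[OF that] by (auto simp: g_def abs_le_iff)
    have ig: "integrable \<nu> g" unfolding g_def using i\<phi> by simp
    let ?\<mu> = "density \<nu> (\<lambda>t. ennreal (g t))"
    have "?\<mu> \<in> M1 a b"
    proof -
      have "prob_space ?\<mu>"
      proof
        have "emeasure ?\<mu> (space ?\<mu>) = (\<integral>\<^sup>+t. ennreal (g t) \<partial>\<nu>)"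
          by (simp add: emeasure_density cong: nn_integral_cong_simp)
        also have "\<dots> = ennreal (\<integral>t. g t \<partial>\<nu>)"
          using g0 ig by (intro nn_integral_eq_integral) (auto simp: space_\<nu>)
        also have "(\<integral>t. g t \<partial>\<nu>) = 1" unfolding g_def using i\<phi> by (simp add: \<phi>0 N.prob_space)
        finally show "emeasure ?\<mu> (space ?\<mu>) = 1" by simp
      qed
      then show ?thesis by (simp add: M1_def sets_\<nu>)
    qed
    then have "v \<le> energy (cov_fun M X) ?\<mu>"
      using opt by (auto simp: optimal_measure_def is_arg_min_def v_def not_less)
    also have "\<dots> = (\<integral>\<omega>. (mix g \<omega>)\<^sup>2 \<partial>M)"
      by (rule energy_density[OF _ g2 g0]) auto
    also have "\<dots> = (\<integral>\<omega>. (1 * average \<omega> + \<epsilon> * U \<omega>)\<^sup>2 \<partial>M)"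
    proof (rule Bochner_Integration.integral_cong[OF refl])
      fix \<omega> assume \<omega>: "\<omega> \<in> space M"
      have "mix g \<omega> = (\<integral>t. X t \<omega> + \<epsilon> * (\<phi> t * X t \<omega>) \<partial>\<nu>)"
        unfolding mix_def g_def by (intro Bochner_Integration.integral_cong) (auto simp: algebra_simps)
      also have "\<dots> = average \<omega> + \<epsilon> * U \<omega>"
        using path_integrable(1)[OF _ C \<omega>] path_integrable(1)[of "\<lambda>_. 1" 1, OF _ _ \<omega>]
        by (simp add: average_def U_def mix_def)
      finally show "(mix g \<omega>)\<^sup>2 = (1 * average \<omega> + \<epsilon> * U \<omega>)\<^sup>2" by simp
    qed
    also have "\<dots> = v + 2 * \<epsilon> * (\<integral>\<omega>. average \<omega> * U \<omega> \<partial>M) + \<epsilon>\<^sup>2 * (\<integral>\<omega>. (U \<omega>)\<^sup>2 \<partial>M)"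
      unfolding vY using square_integrable_lin(2)[OF average_measurable _ average_sq U2, of 1 \<epsilon>] by simp
    finally have "0 \<le> \<epsilon> * (\<epsilon> * (\<integral>\<omega>. (U \<omega>)\<^sup>2 \<partial>M) - 2 * (\<integral>t. (\<phi> t)\<^sup>2 \<partial>\<nu>))"
      unfolding YU by (simp add: power2_eq_square algebra_simps)
    then show ?thesis using \<epsilon> by (simp add: zero_le_mult_iff)
  qed
  have "(\<integral>t. (\<phi> t)\<^sup>2 \<partial>\<nu>) \<le> 0"
  proof (rule ccontr)
    assume "\<not> (\<integral>t. (\<phi> t)\<^sup>2 \<partial>\<nu>) \<le> 0"
    then have pos: "(\<integral>t. (\<phi> t)\<^sup>2 \<partial>\<nu>) > 0" by simp
    let ?u = "\<integral>\<omega>. (U \<omega>)\<^sup>2 \<partial>M"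
    have u: "?u \<ge> 0" by simp
    \<comment> \<open>The first bound keeps the perturbed density nonnegative, the second makes the quadratic
      term at most half as large as the linear one.\<close>
    define \<epsilon> where "\<epsilon> = min (1 / (C + 1)) ((\<integral>t. (\<phi> t)\<^sup>2 \<partial>\<nu>) / (?u + 1))"
    have u1: "?u + 1 > 0" using u by linarith
    have e0: "\<epsilon> > 0" unfolding \<epsilon>_def using divide_pos_pos[OF pos u1] C0 by simp
    have "\<epsilon> * C \<le> \<epsilon> * (C + 1)" using e0 by simp
    also have "\<dots> \<le> 1 / (C + 1) * (C + 1)" using C0 by (intro mult_right_mono) (auto simp: \<epsilon>_def)
    also have "\<dots> = 1" using C0 by simp
    finally have "2 * (\<integral>t. (\<phi> t)\<^sup>2 \<partial>\<nu>) \<le> \<epsilon> * ?u" using key[OF e0] by simp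
    also have "\<dots> \<le> (\<integral>t. (\<phi> t)\<^sup>2 \<partial>\<nu>) / (?u + 1) * (?u + 1)"
      using u pos u1 by (intro mult_mono) (auto simp: \<epsilon>_def)
    also have "\<dots> = (\<integral>t. (\<phi> t)\<^sup>2 \<partial>\<nu>)" using u1 by simp
    finally show False using pos by simp
  qed
  moreover have "0 \<le> (\<integral>t. (\<phi> t)\<^sup>2 \<partial>\<nu>)" by simp
  ultimately have "(\<integral>t. (\<phi> t)\<^sup>2 \<partial>\<nu>) = 0" by simp
  then have "AE t in \<nu>. (\<phi> t)\<^sup>2 = 0"
    using integral_nonneg_eq_0_iff_AE[OF i\<phi>2] by simp
  then show ?thesis by eventually_elim (simp add: \<phi>_def v_def)
qed

text \<open>Where the potential differed from the energy, continuity would give an open set of points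
doing so, which has positive measure by full support and measure zero by the first variation.\<close>

lemma potential_constant:
  assumes opt: "optimal_measure (cov_fun M X) a b \<nu>" and supp: "measure_support \<nu> = {a..b}" and t: "t \<in> {a..b}"
  shows "potential t = energy (cov_fun M X) \<nu>"
proof (rule ccontr)
  let ?v = "energy (cov_fun M X) \<nu>"
  assume ne: "potential t \<noteq> ?v"
  have "open (- {?v})" by auto
  then have "\<exists>U. open U \<and> U \<inter> {a..b} = potential -` (- {?v}) \<inter> {a..b}"
    using continuous_on_open_invariant[of "{a..b}" potential] potential_continuous by blast
  then obtain U where U: "open U" "U \<inter> {a..b} = potential -` (- {?v}) \<inter> {a..b}" by blast
  have "t \<in> U" using U(2) t ne by auto
  then have pos: "emeasure \<nu> (U \<inter> space \<nu>) > 0"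
    using supp t U(1) unfolding measure_support_def by blast
  have [measurable]: "potential \<in> borel_measurable \<nu>"
    by (rule measurable_\<nu>_continuous[OF potential_continuous])
  have sets: "{t \<in> space \<nu>. \<not> potential t = ?v} \<in> sets \<nu>" by measurable
  have null: "{t \<in> space \<nu>. \<not> potential t = ?v} \<in> null_sets \<nu>"
    by (rule AE_iff_null[where P = "\<lambda>t. potential t = ?v", OF sets, THEN iffD1, OF optimal_potential_AE[OF opt]])
  have "{t \<in> space \<nu>. \<not> potential t = ?v} = U \<inter> space \<nu>"
    using U(2) unfolding space_\<nu> by blast
  then show False using pos null_setsD1[OF null] by simp
qed

end

section \<open>The lower bound\<close>

text \<open>The hypothesis on \<^term>\<open>\<sigma>\<close> controls increments only at small distances. Steps of a
  small fixed length reach every point of the interval, so second moments are bounded, and a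
  larger constant covers the remaining distances.\<close>

lemma mean_square_holder:
  fixes \<beta> c a b :: real
  assumes "prob_space M" and gp: "centered_gaussian_process M {a..b} X" and "a < b" "\<beta> > 0" "c > 0"
    and \<sigma>0: "\<And>h. h \<ge> 0 \<Longrightarrow> \<sigma> h \<ge> 0"
    and lim: "((\<lambda>h. h powr (-\<beta>) * \<sigma> h) \<longlongrightarrow> c) (at_right 0)"
    and incr: "\<And>s t. s \<in> {a..b} \<Longrightarrow> t \<in> {a..b} \<Longrightarrow> (\<integral>\<omega>. (X t \<omega> - X s \<omega>)\<^sup>2 \<partial>M) \<le> (\<sigma> \<bar>t - s\<bar>)\<^sup>2"
  obtains K where "K > 0"
    "\<And>s t. s \<in> {a..b} \<Longrightarrow> t \<in> {a..b} \<Longrightarrow> (\<integral>\<omega>. (X t \<omega> - X s \<omega>)\<^sup>2 \<partial>M) \<le> (K * \<bar>t - s\<bar> powr \<beta>)\<^sup>2"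
proof -
  interpret gaussian_space M "process_span {a..b} X"
    by (rule gaussian_space_process_span[OF assms(1) gp])
  have X: "X t \<in> process_span {a..b} X" if "t \<in> {a..b}" for t
    using that by (rule mem_process_span)
  have "eventually (\<lambda>h. h powr (-\<beta>) * \<sigma> h < 2 * c) (at_right 0)"
    using order_tendstoD(2)[OF lim, of "2 * c"] \<open>c > 0\<close> by simp
  then obtain \<delta> where \<delta>: "\<delta> > 0" "\<And>h. 0 < h \<Longrightarrow> h < \<delta> \<Longrightarrow> h powr (-\<beta>) * \<sigma> h < 2 * c"
    unfolding eventually_at_right_field by auto
  have small: "(\<sigma> h)\<^sup>2 \<le> (2 * c * h powr \<beta>)\<^sup>2" if h: "0 < h" "h < \<delta>" for h
  proof -
    have "\<sigma> h = h powr \<beta> * (h powr (-\<beta>) * \<sigma> h)" using h by (simp add: powr_minus)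
    also have "\<dots> \<le> h powr \<beta> * (2 * c)" using \<delta>(2)[OF h] by (intro mult_left_mono) auto
    finally show ?thesis using \<sigma>0[of h] h by (intro power_mono) (auto simp: mult_ac)
  qed
  have two: "(\<integral>\<omega>. (r * X s \<omega> + q * Y \<omega>)\<^sup>2 \<partial>M) \<le> 2 * r\<^sup>2 * (\<integral>\<omega>. (X s \<omega>)\<^sup>2 \<partial>M) + 2 * q\<^sup>2 * (\<integral>\<omega>. (Y \<omega>)\<^sup>2 \<partial>M)"
    if "s \<in> {a..b}" "Y \<in> process_span {a..b} X" for r q s Y
    using that by (intro square_integrable_lin(3) meas sq X) auto
  \<comment> \<open>Second moments are bounded on the part of the interval reached in \<open>n\<close> steps.\<close>
  have steps: "\<exists>B. \<forall>t\<in>{a..b}. t \<le> a + real n * (\<delta> / 2) \<longrightarrow> (\<integral>\<omega>. (X t \<omega>)\<^sup>2 \<partial>M) \<le> B" for n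
  proof (induction n)
    case 0
    show ?case by (intro exI[of _ "\<integral>\<omega>. (X a \<omega>)\<^sup>2 \<partial>M"]) auto
  next
    case (Suc n)
    then obtain B where B: "\<And>t. t \<in> {a..b} \<Longrightarrow> t \<le> a + real n * (\<delta> / 2) \<Longrightarrow> (\<integral>\<omega>. (X t \<omega>)\<^sup>2 \<partial>M) \<le> B" by blast
    show ?case
    proof (intro exI[of _ "2 * B + 2 * (2 * c * \<delta> powr \<beta>)\<^sup>2"] ballI impI)
      fix t assume t: "t \<in> {a..b}" "t \<le> a + real (Suc n) * (\<delta> / 2)"
      \<comment> \<open>Half the radius, because the bound on the increments needs a distance below \<open>\<delta>\<close>.\<close>
      define s where "s = max a (t - \<delta> / 2)"
      have s: "s \<in> {a..b}" "s \<le> a + real n * (\<delta> / 2)" "0 \<le> t - s" "t - s < \<delta>"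
        using t \<delta>(1) by (auto simp: s_def algebra_simps max_def add_divide_distrib)
      have d: "(\<integral>\<omega>. (X t \<omega> - X s \<omega>)\<^sup>2 \<partial>M) \<le> (2 * c * \<delta> powr \<beta>)\<^sup>2"
      proof (cases "t = s")
        case False
        then have "(\<integral>\<omega>. (X t \<omega> - X s \<omega>)\<^sup>2 \<partial>M) \<le> (2 * c * (t - s) powr \<beta>)\<^sup>2"
          using incr[OF s(1) t(1)] small[of "t - s"] s by simp
        also have "\<dots> \<le> (2 * c * \<delta> powr \<beta>)\<^sup>2"
          using s \<open>c > 0\<close> \<open>\<beta> > 0\<close> by (intro power_mono mult_left_mono powr_mono2) auto
        finally show ?thesis .
      qed simp
      have "(\<integral>\<omega>. (X t \<omega>)\<^sup>2 \<partial>M) = (\<integral>\<omega>. (1 * X s \<omega> + 1 * (X t \<omega> - X s \<omega>))\<^sup>2 \<partial>M)" by simp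
      also have "\<dots> \<le> 2 * 1\<^sup>2 * (\<integral>\<omega>. (X s \<omega>)\<^sup>2 \<partial>M) + 2 * 1\<^sup>2 * (\<integral>\<omega>. (X t \<omega> - X s \<omega>)\<^sup>2 \<partial>M)"
        by (rule two[OF s(1) diff[OF X[OF t(1)] X[OF s(1)]]])
      also have "\<dots> \<le> 2 * B + 2 * (2 * c * \<delta> powr \<beta>)\<^sup>2" using B[OF s(1,2)] d by simp
      finally show "(\<integral>\<omega>. (X t \<omega>)\<^sup>2 \<partial>M) \<le> 2 * B + 2 * (2 * c * \<delta> powr \<beta>)\<^sup>2" .
    qed
  qed
  obtain n :: nat where n: "(b - a) / (\<delta> / 2) \<le> real n" using real_arch_simple by blast
  have bn: "b \<le> a + real n * (\<delta> / 2)" using n \<delta>(1) by (simp add: field_simps)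
  obtain B where Bn: "\<forall>t\<in>{a..b}. t \<le> a + real n * (\<delta> / 2) \<longrightarrow> (\<integral>\<omega>. (X t \<omega>)\<^sup>2 \<partial>M) \<le> B"
    using steps[of n] by blast
  have B: "(\<integral>\<omega>. (X t \<omega>)\<^sup>2 \<partial>M) \<le> B" if t: "t \<in> {a..b}" for t
    using Bn[rule_format, OF t] t bn by simp
  have B0: "B \<ge> 0"
  proof -
    have "0 \<le> (\<integral>\<omega>. (X a \<omega>)\<^sup>2 \<partial>M)" by simp
    also have "\<dots> \<le> B" using B[of a] \<open>a < b\<close> by simp
    finally show ?thesis .
  qed
  define K where "K = 2 * c + sqrt (4 * B) / \<delta> powr \<beta>"
  have K: "K > 0" "2 * c \<le> K" "sqrt (4 * B) / \<delta> powr \<beta> \<le> K" using \<open>c > 0\<close> B0 by (auto simp: K_def intro!: add_pos_nonneg)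
  show ?thesis
  proof (rule that[OF K(1)])
    fix s t assume st: "s \<in> {a..b}" "t \<in> {a..b}"
    consider "s = t" | "0 < \<bar>t - s\<bar>" "\<bar>t - s\<bar> < \<delta>" | "\<bar>t - s\<bar> \<ge> \<delta>" by linarith
    then show "(\<integral>\<omega>. (X t \<omega> - X s \<omega>)\<^sup>2 \<partial>M) \<le> (K * \<bar>t - s\<bar> powr \<beta>)\<^sup>2"
    proof cases
      case 2
      have "(\<integral>\<omega>. (X t \<omega> - X s \<omega>)\<^sup>2 \<partial>M) \<le> (2 * c * \<bar>t - s\<bar> powr \<beta>)\<^sup>2"
        using incr[OF st] small[OF 2] by simp
      also have "\<dots> \<le> (K * \<bar>t - s\<bar> powr \<beta>)\<^sup>2"
        using K \<open>c > 0\<close> by (intro power_mono mult_right_mono) auto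
      finally show ?thesis .
    next
      case 3
      have "(\<integral>\<omega>. (X t \<omega> - X s \<omega>)\<^sup>2 \<partial>M) = (\<integral>\<omega>. (1 * X t \<omega> + (-1) * X s \<omega>)\<^sup>2 \<partial>M)" by simp
      also have "\<dots> \<le> 2 * 1\<^sup>2 * (\<integral>\<omega>. (X t \<omega>)\<^sup>2 \<partial>M) + 2 * (-1)\<^sup>2 * (\<integral>\<omega>. (X s \<omega>)\<^sup>2 \<partial>M)"
        by (rule two[OF st(2) X[OF st(1)]])
      also have "\<dots> \<le> 4 * B" using B[OF st(1)] B[OF st(2)] by simp
      also have "\<dots> = (sqrt (4 * B) / \<delta> powr \<beta> * \<delta> powr \<beta>)\<^sup>2" using B0 \<delta>(1) by simp
      also have "\<dots> \<le> (K * \<bar>t - s\<bar> powr \<beta>)\<^sup>2"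
        using K 3 \<delta>(1) \<open>\<beta> > 0\<close> B0 by (intro power_mono mult_mono powr_mono2) auto
      finally show ?thesis .
    qed simp
  qed
qed

lemma std_normal_tail_lower:
  assumes "s \<ge> 0" "\<eta> > 0"
  shows "measure std_normal {s<..} \<ge> \<eta> * std_normal_density (s + \<eta>)"
proof -
  interpret prob_space std_normal by (rule prob_space_std_normal)
  have "ennreal (\<eta> * std_normal_density (s + \<eta>)) = (\<integral>\<^sup>+x. ennreal (std_normal_density (s + \<eta>)) * indicator {s<..s + \<eta>} x \<partial>lborel)"
    using assms by (subst nn_integral_cmult_indicator) (auto simp: ennreal_mult'[symmetric] mult.commute)
  also have "\<dots> \<le> (\<integral>\<^sup>+x. ennreal (std_normal_density x) * indicator {s<..} x \<partial>lborel)"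
  proof (rule nn_integral_mono)
    fix x :: real
    show "ennreal (std_normal_density (s + \<eta>)) * indicator {s<..s + \<eta>} x \<le> ennreal (std_normal_density x) * indicator {s<..} x"
    proof (cases "x \<in> {s<..s + \<eta>}")
      case True
      then have "x\<^sup>2 \<le> (s + \<eta>)\<^sup>2" using assms by (intro power_mono) auto
      then have "std_normal_density (s + \<eta>) \<le> std_normal_density x"
        unfolding std_normal_density_def by (intro mult_left_mono) auto
      then show ?thesis using True by (simp add: ennreal_leI)
    qed simp
  qed
  also have "\<dots> = emeasure std_normal {s<..}"
    by (subst emeasure_density) auto
  finally show ?thesis by (simp add: emeasure_eq_measure)
qed

lemma dyadic_dense_unit_interval:
  assumes "x \<in> {0..1::real}"
  obtains k where "k < 2 ^ n" "\<bar>real k / 2 ^ n - x\<bar> \<le> 1 / 2 ^ n"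
proof (cases "x = 1")
  case True
  have "real (2 ^ n - 1) / 2 ^ n - x = - (1 / 2 ^ n)"
    using True by (simp add: of_nat_diff diff_divide_distrib)
  then show ?thesis by (intro that[of "2 ^ n - 1"]) auto
next
  case False
  define k where "k = nat \<lfloor>x * 2 ^ n\<rfloor>"
  have rk: "real k = real_of_int \<lfloor>x * 2 ^ n\<rfloor>" using assms by (simp add: k_def)
  have k: "real k \<le> x * 2 ^ n" "x * 2 ^ n < real k + 1" unfolding rk by linarith+
  have "x * 2 ^ n < 1 * 2 ^ n" using False assms by (intro mult_strict_right_mono) auto
  with k(1) have "real k < 1 * 2 ^ n" by (rule le_less_trans)
  then have "real k < real (2 ^ n)" by simp
  then have "k < 2 ^ n" by (simp only: of_nat_less_iff)
  moreover have "real k / 2 ^ n \<le> x" "x \<le> real k / 2 ^ n + 1 / 2 ^ n"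
    using k by (simp_all add: field_simps)
  ultimately show ?thesis by (intro that[of k]) auto
qed

context ms_holder_process
begin

lemma affine_mem:
  assumes "x \<in> {0..1}"
  shows "a + (b - a) * x \<in> {a..b}"
proof -
  have "(b - a) * x \<le> (b - a) * 1" using assms ab by (intro mult_left_mono) auto
  moreover have "0 \<le> (b - a) * x" using ab assms by simp
  ultimately show ?thesis by simp
qed

lemma path_ge_of_dyadic:
  assumes \<omega>: "\<omega> \<in> space M" and t: "t \<in> {a..b}"
    and dy: "\<And>n k. k < 2 ^ n \<Longrightarrow> y \<le> X (a + (b - a) * (real k / 2 ^ n)) \<omega>"
  shows "y \<le> X t \<omega>"
proof -
  define x where "x = (t - a) / (b - a)"
  have x: "x \<in> {0..1}" and tx: "t = a + (b - a) * x" using t ab by (auto simp: x_def field_simps)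
  have "\<forall>n. \<exists>k. k < 2 ^ n \<and> \<bar>real k / 2 ^ n - x\<bar> \<le> 1 / 2 ^ n"
    using dyadic_dense_unit_interval[OF x] by metis
  then obtain k where k: "\<And>n. k n < 2 ^ n" "\<And>n. \<bar>real (k n) / 2 ^ n - x\<bar> \<le> 1 / 2 ^ n" by metis
  have lim: "(\<lambda>n. real (k n) / 2 ^ n) \<longlonglongrightarrow> x"
  proof (rule LIM_zero_cancel, rule Lim_null_comparison)
    show "\<forall>\<^sub>F n in sequentially. norm (real (k n) / 2 ^ n - x) \<le> (1/2) ^ n"
      using k(2) by (auto simp: power_divide)
    show "(\<lambda>n. (1/2) ^ n) \<longlonglongrightarrow> (0::real)" by (intro LIMSEQ_power_zero) auto
  qed
  have lim': "(\<lambda>n. a + (b - a) * (real (k n) / 2 ^ n)) \<longlonglongrightarrow> t"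
    unfolding tx by (intro tendsto_intros lim)
  have mem: "a + (b - a) * (real (k n) / 2 ^ n) \<in> {a..b}" for n
    by (rule affine_mem[OF dyadic_mem_unit_interval[OF k(1)]])
  have "(\<lambda>n. X (a + (b - a) * (real (k n) / 2 ^ n)) \<omega>) \<longlonglongrightarrow> X t \<omega>"
    by (rule continuous_on_tendsto_compose[OF cont[OF \<omega>] lim' t]) (use mem in auto)
  then show ?thesis by (rule LIMSEQ_le_const) (use dy k(1) in auto)
qed

lemma path_INF_le:
  assumes "\<omega> \<in> space M" "t \<in> {a..b}"
  shows "(INF t\<in>{a..b}. X t \<omega>) \<le> X t \<omega>"
proof (rule cINF_lower)
  show "bdd_below ((\<lambda>t. X t \<omega>) ` {a..b})"
    by (intro bounded_imp_bdd_below compact_imp_bounded compact_continuous_image cont assms) simp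
qed fact

lemma le_path_INF:
  assumes "\<And>t. t \<in> {a..b} \<Longrightarrow> y \<le> X t \<omega>"
  shows "y \<le> (INF t\<in>{a..b}. X t \<omega>)"
  using assms ab by (intro cINF_greatest) auto

lemma INF_event_measurable: "{\<omega> \<in> space M. (INF t\<in>{a..b}. X t \<omega>) > u} \<in> sets M"
proof -
  let ?Q = "\<lambda>m n k \<omega>. u + 1 / real (Suc m) \<le> X (a + (b - a) * (real k / 2 ^ n)) \<omega>"
  have mem: "a + (b - a) * (real k / 2 ^ n) \<in> {a..b}" if "k < 2 ^ n" for k n
    by (rule affine_mem[OF dyadic_mem_unit_interval[OF that]])
  have "{\<omega> \<in> space M. (INF t\<in>{a..b}. X t \<omega>) > u} = {\<omega> \<in> space M. \<exists>m. \<forall>n. \<forall>k\<in>{..<2^n}. ?Q m n k \<omega>}"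
  proof (intro Collect_cong conj_cong refl iffI)
    fix \<omega> assume \<omega>: "\<omega> \<in> space M" and "(INF t\<in>{a..b}. X t \<omega>) > u"
    then have g: "(INF t\<in>{a..b}. X t \<omega>) - u > 0" by simp
    obtain m where m: "inverse (real (Suc m)) < (INF t\<in>{a..b}. X t \<omega>) - u" using reals_Archimedean[OF g] by auto
    have "u + 1 / real (Suc m) \<le> X t \<omega>" if "t \<in> {a..b}" for t
      using m path_INF_le[OF \<omega> that] by (simp add: inverse_eq_divide)
    then have "?Q m n k \<omega>" if "k < 2 ^ n" for n k
      using mem[OF that] by blast
    then show "\<exists>m. \<forall>n. \<forall>k\<in>{..<2^n}. ?Q m n k \<omega>" by blast
  next
    fix \<omega> assume \<omega>: "\<omega> \<in> space M" and "\<exists>m. \<forall>n. \<forall>k\<in>{..<2^n}. ?Q m n k \<omega>"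
    then obtain m where m: "\<And>n k. k < 2 ^ n \<Longrightarrow> ?Q m n k \<omega>" by blast
    have "u + 1 / real (Suc m) \<le> (INF t\<in>{a..b}. X t \<omega>)"
    proof (rule le_path_INF)
      fix t assume "t \<in> {a..b}"
      then show "u + 1 / real (Suc m) \<le> X t \<omega>" using m by (rule path_ge_of_dyadic[OF \<omega>])
    qed
    moreover have "1 / real (Suc m) > 0" by simp
    ultimately show "u < (INF t\<in>{a..b}. X t \<omega>)" by linarith
  qed
  also have "\<dots> \<in> sets M"
  proof -
    have [measurable]: "X (a + (b - a) * (real k / 2 ^ n)) \<in> borel_measurable M" if "k \<in> {..<2 ^ n}" for k n
      using X_meas[OF mem] that by simp
    show ?thesis by measurable
  qed
  finally show ?thesis .
qed

end

context ms_holder_process_measure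
begin

text \<open>Conditionally on the size of the average, the differences from the average remain a
  Gaussian process with the same covariances, so the small ball estimate applies to them with
  a constant independent of the conditioning.\<close>

lemma INF_prob_lower:
  assumes opt: "optimal_measure (cov_fun M X) a b \<nu>" and supp: "measure_support \<nu> = {a..b}"
    and v: "energy (cov_fun M X) \<nu> = v" "v > 0"
  obtains C where "C > 0"
    "\<And>u \<epsilon>. u > 0 \<Longrightarrow> 0 < \<epsilon> \<Longrightarrow> \<epsilon> \<le> 1 \<Longrightarrow> prob {\<omega> \<in> space M. (INF t\<in>{a..b}. X t \<omega>) > u}
      \<ge> \<epsilon> / sqrt (2 * pi * v) * exp (- (u + 3 * \<epsilon>)\<^sup>2 / (2 * v)) * exp (- C * \<epsilon> powr (- 1 / \<beta>))"
proof -
  define Z where "Z x = (\<lambda>\<omega>. X (a + (b - a) * x) \<omega> - average \<omega>)" for x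
  have Y2: "(\<integral>\<omega>. (average \<omega>)\<^sup>2 \<partial>M) = v" using v energy_\<nu> by simp
  define H' where "H' = {W \<in> gspace. (\<integral>\<omega>. W \<omega> * average \<omega> \<partial>M) = 0}"
  have ZH: "Z x \<in> gspace" if "x \<in> {0..1}" for x
    unfolding Z_def by (rule S.diff[OF X_gspace[OF affine_mem[OF that]] average_gspace])
  have ZH': "Z x \<in> H'" if x: "x \<in> {0..1}" for x
  proof -
    let ?t = "a + (b - a) * x"
    have "(\<integral>\<omega>. Z x \<omega> * average \<omega> \<partial>M) = (\<integral>\<omega>. X ?t \<omega> * average \<omega> - (average \<omega>)\<^sup>2 \<partial>M)"
      by (intro Bochner_Integration.integral_cong) (auto simp: Z_def power2_eq_square algebra_simps)
    also have "\<dots> = potential ?t - v"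
      using S.mult_integrable[OF X_gspace[OF affine_mem[OF x]] average_gspace] average_sq
      by (simp add: potential_def Y2)
    also have "\<dots> = 0" using potential_constant[OF opt supp affine_mem[OF x]] v by simp
    finally show ?thesis using ZH[OF x] by (simp add: H'_def)
  qed
  \<comment> \<open>After rescaling time to the unit interval, one constant has to cover both the increments
    and the initial value.\<close>
  define K' where "K' = K * (b - a) powr \<beta> + sqrt (\<integral>\<omega>. (Z 0 \<omega>)\<^sup>2 \<partial>M)"
  have K'1: "K * (b - a) powr \<beta> \<le> K'" by (simp add: K'_def)
  have Kp: "0 < K * (b - a) powr \<beta>" using K ab by simp
  then have K'0: "K' > 0" using K'1 by linarith
  have K'2: "(\<integral>\<omega>. (Z 0 \<omega>)\<^sup>2 \<partial>M) \<le> K'\<^sup>2"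
  proof -
    have "(\<integral>\<omega>. (Z 0 \<omega>)\<^sup>2 \<partial>M) = (sqrt (\<integral>\<omega>. (Z 0 \<omega>)\<^sup>2 \<partial>M))\<^sup>2" by simp
    also have "\<dots> \<le> K'\<^sup>2" using Kp by (intro power_mono) (auto simp: K'_def)
    finally show ?thesis .
  qed
  have K'3: "(\<integral>\<omega>. (Z x \<omega> - Z y \<omega>)\<^sup>2 \<partial>M) \<le> (K' * \<bar>x - y\<bar> powr \<beta>)\<^sup>2" if x: "x \<in> {0..1}" and y: "y \<in> {0..1}" for x y
  proof -
    have "(\<integral>\<omega>. (Z x \<omega> - Z y \<omega>)\<^sup>2 \<partial>M) \<le> (K * \<bar>(a + (b - a) * x) - (a + (b - a) * y)\<bar> powr \<beta>)\<^sup>2"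
      using incr[OF affine_mem[OF y] affine_mem[OF x]] by (simp add: Z_def)
    also have "(a + (b - a) * x) - (a + (b - a) * y) = (b - a) * (x - y)" by (simp add: algebra_simps)
    also have "\<bar>(b - a) * (x - y)\<bar> powr \<beta> = (b - a) powr \<beta> * \<bar>x - y\<bar> powr \<beta>"
      using ab by (simp add: abs_mult powr_mult)
    also have "(K * ((b - a) powr \<beta> * \<bar>x - y\<bar> powr \<beta>))\<^sup>2 \<le> (K' * \<bar>x - y\<bar> powr \<beta>)\<^sup>2"
      unfolding mult.assoc[symmetric] using K'1 K by (intro power_mono mult_right_mono) auto
    finally show ?thesis .
  qed
  obtain C where C: "C > 0"
    "\<And>(M'::'a measure) H Z n \<epsilon>. \<lbrakk>gaussian_space M' H; \<And>t. t \<in> {0..1} \<Longrightarrow> Z t \<in> H;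
       (\<integral>\<omega>. (Z 0 \<omega>)\<^sup>2 \<partial>M') \<le> K'\<^sup>2;
       \<And>s t. s \<in> {0..1} \<Longrightarrow> t \<in> {0..1} \<Longrightarrow> (\<integral>\<omega>. (Z s \<omega> - Z t \<omega>)\<^sup>2 \<partial>M') \<le> (K' * \<bar>s - t\<bar> powr \<beta>)\<^sup>2;
       0 < \<epsilon>; \<epsilon> \<le> 1\<rbrakk>
     \<Longrightarrow> measure M' {\<omega> \<in> space M'. \<forall>k<2^n. \<bar>Z (real k / 2 ^ n) \<omega>\<bar> \<le> \<epsilon>} \<ge> exp (- C * \<epsilon> powr (- 1 / \<beta>))"
    using small_ball[OF \<beta> K'0, where ?'w = 'a] by blast
  show ?thesis
  proof (rule that[OF C(1)])
    fix u \<epsilon> :: real assume u: "u > 0" and \<epsilon>: "0 < \<epsilon>" "\<epsilon> \<le> 1"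
    \<comment> \<open>One \<open>\<epsilon>\<close> absorbs the deviation from the average, the second makes the inequality strict. A
      third one appears in the tail estimate, as the length of the interval used there.\<close>
    define w where "w = u + 2 * \<epsilon>"
    define B where "B = {\<omega> \<in> space M. average \<omega> \<in> {w<..}}"
    have Bm[measurable]: "B \<in> sets M" unfolding B_def by measurable
    have PB: "prob B \<ge> \<epsilon> / sqrt (2 * pi * v) * exp (- (u + 3 * \<epsilon>)\<^sup>2 / (2 * v))"
    proof -
      define s where "s = sqrt v"
      have s: "s > 0" "s\<^sup>2 = v" using v by (auto simp: s_def)
      have N: "(\<lambda>\<omega>. (1/s) * average \<omega>) \<in> gspace" by (rule S.scale[OF average_gspace])
      have "(\<integral>\<omega>. ((1/s) * average \<omega>)\<^sup>2 \<partial>M) = 1"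
        using s v by (simp add: power_divide Y2)
      then have "measure std_normal {w / s<..} = measure (distr M borel (\<lambda>\<omega>. (1/s) * average \<omega>)) {w / s<..}"
        by (subst S.distr_std_normal[OF N]) auto
      also have "\<dots> = prob ((\<lambda>\<omega>. (1/s) * average \<omega>) -` {w / s<..} \<inter> space M)"
        by (rule measure_distr) auto
      also have "(\<lambda>\<omega>. (1/s) * average \<omega>) -` {w / s<..} \<inter> space M = B"
        using s by (auto simp: B_def divide_less_cancel)
      finally have "prob B = measure std_normal {w / s<..}" ..
      also have "\<dots> \<ge> \<epsilon> / s * std_normal_density (w / s + \<epsilon> / s)"
        using u \<epsilon> s by (intro std_normal_tail_lower) (auto simp: w_def)
      also have "w / s + \<epsilon> / s = (u + 3 * \<epsilon>) / s" by (simp add: w_def add_divide_distrib[symmetric])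
      also have "\<epsilon> / s * std_normal_density ((u + 3 * \<epsilon>) / s) = \<epsilon> / sqrt (2 * pi * v) * exp (- (u + 3 * \<epsilon>)\<^sup>2 / (2 * v))"
        using s by (simp add: std_normal_density_def power_divide real_sqrt_mult s_def[symmetric] mult_ac)
      finally show ?thesis .
    qed
    have lowpos: "0 < \<epsilon> / sqrt (2 * pi * v) * exp (- (u + 3 * \<epsilon>)\<^sup>2 / (2 * v))" using \<epsilon> v by simp
    then have Bpos: "prob B > 0" using PB by linarith
    define M' where "M' = uniform_measure M B"
    have [measurable_cong, simp]: "sets M' = sets M" "space M' = space M" by (simp_all add: M'_def)
    have Ab: "{w<..} \<in> sets borel" by simp
    note cond = S.conditional_gaussian_space[OF average_gspace Ab Bpos[unfolded B_def]]
      S.conditional_integral_sq[OF average_gspace Ab Bpos[unfolded B_def]]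
    have G': "gaussian_space M' H'" unfolding M'_def B_def H'_def by (rule cond(1))
    interpret G': gaussian_space M' H' by (rule G')
    have sq': "(\<integral>\<omega>. (W \<omega>)\<^sup>2 \<partial>M') = (\<integral>\<omega>. (W \<omega>)\<^sup>2 \<partial>M)" if "W \<in> H'" for W
      using cond(2)[of W] that unfolding M'_def B_def H'_def by simp
    define E where "E n = {\<omega> \<in> space M'. \<forall>k<2^n. \<bar>Z (real k / 2 ^ n) \<omega>\<bar> \<le> \<epsilon>}" for n :: nat
    note dy = dyadic_mem_unit_interval
    have Em[measurable]: "E n \<in> sets M" for n
    proof -
      have [measurable]: "Z (real k / 2 ^ n) \<in> borel_measurable M" if "k \<in> {..<2 ^ n}" for k
        using S.meas[OF ZH[OF dy]] that by simp
      have "{\<omega> \<in> space M. \<forall>k\<in>{..<2^n}. \<bar>Z (real k / 2 ^ n) \<omega>\<bar> \<le> \<epsilon>} \<in> sets M" by measurable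
      then show ?thesis by (simp add: E_def Ball_def)
    qed
    have PE: "measure M' (E n) \<ge> exp (- C * \<epsilon> powr (- 1 / \<beta>))" for n
      unfolding E_def
    proof (rule C(2)[OF G'])
      show "(\<integral>\<omega>. (Z 0 \<omega>)\<^sup>2 \<partial>M') \<le> K'\<^sup>2" using sq'[OF ZH'] K'2 by simp
      show "(\<integral>\<omega>. (Z s \<omega> - Z t \<omega>)\<^sup>2 \<partial>M') \<le> (K' * \<bar>s - t\<bar> powr \<beta>)\<^sup>2" if "s \<in> {0..1}" "t \<in> {0..1}" for s t
        using sq'[OF G'.diff[OF ZH' ZH'], OF that] K'3[OF that] by simp
    qed (use ZH' \<epsilon> in auto)
    have dec: "decseq E"
    proof (rule decseq_SucI, rule subsetI)
      fix n \<omega> assume \<omega>: "\<omega> \<in> E (Suc n)"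
      have "\<bar>Z (real k / 2 ^ n) \<omega>\<bar> \<le> \<epsilon>" if "k < 2 ^ n" for k
      proof -
        have "2 * k < 2 ^ Suc n" using that by simp
        then have "\<bar>Z (real (2 * k) / 2 ^ Suc n) \<omega>\<bar> \<le> \<epsilon>" using \<omega> unfolding E_def by blast
        moreover have "real (2 * k) / 2 ^ Suc n = real k / 2 ^ n" by simp
        ultimately show ?thesis by simp
      qed
      then show "\<omega> \<in> E n" using \<omega> by (simp add: E_def)
    qed
    have "(\<lambda>n. measure M' (E n)) \<longlonglongrightarrow> measure M' (\<Inter>n. E n)"
      by (rule G'.finite_Lim_measure_decseq) (use dec in auto)
    then have PI: "measure M' (\<Inter>n. E n) \<ge> exp (- C * \<epsilon> powr (- 1 / \<beta>))"
      by (rule LIMSEQ_le_const) (use PE in auto)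
    have "measure M' (\<Inter>n. E n) = prob (B \<inter> (\<Inter>n. E n)) / prob B"
      unfolding M'_def using Bpos by (intro measure_uniform_measure) (auto simp: emeasure_eq_measure)
    then have "prob (B \<inter> (\<Inter>n. E n)) = prob B * measure M' (\<Inter>n. E n)" using Bpos by simp
    also have "\<dots> \<ge> \<epsilon> / sqrt (2 * pi * v) * exp (- (u + 3 * \<epsilon>)\<^sup>2 / (2 * v)) * exp (- C * \<epsilon> powr (- 1 / \<beta>))"
      using PB PI lowpos by (intro mult_mono) auto
    finally have "prob (B \<inter> (\<Inter>n. E n)) \<ge> \<epsilon> / sqrt (2 * pi * v) * exp (- (u + 3 * \<epsilon>)\<^sup>2 / (2 * v)) * exp (- C * \<epsilon> powr (- 1 / \<beta>))" .
    moreover have "prob (B \<inter> (\<Inter>n. E n)) \<le> prob {\<omega> \<in> space M. (INF t\<in>{a..b}. X t \<omega>) > u}"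
    proof (rule finite_measure_mono[OF _ INF_event_measurable], rule subsetI)
      fix \<omega> assume h: "\<omega> \<in> B \<inter> (\<Inter>n. E n)"
      then have \<omega>: "\<omega> \<in> space M" and Y: "average \<omega> > w" by (auto simp: B_def)
      have dyad: "average \<omega> - \<epsilon> \<le> X (a + (b - a) * (real k / 2 ^ n)) \<omega>" if "k < 2 ^ n" for k n
      proof -
        have "\<bar>Z (real k / 2 ^ n) \<omega>\<bar> \<le> \<epsilon>" using h that by (auto simp: E_def)
        then show ?thesis by (simp add: Z_def)
      qed
      have "average \<omega> - \<epsilon> \<le> (INF t\<in>{a..b}. X t \<omega>)"
      proof (rule le_path_INF)
        fix t assume "t \<in> {a..b}"
        then show "average \<omega> - \<epsilon> \<le> X t \<omega>" using dyad by (rule path_ge_of_dyadic[OF \<omega>])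
      qed
      then have "u < (INF t\<in>{a..b}. X t \<omega>)" using Y \<epsilon> by (simp add: w_def)
      then show "\<omega> \<in> {\<omega> \<in> space M. (INF t\<in>{a..b}. X t \<omega>) > u}" using \<omega> by simp
    qed
    ultimately show "prob {\<omega> \<in> space M. (INF t\<in>{a..b}. X t \<omega>) > u}
      \<ge> \<epsilon> / sqrt (2 * pi * v) * exp (- (u + 3 * \<epsilon>)\<^sup>2 / (2 * v)) * exp (- C * \<epsilon> powr (- 1 / \<beta>))" by linarith
  qed
qed

end

text \<open>The choice \<open>\<epsilon> = u powr (- \<beta> / (\<beta> + 1))\<close> makes the loss \<open>u * \<epsilon>\<close> in the Gaussian tail and
  the small ball cost \<open>\<epsilon> powr (- 1 / \<beta>)\<close> both equal to \<open>q = u powr (1 / (\<beta> + 1))\<close>.\<close>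

lemma balanced_exponent_bound:
  fixes \<beta> v C u :: real
  assumes \<beta>: "\<beta> > 0" and v: "v > 0" and C: "C > 0" and u: "u \<ge> 1"
  defines "\<epsilon> \<equiv> u powr (- \<beta> / (\<beta> + 1))" and "q \<equiv> u powr (1 / (\<beta> + 1))"
    and "D \<equiv> 15 / (2 * v) + \<beta> + \<bar>ln (sqrt (2 * pi * v))\<bar> + C"
  shows "0 < \<epsilon>" "\<epsilon> \<le> 1"
    and "exp (- u\<^sup>2 / (2 * v) - D * q)
      \<le> \<epsilon> / sqrt (2 * pi * v) * exp (- (u + 3 * \<epsilon>)\<^sup>2 / (2 * v)) * exp (- C * \<epsilon> powr (- 1 / \<beta>))"
proof -
  show e: "0 < \<epsilon>" using u by (simp add: \<epsilon>_def)
  show e1: "\<epsilon> \<le> 1"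
  proof -
    have "\<epsilon> \<le> u powr 0" unfolding \<epsilon>_def using u \<beta> by (intro powr_mono) auto
    then show ?thesis using u by simp
  qed
  have q: "q \<ge> 1" unfolding q_def using u \<beta> by (intro ge_one_powr_ge_zero) auto
  have ue: "u * \<epsilon> = q"
  proof -
    have "u * \<epsilon> = u powr 1 * u powr (- \<beta> / (\<beta> + 1))" using u by (simp add: \<epsilon>_def)
    also have "\<dots> = u powr (1 + - \<beta> / (\<beta> + 1))" by (simp only: powr_add)
    also have "1 + - \<beta> / (\<beta> + 1) = 1 / (\<beta> + 1)" using \<beta> by (simp add: field_simps)
    finally show ?thesis by (simp add: q_def)
  qed
  have eb: "\<epsilon> powr (- 1 / \<beta>) = q"
    using \<beta> by (simp add: \<epsilon>_def q_def powr_powr)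
  have lne: "ln \<epsilon> \<ge> - \<beta> * q"
  proof -
    have "ln \<epsilon> = - \<beta> * ln q" using u \<beta> by (simp add: \<epsilon>_def q_def ln_powr)
    moreover have "ln q \<le> q" using q by (intro ln_bound) auto
    ultimately show ?thesis using \<beta> by simp
  qed
  have s: "sqrt (2 * pi * v) > 0" using v by simp
  have sq: "(u + 3 * \<epsilon>)\<^sup>2 \<le> u\<^sup>2 + 15 * q"
  proof -
    have "\<epsilon>\<^sup>2 \<le> 1" using e e1 by (simp add: power_le_one)
    then have "9 * \<epsilon>\<^sup>2 \<le> 9 * q" using q by linarith
    moreover have "(u + 3 * \<epsilon>)\<^sup>2 = u\<^sup>2 + 6 * (u * \<epsilon>) + 9 * \<epsilon>\<^sup>2" by (simp add: power2_eq_square algebra_simps)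
    ultimately show ?thesis unfolding ue by simp
  qed
  have sq': "- (u + 3 * \<epsilon>)\<^sup>2 / (2 * v) \<ge> - u\<^sup>2 / (2 * v) - 15 / (2 * v) * q"
  proof -
    have "(u + 3 * \<epsilon>)\<^sup>2 / (2 * v) \<le> (u\<^sup>2 + 15 * q) / (2 * v)" using sq v by (intro divide_right_mono) auto
    then show ?thesis by (simp add: add_divide_distrib)
  qed
  have ls: "\<bar>ln (sqrt (2 * pi * v))\<bar> * q \<ge> ln (sqrt (2 * pi * v))"
  proof -
    have "\<bar>ln (sqrt (2 * pi * v))\<bar> * 1 \<le> \<bar>ln (sqrt (2 * pi * v))\<bar> * q" using q by (intro mult_left_mono) auto
    then show ?thesis by linarith
  qed
  have "- u\<^sup>2 / (2 * v) - D * q \<le> ln \<epsilon> - ln (sqrt (2 * pi * v)) + - (u + 3 * \<epsilon>)\<^sup>2 / (2 * v) + - C * q"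
  proof -
    have "D * q = 15 / (2 * v) * q + \<beta> * q + \<bar>ln (sqrt (2 * pi * v))\<bar> * q + C * q"
      by (simp add: D_def distrib_right)
    then show ?thesis using lne sq' ls by simp
  qed
  then have "exp (- u\<^sup>2 / (2 * v) - D * q) \<le> exp (ln \<epsilon> - ln (sqrt (2 * pi * v)) + - (u + 3 * \<epsilon>)\<^sup>2 / (2 * v) + - C * q)" by simp
  also have "\<dots> = \<epsilon> / sqrt (2 * pi * v) * exp (- (u + 3 * \<epsilon>)\<^sup>2 / (2 * v)) * exp (- C * \<epsilon> powr (- 1 / \<beta>))"
    unfolding eb exp_add exp_diff exp_ln[OF e] exp_ln[OF s] ..
  finally show "exp (- u\<^sup>2 / (2 * v) - D * q)
      \<le> \<epsilon> / sqrt (2 * pi * v) * exp (- (u + 3 * \<epsilon>)\<^sup>2 / (2 * v)) * exp (- C * \<epsilon> powr (- 1 / \<beta>))" .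
qed

theorem theorem3p2:
  fixes M :: "'w measure"
    and X :: "real \<Rightarrow> 'w \<Rightarrow> real"
    and \<sigma> :: "real \<Rightarrow> real"
    and \<nu> :: "real measure"
    and a b \<beta> c :: real
  assumes "a < b"
    and "prob_space M"
    and "centered_gaussian_process M {a..b} X"
    and "\<And>\<omega>. \<omega> \<in> space M \<Longrightarrow> continuous_on {a..b} (\<lambda>t. X t \<omega>)"
    and "sigma_star_sq (cov_fun M X) a b > 0"
    and "optimal_measure (cov_fun M X) a b \<nu>"
    and "measure_support \<nu> = {a..b}"
    and "\<And>h. h \<ge> 0 \<Longrightarrow> \<sigma> h \<ge> 0"
    and "\<beta> > 0"
    and "c > 0"
    and "((\<lambda>h. h powr (-\<beta>) * \<sigma> h) \<longlongrightarrow> c) (at_right 0)"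
    and "\<And>s t. s \<in> {a..b} \<Longrightarrow> t \<in> {a..b} \<Longrightarrow>
           (\<integral>\<omega>. (X t \<omega> - X s \<omega>)\<^sup>2 \<partial>M) \<le> (\<sigma> \<bar>t - s\<bar>)\<^sup>2"
  shows "Liminf at_top (\<lambda>u::real.
           ereal (u powr (- 1 / (\<beta> + 1))) *
             (ext_ln (measure M {\<omega> \<in> space M. (INF t\<in>{a..b}. X t \<omega>) > u})
              + ereal (1 / (2 * sigma_star_sq (cov_fun M X) a b) * u\<^sup>2))) > -\<infinity>"
proof -
  obtain K where K: "K > 0"
    "\<And>s t. s \<in> {a..b} \<Longrightarrow> t \<in> {a..b} \<Longrightarrow> (\<integral>\<omega>. (X t \<omega> - X s \<omega>)\<^sup>2 \<partial>M) \<le> (K * \<bar>t - s\<bar> powr \<beta>)\<^sup>2"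
    using mean_square_holder[OF assms(2,3,1,9,10,8,11,12)] by blast
  have \<nu>: "\<nu> \<in> M1 a b" and min: "\<And>\<mu>. \<mu> \<in> M1 a b \<Longrightarrow> energy (cov_fun M X) \<nu> \<le> energy (cov_fun M X) \<mu>"
    using assms(6) by (auto simp: optimal_measure_def is_arg_min_def not_less)
  interpret prob_space M by fact
  interpret ms_holder_process_measure M X a b \<beta> K \<nu>
    by unfold_locales (use assms K \<nu> in auto)
  define v where "v = sigma_star_sq (cov_fun M X) a b"
  have v0: "v > 0" using assms(5) by (simp add: v_def)
  have v: "energy (cov_fun M X) \<nu> = v"
  proof (rule antisym)
    show "energy (cov_fun M X) \<nu> \<le> v"
      unfolding v_def sigma_star_sq_def using \<nu> min by (intro cINF_greatest) auto
    show "v \<le> energy (cov_fun M X) \<nu>"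
      unfolding v_def sigma_star_sq_def using \<nu> min
      by (intro cINF_lower) (auto intro!: bdd_belowI2[where m = "energy (cov_fun M X) \<nu>"])
  qed
  obtain C where C: "C > 0"
    "\<And>u \<epsilon>. u > 0 \<Longrightarrow> 0 < \<epsilon> \<Longrightarrow> \<epsilon> \<le> 1 \<Longrightarrow> prob {\<omega> \<in> space M. (INF t\<in>{a..b}. X t \<omega>) > u}
      \<ge> \<epsilon> / sqrt (2 * pi * v) * exp (- (u + 3 * \<epsilon>)\<^sup>2 / (2 * v)) * exp (- C * \<epsilon> powr (- 1 / \<beta>))"
    using INF_prob_lower[OF assms(6,7) v v0] by blast
  define D where "D = 15 / (2 * v) + \<beta> + \<bar>ln (sqrt (2 * pi * v))\<bar> + C"
  have "ereal (- D) \<le> Liminf at_top (\<lambda>u::real. ereal (u powr (- 1 / (\<beta> + 1))) *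
             (ext_ln (measure M {\<omega> \<in> space M. (INF t\<in>{a..b}. X t \<omega>) > u})
              + ereal (1 / (2 * v) * u\<^sup>2)))"
  proof (rule Liminf_bounded)
    have "ereal (- D) \<le> ereal (u powr (- 1 / (\<beta> + 1))) *
             (ext_ln (measure M {\<omega> \<in> space M. (INF t\<in>{a..b}. X t \<omega>) > u})
              + ereal (1 / (2 * v) * u\<^sup>2))" if u: "u \<ge> 1" for u
    proof -
      define q where "q = u powr (1 / (\<beta> + 1))"
      define p where "p = prob {\<omega> \<in> space M. (INF t\<in>{a..b}. X t \<omega>) > u}"
      note bal = balanced_exponent_bound[OF assms(9) v0 C(1) u]
      have q: "q > 0" using u by (simp add: q_def)
      have "exp (- u\<^sup>2 / (2 * v) - D * q) \<le> p"
        unfolding p_def D_def q_def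
        by (rule order_trans[OF bal(3) C(2)[OF _ bal(1,2)]]) (use u in auto)
      moreover from this have p0: "p > 0" using exp_gt_zero[of "- u\<^sup>2 / (2 * v) - D * q"] by linarith
      ultimately have "- u\<^sup>2 / (2 * v) - D * q \<le> ln p" by (simp add: ln_ge_iff)
      then have "- D * q \<le> ln p + 1 / (2 * v) * u\<^sup>2" by simp
      then have "(1 / q) * (- D * q) \<le> (1 / q) * (ln p + 1 / (2 * v) * u\<^sup>2)"
        using q by (intro mult_left_mono) auto
      then have "- D \<le> (1 / q) * (ln p + 1 / (2 * v) * u\<^sup>2)" using q by simp
      moreover have "u powr (- 1 / (\<beta> + 1)) = 1 / q"
        by (simp add: q_def powr_minus_divide[symmetric])
      ultimately show ?thesis
        unfolding p_def[symmetric] ext_ln_def using p0 by simp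
    qed
    then show "\<forall>\<^sub>F u in at_top. ereal (- D) \<le> ereal (u powr (- 1 / (\<beta> + 1))) *
             (ext_ln (measure M {\<omega> \<in> space M. (INF t\<in>{a..b}. X t \<omega>) > u})
              + ereal (1 / (2 * v) * u\<^sup>2))"
      using eventually_ge_at_top[of "1::real"] by (rule eventually_mono[rotated])
  qed
  moreover have "- \<infinity> < ereal (- D)" by simp
  ultimately show ?thesis unfolding v_def by (rule less_le_trans[rotated])
qed

end
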